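(* Let $K$ be an irreducible Markov kernel on $\mathcal{X}=\{1,\dots,n\}$ with stationary distribution $\pi$, Dirichlet form $\mathcal{E}$ and logarithmic Sobolev constant $\alpha$. For integers $d\ge 2$ and $m\ge 0$, let $\alpha_{d,m}$ be defined by $$\frac{1}{\alpha_{d,m}}:=\inf\Big\{\gamma\in\mathbb{R}\;:\;\exists\, p_1,\dots,p_n\in\mathbb{R}[t]_{2d}\text{ with } \gamma\,\mathcal{E}(x,x)-\sum_{i=1}^n\pi_i p_i(x_i)\in \mathsf{SOS}_d(S^\pi)\text{ and } S_m(t)p_i(t)-2t^2(t-1)R_m(t)\in \mathsf{SOS}_{d+\lceil m/2\rceil}([0,\pi_i^{-1/2}])\ (i=1,\dots,n)\Big\}.$$ Then this program is feasible, $0<\alpha_{d,m}\le\alpha$, and $$\lim_{m\to\infty}\lim_{d\to\infty}\alpha_{d,m}=\alpha.$$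
   Context: A Markov kernel $K$ on $\mathcal{X}$ is a matrix with $K_{ij}\ge0$, $\sum_j K_{ij}=1$; irreducibility gives a unique stationary distribution $\pi$ ($\pi K=\pi$) with all $\pi_i>0$. Dirichlet form: $\mathcal{E}(x,x)=\frac12\sum_{i,j}\pi_iK_{ij}(x_i-x_j)^2$. Write $\|x\|_\pi^2=\sum_i\pi_ix_i^2$ and $\mathrm{Ent}_\pi[x^2]=\sum_i\pi_ix_i^2\log(x_i^2/\|x\|_\pi^2)$. The logarithmic Sobolev constant $\alpha$ is the largest constant with $\mathcal{E}(x,x)\ge\alpha\,\mathrm{Ent}_\pi[x^2]$ for all $x\in\mathbb{R}^n$. Let $S^\pi=\{x\in\mathbb{R}^n_{\ge0}:\|x\|_\pi^2=1\}$. $\Sigma[x]_{2k}$ denotes sums of squares of polynomials of degree $\le k$, and $\mathbb{R}[x]_k$ polynomials of degree $\le k$. Define $\mathsf{SOS}_d(S^\pi)=\{f\in\mathbb{R}[x]_{2d}: f=\sigma_0+\sum_{i=1}^n x_i\sigma_i+\phi\,(\|x\|_\pi^2-1),\ \sigma_0\in\Sigma[x]_{2d},\ \sigma_i\in\Sigma[x]_{2d-2},\ \phi\in\mathbb{R}[x]_{2d-2}\}$. For an interval $[a,b]$, $\mathsf{SOS}_k([a,b])$ is the set of univariate polynomials of degree at most $2k$ that are nonnegative on $[a,b]$. For $m\ge0$, $\overline{r_m}(t)$ denotes the $(m+1,m)$ Padé approximant of $\log t$ at $t=1$, i.e. the rational function $R/S$ with $\deg R\le m+1$, $\deg S\le m$,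 $S(1)=1$, and $\log t-R(t)/S(t)=O((t-1)^{2m+2})$ as $t\to1$; it is written $\overline{r_m}(t)=(t-1)R_m(t)/S_m(t)$ with $R_m,S_m$ polynomials of degree $m$ and $S_m>0$ on $(0,\infty)$. *)

theory Defs
  imports "HOL-Analysis.Analysis" "HOL-Computational_Algebra.Polynomial" "HOL-Library.Landau_Symbols"
begin

text \<open>States are 0,...,n-1; vectors x in R^n are functions nat => real (only x i, i<n, matter).\<close>

definition markov_kernel :: "nat \<Rightarrow> (nat \<Rightarrow> nat \<Rightarrow> real) \<Rightarrow> bool" where
  "markov_kernel n K \<longleftrightarrow> (\<forall>i<n. \<forall>j<n. K i j \<ge> 0) \<and> (\<forall>i<n. (\<Sum>j<n. K i j) = 1)"

fun kpow :: "nat \<Rightarrow> (nat \<Rightarrow> nat \<Rightarrow> real) \<Rightarrow> nat \<Rightarrow> nat \<Rightarrow> nat \<Rightarrow> real" where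
  "kpow n K 0 i j = (if i = j then 1 else 0)"
| "kpow n K (Suc k) i j = (\<Sum>l<n. kpow n K k i l * K l j)"

definition irreducible_kernel :: "nat \<Rightarrow> (nat \<Rightarrow> nat \<Rightarrow> real) \<Rightarrow> bool" where
  "irreducible_kernel n K \<longleftrightarrow> (\<forall>i<n. \<forall>j<n. \<exists>k. kpow n K k i j > 0)"

definition stationary_dist :: "nat \<Rightarrow> (nat \<Rightarrow> nat \<Rightarrow> real) \<Rightarrow> (nat \<Rightarrow> real) \<Rightarrow> bool" where
  "stationary_dist n K \<pi> \<longleftrightarrow> (\<forall>i<n. \<pi> i \<ge> 0) \<and> (\<Sum>i<n. \<pi> i) = 1
     \<and> (\<forall>j<n. (\<Sum>i<n. \<pi> i * K i j) = \<pi> j)"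

definition dirichlet :: "nat \<Rightarrow> (nat \<Rightarrow> nat \<Rightarrow> real) \<Rightarrow> (nat \<Rightarrow> real) \<Rightarrow> (nat \<Rightarrow> real) \<Rightarrow> real" where
  "dirichlet n K \<pi> x = (1/2) * (\<Sum>i<n. \<Sum>j<n. \<pi> i * K i j * (x i - x j)^2)"

definition pi_norm2 :: "nat \<Rightarrow> (nat \<Rightarrow> real) \<Rightarrow> (nat \<Rightarrow> real) \<Rightarrow> real" where
  "pi_norm2 n \<pi> x = (\<Sum>i<n. \<pi> i * (x i)^2)"

definition entropy :: "nat \<Rightarrow> (nat \<Rightarrow> real) \<Rightarrow> (nat \<Rightarrow> real) \<Rightarrow> real" where
  "entropy n \<pi> x = (\<Sum>i<n. \<pi> i * (x i)^2 * ln ((x i)^2 / pi_norm2 n \<pi> x))"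

definition log_sobolev :: "nat \<Rightarrow> (nat \<Rightarrow> nat \<Rightarrow> real) \<Rightarrow> (nat \<Rightarrow> real) \<Rightarrow> real" where
  "log_sobolev n K \<pi> = Sup {a. \<forall>x. dirichlet n K \<pi> x \<ge> a * entropy n \<pi> x}"

definition exps :: "nat \<Rightarrow> nat \<Rightarrow> (nat \<Rightarrow> nat) set" where
  "exps n k = {a. (\<forall>i\<ge>n. a i = 0) \<and> (\<Sum>i<n. a i) \<le> k}"

definition mpoly_fun :: "nat \<Rightarrow> nat \<Rightarrow> ((nat \<Rightarrow> real) \<Rightarrow> real) \<Rightarrow> bool" where
  "mpoly_fun n k f \<longleftrightarrow> (\<exists>c :: (nat \<Rightarrow> nat) \<Rightarrow> real.
      \<forall>x. f x = (\<Sum>a\<in>exps n k. c a * (\<Prod>i<n. (x i) ^ (a i))))"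

definition sos_mpoly :: "nat \<Rightarrow> nat \<Rightarrow> ((nat \<Rightarrow> real) \<Rightarrow> real) \<Rightarrow> bool" where
  "sos_mpoly n k f \<longleftrightarrow> (\<exists>qs. (\<forall>q\<in>set qs. mpoly_fun n k q) \<and> (\<forall>x. f x = (\<Sum>q\<leftarrow>qs. (q x)^2)))"

definition SOS_Spi :: "nat \<Rightarrow> (nat \<Rightarrow> real) \<Rightarrow> nat \<Rightarrow> ((nat \<Rightarrow> real) \<Rightarrow> real) \<Rightarrow> bool" where
  "SOS_Spi n \<pi> d f \<longleftrightarrow> mpoly_fun n (2*d) f \<and>
     (\<exists>\<sigma>0 \<sigma> \<phi>. sos_mpoly n d \<sigma>0 \<and> (\<forall>i<n. sos_mpoly n (d - 1) (\<sigma> i)) \<and> mpoly_fun n (2*d - 2) \<phi>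
        \<and> (\<forall>x. f x = \<sigma>0 x + (\<Sum>i<n. x i * \<sigma> i x) + \<phi> x * (pi_norm2 n \<pi> x - 1)))"

definition SOS_interval :: "nat \<Rightarrow> real \<Rightarrow> real \<Rightarrow> real poly \<Rightarrow> bool" where
  "SOS_interval k a b p \<longleftrightarrow> degree p \<le> 2*k \<and> (\<forall>t\<in>{a..b}. poly p t \<ge> 0)"

text \<open>(t-1) R / S is the (m+1,m) Pade approximant of log t at t = 1.\<close>
definition pade_log :: "nat \<Rightarrow> real poly \<Rightarrow> real poly \<Rightarrow> bool" where
  "pade_log m R S \<longleftrightarrow> degree R \<le> m \<and> degree S \<le> m \<and> poly S 1 = 1 \<and>
     (\<lambda>t. ln t - (t - 1) * poly R t / poly S t) \<in> O[at 1](\<lambda>t. (t - 1) ^ (2*m + 2))"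

definition feasible_gammas :: "nat \<Rightarrow> (nat \<Rightarrow> nat \<Rightarrow> real) \<Rightarrow> (nat \<Rightarrow> real) \<Rightarrow> real poly \<Rightarrow> real poly
    \<Rightarrow> nat \<Rightarrow> nat \<Rightarrow> real set" where
  "feasible_gammas n K \<pi> Rm Sm d m = {\<gamma>. \<exists>p :: nat \<Rightarrow> real poly.
      (\<forall>i<n. degree (p i) \<le> 2*d)
    \<and> SOS_Spi n \<pi> d (\<lambda>x. \<gamma> * dirichlet n K \<pi> x - (\<Sum>i<n. \<pi> i * poly (p i) (x i)))
    \<and> (\<forall>i<n. SOS_interval (d + nat \<lceil>real m / 2\<rceil>) 0 (1 / sqrt (\<pi> i))
              (Sm * p i - [:0, 0, 2:] * [:-1, 1:] * Rm))}"

definition alpha_dm :: "nat \<Rightarrow> (nat \<Rightarrow> nat \<Rightarrow> real) \<Rightarrow> (nat \<Rightarrow> real) \<Rightarrow> real poly \<Rightarrow> real poly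
    \<Rightarrow> nat \<Rightarrow> nat \<Rightarrow> real" where
  "alpha_dm n K \<pi> Rm Sm d m = 1 / Inf (feasible_gammas n K \<pi> Rm Sm d m)"

end

theory Submission
  imports Defs
begin

text \<open>
  Write $r_m = (t-1)R_m/S_m$. The Pade condition forces $S_m = S_m(0) \sum_k {m \choose k}{m+1 \choose k} t^k$
  and $r_m' = 1/t + (S_m(0)/S_m)^2 (t-1)^{2m+1}/t$, whence $\log t \le r_m(t) \le t-1$ and
  $t^2(r_m(t) - \log t) = O((t-1)^2/m)$ on bounded intervals. The lower bound by $\log$ makes every feasible
  $\gamma$ a logarithmic Sobolev constant; the upper bound shows that $p_i = t^4 - t^2$ is feasible at $d = 2$,
  where a Poincare inequality along paths provides an explicit sum of squares.

  For the limit, $\gamma = 1/\alpha + \epsilon$ and a polynomial $p = t^2 - 1 + (t-1)^2 h$ slightly above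
  $2t^2 r_m$ give a polynomial $f$ that dominates $c\tau$ on the orthant of the sphere, where
  $\tau = \sum_i \pi_i (x_i-1)^2$. It vanishes at the point $1$, so the Positivstellensatz does not apply to $f$ itself.
  Modulo the sphere, however, $f = Q - \sum_i \pi_i k(x_i)(x_i-1)^3 - \mu\tau^2/4$ with $Q - c\tau$ a positive
  semidefinite quadratic form in $x - 1$. Splitting $f = (1-s)f + sf$ with $s = (1-\tau/4)^{2N}$, so that
  $\tau$ divides $1-s$, writes $f$ as squares plus squares times strictly positive polynomials.

  Strictly positive polynomials lie in the quadratic module: penalty terms $x_i(1-x_i/B)^{2N}$ and $(\|x\|^2-1)^2$
  reduce to positivity on the box $[-B,B]^n$, where Bernstein expansions have positive coefficients, and
  $B \pm x_i$ are sums of squares modulo the sphere, a class closed under multiplication.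
\<close>

section \<open>Pade approximants of the logarithm\<close>

text \<open>Constants are the obstruction. The interval constraints give p_i(1) >= 0, so no \<gamma>
  makes the certified expression positive at the point 1, and every p_i must touch 2 t^2 log t there
  to first order. Hence all errors, that of r_m as well as that of p, are measured against (t-1)^2
  and not uniformly: their averages are multiples of \<tau>, and the slack \<epsilon> E dominates
  \<tau> by the Poincare inequality. The factor t^2 takes care of the other end, since r_m - log t
  is unbounded at 0. The Pade pair is known only through its order of contact. Operators that kill
  t^j one after the other remove the logarithm and the unknown numerator, and what is left is a
  polynomial of degree at most m with a zero of order m, which determines S up to a factor. The base
  1 - \<tau>/4 of s comes from \<tau> <= 2 on the nonnegative part of the sphere, which keeps it in
  [1/2, 1]; the even exponent makes s a square.\<close>

lemma fps_X_power_dvd_iff: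
  fixes F :: "'a::field fps"
  shows "fps_X ^ N dvd F \<longleftrightarrow> (\<forall>k<N. fps_nth F k = 0)"
proof
  assume "fps_X ^ N dvd F"
  then show "\<forall>k<N. fps_nth F k = 0" by (auto simp: dvd_def fps_X_power_mult_nth)
next
  assume "\<forall>k<N. fps_nth F k = 0"
  then have "F = fps_X ^ N * fps_shift N F"
    by (intro fps_ext) (auto simp: fps_X_power_mult_nth)
  then show "fps_X ^ N dvd F" by (rule dvdI)
qed

lemma fps_X_power_dvd_deriv:
  fixes F :: "'a::field fps"
  assumes "fps_X ^ Suc N dvd F"
  shows "fps_X ^ N dvd fps_deriv F"
  using assms unfolding fps_X_power_dvd_iff by simp

lemma has_fps_expansion_ln_real: "(\<lambda>x::real. ln (1 + x)) has_fps_expansion fps_ln 1"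
proof (rule has_fps_expansionI)
  have "eventually (\<lambda>x::real. x \<in> {-1<..<1}) (nhds 0)"
    by (rule eventually_nhds_in_open) auto
  then show "\<forall>\<^sub>F u::real in nhds 0. (\<lambda>n. fps_nth (fps_ln 1) n * u ^ n) sums ln (1 + u)"
  proof eventually_elim
    case (elim u)
    have "(\<lambda>n. (-1)^n * (1 / real (n + 1)) * u^(Suc n)) sums ln (1 + u)"
    proof -
      have "summable (\<lambda>n. (-1)^n * (1 / real (n + 1)) * u^(Suc n))"
      proof (rule summable_comparison_test')
        show "summable (\<lambda>n. \<bar>u\<bar> ^ n)" using elim by (intro summable_geometric) auto
        show "norm ((-1)^n * (1 / real (n + 1)) * u^(Suc n)) \<le> \<bar>u\<bar> ^ n" if "n \<ge> 0" for n
        proof -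
          have "\<bar>u\<bar> * \<bar>u\<bar> ^ n \<le> 1 * \<bar>u\<bar> ^ n" using elim by (intro mult_right_mono) auto
          also have "\<dots> \<le> (1 + real n) * \<bar>u\<bar> ^ n" by (intro mult_right_mono) auto
          finally show ?thesis by (simp add: abs_mult power_abs divide_le_eq mult.commute)
        qed
      qed
      moreover have "ln (1 + u) = (\<Sum>n. (-1)^n * (1 / real (n + 1)) * u^(Suc n))"
        using ln_series[of "1 + u"] elim by simp
      ultimately show ?thesis by (simp add: sums_iff)
    qed
    then have "(\<lambda>n. fps_nth (fps_ln 1) (Suc n) * u ^ (Suc n)) sums ln (1 + u)"
      by (simp add: fps_ln_nth)
    then show ?case by (subst (asm) sums_Suc_iff) simp
  qed
qed

text \<open>If the subdegree j were below N, f(x) / x^j would tend to the nonzero leading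
  coefficient, while the growth bound forces the limit 0.\<close>

lemma has_fps_expansion_bigo_imp_dvd:
  fixes f :: "real \<Rightarrow> real"
  assumes f: "f has_fps_expansion F" and O: "f \<in> O[at 0](\<lambda>x. x ^ N)"
  shows "fps_X ^ N dvd F"
proof (rule ccontr)
  assume *: "\<not> fps_X ^ N dvd F"
  define j where "j = subdegree F"
  have "F \<noteq> 0" using * by auto
  then have nz: "fps_nth F j \<noteq> 0" by (simp add: j_def)
  have "j < N"
    using * unfolding fps_X_power_dvd_iff j_def
    by (meson le_less_trans not_less nth_less_subdegree_zero)
  define g where "g = (\<lambda>x. if x = 0 then fps_nth F j else f x / x ^ j)"
  have "g has_fps_expansion fps_shift j F"
    unfolding g_def by (rule has_fps_expansion_shift[OF f]) (auto simp: j_def)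
  from has_fps_expansion_imp_continuous[OF this, of UNIV]
  have g1: "g \<midarrow>0\<rightarrow> fps_nth F j" by (simp add: isCont_def g_def)
  from O obtain C where C: "eventually (\<lambda>x. norm (f x) \<le> C * norm (x ^ N)) (at 0)"
    by (elim landau_o.bigE)
  have "g \<midarrow>0\<rightarrow> 0"
  proof (rule Lim_null_comparison)
    show "\<forall>\<^sub>F x in at 0. norm (g x) \<le> C * \<bar>x\<bar> ^ (N - j)"
      using C eventually_neq_at_within[of 0]
    proof eventually_elim
      case (elim x)
      have "\<bar>x\<bar> ^ N = \<bar>x\<bar> ^ (N - j) * \<bar>x\<bar> ^ j"
        using \<open>j < N\<close> by (simp flip: power_add)
      then show ?case
        using elim by (simp add: g_def power_abs divide_le_eq mult.assoc)
    qed
    have "((\<lambda>x. C * \<bar>x\<bar> ^ (N - j)) \<longlongrightarrow> C * \<bar>0\<bar> ^ (N - j)) (at (0::real))"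
      by (intro tendsto_intros)
    then show "((\<lambda>x. C * \<bar>x\<bar> ^ (N - j)) \<longlongrightarrow> 0) (at (0::real))"
      using \<open>j < N\<close> by (simp add: power_0_left)
  qed
  with g1 nz show False using LIM_unique by blast
qed

section \<open>Taylor expansion of polynomials at t = 1\<close>

definition fps_at_one :: "real poly \<Rightarrow> real fps" where
  "fps_at_one p = fps_of_poly (pcompose p [:1, 1:])"

lemma fps_at_one_add: "fps_at_one (p + q) = fps_at_one p + fps_at_one q"
  by (simp add: fps_at_one_def pcompose_add fps_of_poly_add)

lemma fps_at_one_diff: "fps_at_one (p - q) = fps_at_one p - fps_at_one q"
  by (simp add: fps_at_one_def pcompose_diff fps_of_poly_diff)

lemma fps_at_one_mult: "fps_at_one (p * q) = fps_at_one p * fps_at_one q"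
  by (simp add: fps_at_one_def pcompose_mult fps_of_poly_mult)

lemma fps_at_one_smult: "fps_at_one (smult c p) = fps_const c * fps_at_one p"
  by (simp add: fps_at_one_def pcompose_smult fps_of_poly_smult)

lemma fps_at_one_pCons_0: "fps_at_one (pCons 0 p) = (1 + fps_X) * fps_at_one p"
  by (simp add: fps_at_one_def pcompose_pCons fps_of_poly_linear fps_of_poly_mult add.commute
      del: mult_pCons_left)

lemma fps_at_one_deriv: "fps_at_one (pderiv p) = fps_deriv (fps_at_one p)"
  by (simp add: fps_at_one_def pderiv_pcompose pderiv_pCons flip: fps_of_poly_pderiv)

lemma has_fps_expansion_at_one: "(\<lambda>x. poly p (1 + x)) has_fps_expansion fps_at_one p"
  unfolding has_fps_expansion_def fps_at_one_def by (simp add: poly_pcompose algebra_simps)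

lemma pcompose_power: "pcompose (p ^ n) q = pcompose p q ^ n"
  by (induction n) (simp_all add: pcompose_mult pcompose_1)

text \<open>The shifted polynomial has no coefficient below N and none above. Both the remainder of
  the iteration and the Wronskian are pinned down in this way, up to one constant.\<close>

lemma fps_at_one_dvd_imp:
  assumes "fps_X ^ N dvd fps_at_one p" and "degree p \<le> N"
  shows "\<exists>c. p = smult c ([:-1, 1:] ^ N)"
proof -
  let ?q = "pcompose p [:1, 1:]"
  have "degree ?q \<le> N" using assms(2) by (simp add: degree_pcompose)
  moreover have "\<forall>k<N. coeff ?q k = 0"
    using assms(1) by (simp add: fps_X_power_dvd_iff fps_at_one_def)
  ultimately have q: "?q = monom (coeff ?q N) N"
    by (intro poly_eqI) (metis coeff_eq_0 coeff_monom le_less_trans nat_neq_iff)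
  have "p = pcompose ?q [:-1, 1:]"
    by (simp add: pcompose_pCons pcompose_idR flip: pcompose_assoc)
  also have "\<dots> = smult (coeff ?q N) ([:-1, 1:] ^ N)"
    by (subst q) (simp add: monom_altdef pcompose_smult pcompose_power pcompose_pCons)
  finally show ?thesis by blast
qed

text \<open>Iterating $t\,d/dt - j$ for $j = 0, 1, \dots$ sends $F$ to $t^j F^{(j)}$; for $F = P \log t + Q$ the result is
  \<open>log_part P j\<close> $\log t$ + \<open>rat_part P Q j\<close>. After $m+2$ steps only the rational part survives.\<close>

definition euler_op :: "nat \<Rightarrow> real poly \<Rightarrow> real poly" where
  "euler_op j p = pCons 0 (pderiv p) - smult (real j) p"

lemma coeff_euler_op: "coeff (euler_op j p) k = (real k - real j) * coeff p k"
  by (cases k) (auto simp: euler_op_def coeff_pderiv algebra_simps)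

primrec log_part :: "real poly \<Rightarrow> nat \<Rightarrow> real poly" where
  "log_part P 0 = P"
| "log_part P (Suc j) = euler_op j (log_part P j)"

primrec rat_part :: "real poly \<Rightarrow> real poly \<Rightarrow> nat \<Rightarrow> real poly" where
  "rat_part P Q 0 = Q"
| "rat_part P Q (Suc j) = log_part P j + euler_op j (rat_part P Q j)"

lemma coeff_log_part: "coeff (log_part P j) k = (\<Prod>i<j. real k - real i) * coeff P k"
  by (induction j) (auto simp: coeff_euler_op algebra_simps)

lemma coeff_rat_part_zero: "coeff P k = 0 \<Longrightarrow> coeff Q k = 0 \<Longrightarrow> coeff (rat_part P Q j) k = 0"
  by (induction j) (auto simp: coeff_euler_op coeff_log_part)

lemma prod_diff_fact: "(\<Prod>i<k. real k - real i) = fact k"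
  by (simp add: fact_prod_rev lessThan_atLeast0)

text \<open>The step with j = k multiplies the coefficient of t^k by k - k = 0, so \<open>Q\<close>
  is forgotten and only the contribution k! P_k of the logarithmic part remains. The later steps
  multiply it by -1, ..., -l.\<close>

lemma coeff_rat_part:
  "coeff (rat_part P Q (Suc (k + l))) k = fact k * coeff P k * ((-1) ^ l * fact l)"
proof (induction l)
  case 0
  then show ?case by (simp add: coeff_euler_op coeff_log_part prod_diff_fact)
next
  case (Suc l)
  have "coeff (log_part P (Suc (k + l))) k = 0"
    unfolding coeff_log_part by (auto simp: prod_zero_iff simp del: prod.lessThan_Suc)
  then have "coeff (rat_part P Q (Suc (k + Suc l))) k
      = (real k - real (Suc (k + l))) * coeff (rat_part P Q (Suc (k + l))) k"
    by (simp del: log_part.simps add: coeff_euler_op rat_part.simps(2)[of P Q "Suc (k+l)"])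
  also have "\<dots> = fact k * coeff P k * ((-1) ^ Suc l * fact (Suc l))"
    unfolding Suc by (simp add: algebra_simps)
  finally show ?case .
qed

text \<open>Each step differentiates once and so costs one order of vanishing.\<close>

lemma euler_iterates_dvd:
  assumes "fps_X ^ N dvd fps_at_one P * fps_ln 1 + fps_at_one Q" and "j \<le> N"
  shows "fps_X ^ (N - j) dvd fps_at_one (log_part P j) * fps_ln 1 + fps_at_one (rat_part P Q j)"
  using assms(2)
proof (induction j)
  case 0
  then show ?case using assms(1) by simp
next
  case (Suc j)
  let ?p = "log_part P j" and ?q = "rat_part P Q j"
  let ?G = "fps_at_one ?p * fps_ln 1 + fps_at_one ?q"
  have inv: "(1 + fps_X) * inverse (1 + fps_X :: real fps) = 1"
    by (simp add: inverse_mult_eq_1')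
  have d: "fps_X ^ Suc (N - Suc j) dvd ?G"
    using Suc by (simp add: Suc_diff_Suc)
  then have d2: "fps_X ^ (N - Suc j) dvd ?G"
    by (metis dvd_trans le_imp_power_dvd lessI less_imp_le)
  \<comment> \<open>The last summand is zero. It isolates the fact that \<open>fps_ln 1\<close> has
    derivative 1/(1 + X); the rest is a ring identity.\<close>
  have "fps_at_one (log_part P (Suc j)) * fps_ln 1 + fps_at_one (rat_part P Q (Suc j))
      = (1 + fps_X) * fps_deriv ?G - fps_const (real j) * ?G
        + fps_at_one ?p * (1 - (1 + fps_X) * inverse (1 + fps_X))"
    by (simp add: euler_op_def fps_at_one_add fps_at_one_diff fps_at_one_mult fps_at_one_smult
        fps_at_one_pCons_0 fps_at_one_deriv fps_ln_deriv algebra_simps)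
  also have "\<dots> = (1 + fps_X) * fps_deriv ?G - fps_const (real j) * ?G"
    unfolding inv by simp
  finally show ?case
    by (simp only:) (intro dvd_diff dvd_mult fps_X_power_dvd_deriv[OF d] d2)
qed

text \<open>Clearing the denominator preserves the order of contact because \<open>S\<close> is
  bounded near 1, and S log t - (t-1) R has the shape P log t + Q of the iteration.\<close>

lemma pade_log_fps_dvd:
  assumes "pade_log m R S"
  shows "fps_X ^ (2*m + 2) dvd fps_at_one S * fps_ln 1 + fps_at_one (- ([:-1, 1:] * R))"
proof (rule has_fps_expansion_bigo_imp_dvd)
  define D where "D = (\<lambda>t. ln t - (t - 1) * poly R t / poly S t)"
  show "(\<lambda>x. poly S (1 + x) * ln (1 + x) + poly (- ([:-1, 1:] * R)) (1 + x))
      has_fps_expansion (fps_at_one S * fps_ln 1 + fps_at_one (- ([:-1, 1:] * R)))"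
    by (intro has_fps_expansion_add has_fps_expansion_mult has_fps_expansion_at_one has_fps_expansion_ln_real)
  have S1: "poly S 1 = 1" using assms by (simp add: pade_log_def)
  from assms obtain C where C: "C > 0" "eventually (\<lambda>t. norm (D t) \<le> C * norm ((t - 1) ^ (2*m+2))) (at 1)"
    unfolding pade_log_def D_def by (elim conjE landau_o.bigE)
  then have C': "eventually (\<lambda>x. norm (D (1 + x)) \<le> C * norm (x ^ (2*m+2))) (at 0)"
    by (subst (asm) eventually_at_to_0) (simp add: add.commute)
  have "((\<lambda>x. poly S (1 + x)) \<longlongrightarrow> poly S (1 + 0)) (at 0)" by (intro tendsto_intros)
  \<comment> \<open>Radius 1/2 around \<open>poly S 1 = 1\<close> keeps \<open>S\<close> nonzero for
    the division and at most 2 in absolute value.\<close>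
  then have "eventually (\<lambda>x. dist (poly S (1 + x)) 1 < 1/2) (at 0)"
    using S1 by (auto dest: tendstoD[where e = "1/2"])
  then have "eventually (\<lambda>x. norm (poly S (1 + x) * ln (1 + x) + poly (- ([:-1, 1:] * R)) (1 + x))
      \<le> (2 * C) * norm (x ^ (2*m+2))) (at 0)"
    using C'
  proof eventually_elim
    case (elim x)
    then have nz: "poly S (1 + x) \<noteq> 0" and le: "\<bar>poly S (1 + x)\<bar> \<le> 2"
      by (auto simp: dist_real_def abs_if split: if_splits)
    have "poly S (1 + x) * ln (1 + x) + poly (- ([:-1, 1:] * R)) (1 + x) = poly S (1 + x) * D (1 + x)"
      using nz by (simp add: D_def field_simps)
    then have "norm (poly S (1 + x) * ln (1 + x) + poly (- ([:-1, 1:] * R)) (1 + x))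
        = \<bar>poly S (1 + x)\<bar> * norm (D (1 + x))" by (simp add: abs_mult)
    also have "\<dots> \<le> 2 * (C * norm (x ^ (2*m+2)))"
      using le elim by (intro mult_mono) auto
    finally show ?case by simp
  qed
  then show "(\<lambda>x. poly S (1 + x) * ln (1 + x) + poly (- ([:-1, 1:] * R)) (1 + x)) \<in> O[at 0](\<lambda>x. x ^ (2*m+2))"
    by (rule landau_o.bigI[rotated]) (use C in simp)
qed

text \<open>The linear coefficient of S log t - (t-1) R is S(1) - R(1). The value is what later lets
  (t-1)^2 be split off from 2 t^2 r - (t^2 - 1).\<close>

lemma pade_log_numerator_at_one:
  assumes "pade_log m R S"
  shows "poly R 1 = 1"
proof -
  have "fps_nth (fps_at_one S * fps_ln 1 + fps_at_one (- ([:-1, 1:] * R))) 1 = 0"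
    using pade_log_fps_dvd[OF assms] unfolding fps_X_power_dvd_iff
    by (simp del: fps_add_nth mult_pCons_left)
  moreover have "fps_at_one (- ([:-1, 1:] * R)) = - (fps_X * fps_at_one R)"
    by (simp add: fps_at_one_pCons_0 fps_at_one_diff algebra_simps)
  moreover have "fps_nth (fps_at_one p) 0 = poly p 1" for p
    by (simp add: fps_at_one_def flip: poly_0_coeff_0) (simp add: poly_pcompose)
  ultimately show ?thesis
    using assms by (simp add: fps_mult_nth fps_ln_nth pade_log_def)
qed

text \<open>The iterated remainder is c (t-1)^m, and by \<open>coeff_rat_part\<close> its
  coefficients are those of \<open>S\<close> up to factorials and signs.\<close>

lemma pade_log_denominator_coeff:
  assumes "pade_log m R S" and "k \<le> m"
  shows "coeff S k = poly S 0 * real (m choose k) * real (Suc m choose k)"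
proof -
  define Q where "Q = - ([:-1, 1:] * R)"
  have degS: "degree S \<le> m" and "degree R \<le> m" using assms by (auto simp: pade_log_def)
  have degQ: "degree Q \<le> Suc m"
    unfolding Q_def degree_minus
    by (rule order_trans[OF degree_mult_le]) (use \<open>degree R \<le> m\<close> in simp)
  have Scz: "coeff S k = 0" if "k > m" for k using degS that by (intro coeff_eq_0) simp
  \<comment> \<open>m + 1 steps annihilate the logarithm. One more removes the coefficient of
    t^(m+1), the last trace of \<open>Q\<close>, and contact of order m is still left.\<close>
  have "coeff (log_part S (m+2)) k = 0" for k
    unfolding coeff_log_part by (cases "k \<le> m") (auto simp: Scz prod_zero_iff)
  then have "log_part S (m+2) = 0" by (intro poly_eqI) simp
  moreover have "fps_X ^ (2*m+2 - (m+2)) dvd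
      fps_at_one (log_part S (m+2)) * fps_ln 1 + fps_at_one (rat_part S Q (m+2))"
    by (rule euler_iterates_dvd) (use pade_log_fps_dvd[OF assms(1)] in \<open>simp_all add: Q_def\<close>)
  ultimately have dvd: "fps_X ^ m dvd fps_at_one (rat_part S Q (m+2))"
    by (simp add: fps_at_one_def)
  have coef: "coeff (rat_part S Q (m+2)) k = fact k * coeff S k * ((-1) ^ (Suc m - k) * fact (Suc m - k))"
    if "k \<le> Suc m" for k
    using coeff_rat_part[of S Q k "Suc m - k"] that by simp
  have "degree (rat_part S Q (m+2)) \<le> m"
  proof (rule degree_le, intro allI impI)
    fix k assume "m < k"
    show "coeff (rat_part S Q (m+2)) k = 0"
    proof (cases "k = Suc m")
      case True then show ?thesis using coef[of k] Scz[of k] by simp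
    next
      case False then show ?thesis
        using \<open>m < k\<close> degQ by (intro coeff_rat_part_zero Scz coeff_eq_0) auto
    qed
  qed
  from fps_at_one_dvd_imp[OF dvd this] obtain c where c: "rat_part S Q (m+2) = smult c ([:-1, 1:] ^ m)" by blast
  \<comment> \<open>The alternating signs on both sides cancel, and k! (m+1-k)! becomes the second
    binomial coefficient.\<close>
  have eq: "coeff S k = - c / fact (Suc m) * real (m choose k) * real (Suc m choose k)" if "k \<le> m" for k
  proof -
    have "fact k * coeff S k * ((-1) ^ (Suc m - k) * fact (Suc m - k)) = c * ((-1) ^ (m - k) * real (m choose k))"
      using coef[of k] that unfolding c by (simp add: coeff_linear_poly_power mult_ac)
    moreover have "(-1::real) ^ (Suc m - k) = - ((-1) ^ (m - k))"
      using that by (simp add: Suc_diff_le)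
    ultimately have "(-1) ^ (m - k) * (fact k * coeff S k * fact (Suc m - k) + c * real (m choose k)) = 0"
      by (simp add: algebra_simps)
    then have e: "fact k * coeff S k * fact (Suc m - k) = - c * real (m choose k)"
      by (simp add: add_eq_0_iff2)
    have f: "fact k * fact (Suc m - k) * real (Suc m choose k) = fact (Suc m)"
      using that by (subst binomial_fact) (auto simp: field_simps)
    have "coeff S k * fact (Suc m) = (fact k * coeff S k * fact (Suc m - k)) * real (Suc m choose k)"
      unfolding f[symmetric] by (simp only: mult_ac)
    also have "\<dots> = - c * real (m choose k) * real (Suc m choose k)"
      unfolding e ..
    finally have "coeff S k * fact (Suc m) = - c * real (m choose k) * real (Suc m choose k)" .
    then show ?thesis by (simp add: field_simps del: fact_Suc)
  qed
  have "poly S 0 = - c / fact (Suc m)" using eq[of 0] by (simp add: poly_0_coeff_0 del: fact_Suc)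
  with eq[OF assms(2)] show ?thesis by simp
qed

text \<open>All coefficients are S(0) times nonnegative numbers, so the normalisation S(1) = 1
  decides the sign of S(0). Replacing the second binomial coefficient by 1 leaves the expansion of
  (1 + t)^m.\<close>

lemma pade_log_denominator:
  assumes "pade_log m R S"
  shows "poly S 0 > 0" and "\<And>t. t \<ge> 0 \<Longrightarrow> poly S t \<ge> poly S 0 * (1 + t) ^ m"
proof -
  have Sval: "poly S t = poly S 0 * (\<Sum>k\<le>m. real (m choose k) * real (Suc m choose k) * t ^ k)" for t
  proof -
    have "poly S t = (\<Sum>k\<le>m. coeff S k * t ^ k)"
      unfolding poly_altdef using assms
      by (intro sum.mono_neutral_left) (auto simp: pade_log_def coeff_eq_0)
    also have "\<dots> = (\<Sum>k\<le>m. poly S 0 * (real (m choose k) * real (Suc m choose k) * t ^ k))"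
      by (intro sum.cong refl) (simp add: pade_log_denominator_coeff[OF assms])
    finally show ?thesis by (simp add: sum_distrib_left)
  qed
  have "1 = poly S 0 * (\<Sum>k\<le>m. real (m choose k) * real (Suc m choose k) * 1 ^ k)"
    using Sval[of 1] assms by (simp add: pade_log_def)
  moreover have "(\<Sum>k\<le>m. real (m choose k) * real (Suc m choose k) * 1 ^ k) \<ge> 0"
    by (intro sum_nonneg) auto
  ultimately show pos: "poly S 0 > 0"
    using mult_nonpos_nonneg[of "poly S 0"] by (metis not_le not_one_le_zero)
  fix t :: real assume "t \<ge> 0"
  have "(1 + t) ^ m = (\<Sum>k\<le>m. real (m choose k) * t ^ k)"
    using binomial_ring[of t 1 m] by (simp add: add.commute)
  also have "\<dots> \<le> (\<Sum>k\<le>m. real (m choose k) * real (Suc m choose k) * t ^ k)"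
  proof (intro sum_mono mult_right_mono)
    fix k assume "k \<in> {..m}"
    then have "Suc m choose k \<ge> 1" by (simp add: Suc_le_eq zero_less_binomial_iff del: binomial_Suc_Suc)
    then show "real (m choose k) \<le> real (m choose k) * real (Suc m choose k)"
      by (simp flip: of_nat_mult)
  qed (use \<open>t \<ge> 0\<close> in auto)
  finally show "poly S t \<ge> poly S 0 * (1 + t) ^ m"
    unfolding Sval[of t] using pos by (intro mult_left_mono) auto
qed

text \<open>The left side is t S^2 times the derivative of log t - (t-1) R / S. It vanishes to order
  2m + 1 at 1 and has degree at most 2m + 1; the constant is read off at t = 0.\<close>

lemma pade_log_wronskian:
  assumes "pade_log m R S"
  shows "S * S - [:0, 1:] * (pderiv ([:-1, 1:] * R) * S - [:-1, 1:] * R * pderiv S)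
    = smult (- (poly S 0)\<^sup>2) ([:-1, 1:] ^ (2*m + 1))"
proof -
  define Q where "Q = [:-1, 1:] * R"
  define N where "N = S * S - [:0, 1:] * (pderiv Q * S - Q * pderiv S)"
  have degS: "degree S \<le> m" and "degree R \<le> m" using assms by (auto simp: pade_log_def)
  have degQ: "degree Q \<le> Suc m"
    unfolding Q_def
    by (rule order_trans[OF degree_mult_le]) (use \<open>degree R \<le> m\<close> in simp)
  let ?F = "fps_at_one S * fps_ln 1 - fps_at_one Q"
  have dvd: "fps_X ^ Suc (2*m + 1) dvd ?F"
    using pade_log_fps_dvd[OF assms]
    by (simp add: Q_def fps_at_one_def pcompose_uminus fps_of_poly_uminus
        del: mult_pCons_left minus_mult_left minus_diff_eq)
  have inv: "(1 + fps_X) * inverse (1 + fps_X :: real fps) = 1"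
    by (simp add: inverse_mult_eq_1')
  have "fps_at_one N = (1 + fps_X) * (fps_deriv ?F * fps_at_one S - ?F * fps_deriv (fps_at_one S))
      + fps_at_one S * fps_at_one S * (1 - (1 + fps_X) * inverse (1 + fps_X))"
    unfolding N_def
    by (simp add: fps_at_one_add fps_at_one_diff fps_at_one_mult
        fps_at_one_pCons_0 fps_at_one_deriv fps_ln_deriv algebra_simps)
  also have "fps_X ^ (2*m + 1) dvd \<dots>"
    unfolding inv diff_self mult_zero_right add_0_right
  proof (rule dvd_mult, rule dvd_diff; rule dvd_mult2)
    show "fps_X ^ (2*m + 1) dvd fps_deriv ?F" by (rule fps_X_power_dvd_deriv[OF dvd])
    show "fps_X ^ (2*m + 1) dvd ?F" by (rule dvd_trans[OF _ dvd]) (simp add: le_imp_power_dvd)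
  qed
  finally have d: "fps_X ^ (2*m + 1) dvd fps_at_one N" .
  have "degree (pderiv Q * S - Q * pderiv S) \<le> 2 * m"
  proof (rule degree_diff_le)
    show "degree (pderiv Q * S) \<le> 2 * m"
      by (rule order_trans[OF degree_mult_le]) (use degS degQ in \<open>simp add: degree_pderiv\<close>)
    show "degree (Q * pderiv S) \<le> 2 * m"
    proof (cases "degree S = 0")
      case True then show ?thesis using pderiv_eq_0_iff[of S] by simp
    next
      case False
      then show ?thesis
        by (intro order_trans[OF degree_mult_le]) (use degS degQ in \<open>simp add: degree_pderiv\<close>)
    qed
  qed
  then have "degree N \<le> 2*m + 1"
    unfolding N_def
    by (intro degree_diff_le order_trans[OF degree_mult_le]) (use degS in auto)
  from fps_at_one_dvd_imp[OF d this] obtain c where c: "N = smult c ([:-1, 1:] ^ (2*m + 1))" by blast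
  have "poly N 0 = (poly S 0)\<^sup>2" by (simp add: N_def power2_eq_square)
  with c have "c = - (poly S 0)\<^sup>2" by (simp add: poly_power)
  with c show ?thesis by (simp add: N_def Q_def)
qed

text \<open>By Bernoulli 1 + N s <= (1 + s)^N, and (1 - s^2)^N <= 1. Wherever a high power has to be
  small below, this rate 1/N is used.\<close>

lemma power_le_inverse_linear:
  fixes s :: real
  assumes "0 \<le> s" "s \<le> 1"
  shows "(1 - s) ^ N \<le> 1 / (1 + real N * s)"
proof -
  have "(1 - s) ^ N * (1 + real N * s) \<le> (1 - s) ^ N * (1 + s) ^ N"
    using assms Bernoulli_inequality[of s N] by (intro mult_left_mono) auto
  also have "\<dots> = (1 - s\<^sup>2) ^ N" by (simp add: power2_eq_square algebra_simps flip: power_mult_distrib)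
  also have "\<dots> \<le> 1" using assms by (intro power_le_one) (auto simp: power_le_one)
  finally show ?thesis using assms by (simp add: pos_le_divide_eq add_pos_nonneg)
qed

text \<open>\<open>h\<close> decreases up to 1 and increases afterwards, so 0 is its
  minimum.\<close>

lemma nonneg_if_deriv_sign:
  fixes h v :: "real \<Rightarrow> real"
  assumes deriv: "\<And>t. t > 0 \<Longrightarrow> (h has_real_derivative (t - 1) * v t) (at t)"
    and "h 1 = 0" and v: "\<And>t. t > 0 \<Longrightarrow> v t \<ge> 0" and "t > 0"
  shows "h t \<ge> 0"
proof (cases "t \<ge> 1")
  case True
  have "\<exists>y. (h has_real_derivative y) (at x) \<and> 0 \<le> y" if "1 \<le> x" for x
    using deriv[of x] v[of x] that by (intro exI[of _ "(x - 1) * v x"]) auto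
  then have "h 1 \<le> h t" by (intro DERIV_nonneg_imp_nondecreasing[OF True])
  then show ?thesis using assms by simp
next
  case False
  have "\<exists>y. (h has_real_derivative y) (at x) \<and> y \<le> 0" if "t \<le> x" "x \<le> 1" for x
    using deriv[of x] v[of x] that \<open>t > 0\<close>
    by (intro exI[of _ "(x - 1) * v x"]) (auto intro: mult_nonpos_nonneg)
  then have "h t \<ge> h 1" using False by (intro DERIV_nonpos_imp_nonincreasing[of t 1]) auto
  then show ?thesis using assms by simp
qed

section \<open>Monotonicity and error bounds of the approximant\<close>

locale pade =
  fixes m :: nat and R S :: "real poly"
  assumes pade: "pade_log m R S"
begin

definition r :: "real \<Rightarrow> real" where "r t = (t - 1) * poly R t / poly S t"

text \<open>The defect in t r'(t) = 1 + (t - 1) w(t). Its bounds 0 and 1 give log t <= r(t) and r(t)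
  <= t - 1 respectively.\<close>

definition w :: "real \<Rightarrow> real" where "w t = (poly S 0 / poly S t)\<^sup>2 * (t - 1) ^ (2*m)"

lemma S_pos: "t \<ge> 0 \<Longrightarrow> poly S t > 0"
  using pade_log_denominator[OF pade] by (meson add_pos_nonneg less_le_trans mult_pos_pos zero_less_one zero_less_power)

lemma r_one [simp]: "r 1 = 0"
  by (simp add: r_def)

lemma r_deriv:
  assumes "t > 0"
  shows "(r has_real_derivative 1 / t + w t * (t - 1) / t) (at t)"
proof -
  let ?Q = "[:-1, 1:] * R"
  have S: "poly S t \<noteq> 0" using S_pos[of t] assms by simp
  have "((\<lambda>t. poly ?Q t / poly S t) has_real_derivative
      (poly (pderiv ?Q) t * poly S t - poly ?Q t * poly (pderiv S) t) / (poly S t * poly S t)) (at t)"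
    by (intro DERIV_divide poly_DERIV S)
  moreover have "(\<lambda>t. poly ?Q t / poly S t) = r" by (auto simp: r_def algebra_simps)
  moreover have "(poly (pderiv ?Q) t * poly S t - poly ?Q t * poly (pderiv S) t) / (poly S t * poly S t)
      = 1 / t + w t * (t - 1) / t"
  proof -
    have "poly (S * S - [:0, 1:] * (pderiv ?Q * S - ?Q * pderiv S)) t
        = poly (smult (- (poly S 0)\<^sup>2) ([:-1, 1:] ^ (2*m + 1))) t"
      by (simp only: pade_log_wronskian[OF pade])
    then have "poly S t * poly S t - t * (poly (pderiv ?Q) t * poly S t - poly ?Q t * poly (pderiv S) t)
        = - ((poly S 0)\<^sup>2 * (t - 1) ^ (2*m) * (t - 1))"
      by (simp only: poly_diff poly_mult poly_smult poly_power poly_pCons poly_0 power_add) simp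
    then have "t * (poly (pderiv ?Q) t * poly S t - poly ?Q t * poly (pderiv S) t)
        = poly S t * poly S t + (poly S 0)\<^sup>2 * (t - 1) ^ (2*m) * (t - 1)"
      by linarith
    moreover have "w t * (poly S t * poly S t) = (poly S 0)\<^sup>2 * (t - 1) ^ (2*m)"
      using S by (simp add: w_def power2_eq_square)
    ultimately have *: "t * (poly (pderiv ?Q) t * poly S t - poly ?Q t * poly (pderiv S) t)
        = (1 + w t * (t - 1)) * (poly S t * poly S t)"
      by (simp add: algebra_simps)
    show ?thesis
      using S assms * by (simp add: frac_eq_eq add_divide_distrib[symmetric] mult_ac del: pderiv_mult)
  qed
  ultimately show ?thesis by simp
qed

lemma w_nonneg: "w t \<ge> 0"
  by (simp add: w_def power_mult)

lemma w_le:
  assumes "t \<ge> 0"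
  shows "w t \<le> ((t - 1) / (t + 1)) ^ (2*m)"
proof -
  have S0: "poly S 0 > 0" and le: "poly S 0 * (1 + t) ^ m \<le> poly S t"
    using pade_log_denominator[OF pade] assms by auto
  have "poly S 0 / poly S t \<le> 1 / (1 + t) ^ m"
    using S0 S_pos[OF assms] le assms by (simp add: frac_le_eq divide_le_eq pos_divide_le_eq field_simps)
  then have "(poly S 0 / poly S t)\<^sup>2 \<le> (1 / (1 + t) ^ m)\<^sup>2"
    using S0 S_pos[OF assms] by (intro power_mono) auto
  then have "w t \<le> (1 / (1 + t) ^ m)\<^sup>2 * (t - 1) ^ (2*m)"
    unfolding w_def by (intro mult_right_mono) (auto simp: power_mult)
  also have "\<dots> = ((t - 1) / (t + 1)) ^ (2*m)"
    by (simp add: power_divide power_mult[symmetric] mult.commute add.commute)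
  finally show ?thesis .
qed

lemma w_le_one: assumes "t \<ge> 0" shows "w t \<le> 1"
proof -
  have "((t - 1) / (t + 1)) ^ (2*m) = (\<bar>t - 1\<bar> / (t + 1)) ^ (2*m)"
    using assms by (simp add: power_divide power_mult)
  also have "\<dots> \<le> 1" using assms by (intro power_le_one) auto
  finally show ?thesis using w_le[OF assms] by simp
qed

lemma ln_le_r: assumes "t > 0" shows "ln t \<le> r t"
proof -
  have "r t - ln t \<ge> 0"
  proof (rule nonneg_if_deriv_sign[where h = "\<lambda>t. r t - ln t" and v = "\<lambda>t. w t / t"])
    show "((\<lambda>t. r t - ln t) has_real_derivative (t - 1) * (w t / t)) (at t)" if "t > 0" for t
      by (rule DERIV_cong[OF DERIV_diff[OF r_deriv DERIV_ln]]) (use that in \<open>auto simp: field_simps\<close>)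
  qed (use assms w_nonneg in auto)
  then show ?thesis by simp
qed

lemma r_le: assumes "t > 0" shows "r t \<le> t - 1"
proof -
  have "t - 1 - r t \<ge> 0"
  proof (rule nonneg_if_deriv_sign[where h = "\<lambda>t. t - 1 - r t" and v = "\<lambda>t. (1 - w t) / t"])
    show "((\<lambda>t. t - 1 - r t) has_real_derivative (t - 1) * ((1 - w t) / t)) (at t)" if "t > 0" for t
      by (rule DERIV_cong[OF DERIV_diff[OF DERIV_diff[OF DERIV_ident DERIV_const] r_deriv]])
        (use that in \<open>auto simp: field_simps\<close>)
  qed (use assms w_le_one in auto)
  then show ?thesis by simp
qed

text \<open>Both sides vanish at 1, so derivatives are compared. Writing (t-1)/(t+1) = 1 - 2/(t+1)
  bounds w(t) by (t+1)/(4m) <= t/(2m), as required.\<close>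

lemma r_minus_ln_le_above:
  assumes "t \<ge> 1" "m > 0"
  shows "r t - ln t \<le> (t - 1)\<^sup>2 / (4 * real m)"
proof -
  define h where "h = (\<lambda>t. (t - 1)\<^sup>2 / (4 * real m) - (r t - ln t))"
  have d: "(h has_real_derivative (t - 1) * (1 / (2 * real m) - w t / t)) (at t)" if "t > 0" for t
    unfolding h_def
    by (rule DERIV_cong[OF DERIV_diff[OF _ DERIV_diff[OF r_deriv DERIV_ln]]])
       (use that assms in \<open>auto intro!: derivative_eq_intros simp: field_simps\<close>)
  have nn: "(t - 1) * (1 / (2 * real m) - w t / t) \<ge> 0" if "t \<ge> 1" for t
  proof -
    have "w t \<le> (1 - 2 / (t + 1)) ^ (2*m)"
      using w_le[of t] that by (simp add: field_simps)
    also have "\<dots> \<le> 1 / (1 + real (2*m) * (2 / (t + 1)))"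
      using that by (intro power_le_inverse_linear) auto
    also have "\<dots> \<le> 1 / (real (2*m) * (2 / (t + 1)))"
      using that assms by (intro divide_left_mono) (auto intro!: mult_pos_pos divide_pos_pos add_pos_pos)
    also have "\<dots> = (t + 1) / (4 * real m)" by simp
    also have "\<dots> \<le> t / (2 * real m)" using that assms by (simp add: field_simps)
    finally have "w t / t \<le> 1 / (2 * real m)" using that assms by (simp add: field_simps)
    then show ?thesis using that by simp
  qed
  have "h 1 \<le> h t"
    by (rule DERIV_nonneg_imp_nondecreasing[OF assms(1)]) (use d nn in \<open>meson less_le_trans zero_less_one\<close>)
  then show ?thesis by (simp add: h_def)
qed

text \<open>Since r - log t is unbounded at 0, it is compared with (1/t - 1)^2 / (4m), whose product
  with t^2 is the claimed bound.\<close>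

lemma r_minus_ln_le_below:
  assumes "0 < t" "t \<le> 1" "m > 0"
  shows "t\<^sup>2 * (r t - ln t) \<le> (t - 1)\<^sup>2 / (4 * real m)"
proof -
  define h where "h = (\<lambda>t. (1 / t - 1)\<^sup>2 / (4 * real m) - (r t - ln t))"
  have d: "(h has_real_derivative (1 - t) / t * (w t - 1 / (2 * real m * t\<^sup>2))) (at t)" if "t > 0" for t
    unfolding h_def
    by (rule DERIV_cong[OF DERIV_diff[OF _ DERIV_diff[OF r_deriv DERIV_ln]]])
       (use that assms in \<open>auto intro!: derivative_eq_intros simp: field_simps power2_eq_square\<close>)
  have np: "(1 - t) / t * (w t - 1 / (2 * real m * t\<^sup>2)) \<le> 0" if "0 < t" "t \<le> 1" for t
  proof -
    have "w t \<le> ((1 - t) / (t + 1)) ^ (2*m)"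
      using w_le[of t] that by (simp add: power_mult power_divide power2_commute)
    also have "\<dots> \<le> (1 - t) ^ (2*m)"
      using that by (intro power_mono) (auto simp: field_simps mult_le_one)
    also have "\<dots> \<le> 1 / (1 + real (2*m) * t)"
      using that by (intro power_le_inverse_linear) auto
    also have "\<dots> \<le> 1 / (2 * real m * t\<^sup>2)"
      using that assms
      by (intro divide_left_mono) (auto simp: power2_eq_square mult_le_one intro!: add_increasing mult_pos_pos add_pos_pos)
    finally show ?thesis using that by (intro mult_nonneg_nonpos) auto
  qed
  have "h t \<ge> h 1"
    by (rule DERIV_nonpos_imp_nonincreasing[OF assms(2)]) (use d np assms in \<open>meson less_le_trans\<close>)
  then have "r t - ln t \<le> (1 / t - 1)\<^sup>2 / (4 * real m)" by (simp add: h_def)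
  then have "t\<^sup>2 * (r t - ln t) \<le> t\<^sup>2 * ((1 / t - 1)\<^sup>2 / (4 * real m))"
    by (intro mult_left_mono) auto
  also have "\<dots> = (t * (1 / t - 1))\<^sup>2 / (4 * real m)" by (simp add: power_mult_distrib)
  also have "t * (1 / t - 1) = 1 - t" using assms by (simp add: field_simps)
  finally show ?thesis by (simp add: power2_commute)
qed

text \<open>Above 1 the weight t^2 costs the factor B^2; below 1 it is already part of the
  bound.\<close>

lemma sq_r_le:
  assumes "0 \<le> t" "t \<le> B" "1 \<le> B" "m > 0"
  shows "2 * t\<^sup>2 * r t \<le> 2 * t\<^sup>2 * ln t + B\<^sup>2 / (2 * real m) * (t - 1)\<^sup>2"
proof (cases "t = 0")
  case True then show ?thesis using assms by simp
next
  case False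
  have "t\<^sup>2 * (r t - ln t) \<le> B\<^sup>2 * ((t - 1)\<^sup>2 / (4 * real m))"
  proof (cases "t \<ge> 1")
    case True
    then show ?thesis using r_minus_ln_le_above[OF True \<open>m > 0\<close>] ln_le_r[of t] assms
      by (intro mult_mono power_mono) auto
  next
    case f: False
    have "t\<^sup>2 * (r t - ln t) \<le> 1 * ((t - 1)\<^sup>2 / (4 * real m))"
      using r_minus_ln_le_below[of t] f False assms by simp
    also have "\<dots> \<le> B\<^sup>2 * ((t - 1)\<^sup>2 / (4 * real m))"
      using assms by (intro mult_right_mono) (auto simp: one_le_power)
    finally show ?thesis .
  qed
  then show ?thesis by (simp add: field_simps)
qed

end

section \<open>Polynomial functions and sums of squares\<close>

lemma finite_exps [simp]: "finite (exps n k)"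
proof (rule finite_subset)
  show "exps n k \<subseteq> {a. \<forall>i. (i \<in> {..<n} \<longrightarrow> a i \<in> {..k}) \<and> (i \<notin> {..<n} \<longrightarrow> a i = 0)}"
  proof (intro subsetI CollectI allI conjI impI)
    fix a i assume a: "a \<in> exps n k" and i: "i \<in> {..<n}"
    have "a i \<le> (\<Sum>i<n. a i)" using i by (intro member_le_sum) auto
    then show "a i \<in> {..k}" using a by (auto simp: exps_def)
  qed (auto simp: exps_def)
  show "finite {a. \<forall>i. (i \<in> {..<n} \<longrightarrow> a i \<in> {..k}) \<and> (i \<notin> {..<n} \<longrightarrow> a i = (0::nat))}"
    by (intro finite_set_of_finite_funs) auto
qed

lemma mpoly_funE:
  assumes "mpoly_fun n k f"
  obtains c where "\<And>x. f x = (\<Sum>a\<in>exps n k. c a * (\<Prod>i<n. x i ^ a i))"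
  using assms unfolding mpoly_fun_def by blast

lemma mpoly_fun_monom:
  assumes "a \<in> exps n k"
  shows "mpoly_fun n k (\<lambda>x. c * (\<Prod>i<n. x i ^ a i))"
  unfolding mpoly_fun_def
proof (intro exI allI)
  show "c * (\<Prod>i<n. x i ^ a i) = (\<Sum>b\<in>exps n k. (if b = a then c else 0) * (\<Prod>i<n. x i ^ b i))"
    for x :: "nat \<Rightarrow> real"
    using assms by (simp add: if_distrib[of "\<lambda>c. c * _"] sum.delta cong: if_cong)
qed

lemma mpoly_fun_add:
  assumes "mpoly_fun n k f" "mpoly_fun n k g"
  shows "mpoly_fun n k (\<lambda>x. f x + g x)"
proof -
  obtain c where c: "\<And>x. f x = (\<Sum>a\<in>exps n k. c a * (\<Prod>i<n. x i ^ a i))"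
    using mpoly_funE[OF assms(1)] by blast
  obtain d where d: "\<And>x. g x = (\<Sum>a\<in>exps n k. d a * (\<Prod>i<n. x i ^ a i))"
    using mpoly_funE[OF assms(2)] by blast
  from c d show ?thesis
    unfolding mpoly_fun_def by (intro exI[of _ "\<lambda>a. c a + d a"]) (simp add: algebra_simps sum.distrib)
qed

lemma mpoly_fun_cmult:
  assumes "mpoly_fun n k f"
  shows "mpoly_fun n k (\<lambda>x. r * f x)"
proof -
  obtain c where "\<And>x. f x = (\<Sum>a\<in>exps n k. c a * (\<Prod>i<n. x i ^ a i))"
    using mpoly_funE[OF assms] by blast
  then show ?thesis
    unfolding mpoly_fun_def
    by (intro exI[of _ "\<lambda>a. r * c a"]) (simp add: mult.assoc sum_distrib_left)
qed

lemma mpoly_fun_const: "mpoly_fun n k (\<lambda>x. c)"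
  using mpoly_fun_monom[of "\<lambda>_. 0" n k c] by (simp add: exps_def)

lemma mpoly_fun_sum:
  "(\<And>i. i \<in> A \<Longrightarrow> mpoly_fun n k (f i)) \<Longrightarrow> mpoly_fun n k (\<lambda>x. \<Sum>i\<in>A. f i x)"
  by (induction A rule: infinite_finite_induct) (auto intro: mpoly_fun_const mpoly_fun_add)

lemma mpoly_fun_uminus: "mpoly_fun n k f \<Longrightarrow> mpoly_fun n k (\<lambda>x. - f x)"
  using mpoly_fun_cmult[of n k f "-1"] by simp

lemma mpoly_fun_diff: "mpoly_fun n k f \<Longrightarrow> mpoly_fun n k g \<Longrightarrow> mpoly_fun n k (\<lambda>x. f x - g x)"
  using mpoly_fun_add[OF _ mpoly_fun_uminus, of n k f g] by simp

lemma mpoly_fun_coord: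
  assumes "i < n"
  shows "mpoly_fun n 1 (\<lambda>x. x i)"
proof -
  define a where "a = (\<lambda>j. if j = i then 1 else 0 :: nat)"
  have "a \<in> exps n 1" using assms by (auto simp: exps_def a_def sum.delta)
  moreover have "(\<Prod>j<n. x j ^ a j) = x i" for x :: "nat \<Rightarrow> real"
  proof -
    have "(\<Prod>j<n. x j ^ a j) = (\<Prod>j<n. if j = i then x j else 1)"
      by (intro prod.cong) (auto simp: a_def)
    then show ?thesis using assms by (simp add: prod.delta)
  qed
  ultimately show ?thesis using mpoly_fun_monom[of a n 1 1] by simp
qed

lemma mpoly_fun_mult:
  assumes "mpoly_fun n k f" "mpoly_fun n l g"
  shows "mpoly_fun n (k + l) (\<lambda>x. f x * g x)"
proof -
  obtain c where f: "\<And>x. f x = (\<Sum>a\<in>exps n k. c a * (\<Prod>i<n. x i ^ a i))"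
    using mpoly_funE[OF assms(1)] by blast
  obtain d where g: "\<And>x. g x = (\<Sum>a\<in>exps n l. d a * (\<Prod>i<n. x i ^ a i))"
    using mpoly_funE[OF assms(2)] by blast
  have "f x * g x = (\<Sum>a\<in>exps n k. \<Sum>b\<in>exps n l. (c a * d b) * (\<Prod>i<n. x i ^ (a i + b i)))" for x
    unfolding f g sum_product by (intro sum.cong refl) (simp add: power_add prod.distrib)
  moreover have "mpoly_fun n (k + l) (\<lambda>x. \<Sum>a\<in>exps n k. \<Sum>b\<in>exps n l. (c a * d b) * (\<Prod>i<n. x i ^ (a i + b i)))"
  proof (intro mpoly_fun_sum)
    fix a b assume "a \<in> exps n k" "b \<in> exps n l"
    then have "(\<lambda>i. a i + b i) \<in> exps n (k + l)"
      by (auto simp: exps_def sum.distrib intro: add_mono)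
    from mpoly_fun_monom[OF this]
    show "mpoly_fun n (k + l) (\<lambda>x. (c a * d b) * (\<Prod>i<n. x i ^ (a i + b i)))" .
  qed
  ultimately show ?thesis by simp
qed

lemma mpoly_fun_mono:
  assumes "mpoly_fun n k f" "k \<le> l"
  shows "mpoly_fun n l f"
  using mpoly_fun_mult[OF assms(1) mpoly_fun_const[of n "l - k" 1]] assms(2) by simp

lemma mpoly_fun_power: "mpoly_fun n k f \<Longrightarrow> mpoly_fun n (k * N) (\<lambda>x. f x ^ N)"
proof (induction N)
  case 0 then show ?case by (simp add: mpoly_fun_const)
next
  case (Suc N) then show ?case using mpoly_fun_mult[of n k f "k * N" "\<lambda>x. f x ^ N"] by simp
qed

lemma mpoly_fun_poly:
  assumes "i < n" and "degree p \<le> k"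
  shows "mpoly_fun n k (\<lambda>x. poly p (x i))"
  unfolding poly_altdef
proof (intro mpoly_fun_sum mpoly_fun_cmult)
  fix j assume "j \<in> {..degree p}"
  then show "mpoly_fun n k (\<lambda>x. x i ^ j)"
    using mpoly_fun_mono[OF mpoly_fun_power[OF mpoly_fun_coord[OF assms(1)], of j], of k] assms(2) by simp
qed

lemma mpoly_fun_pi_norm2: "mpoly_fun n 2 (pi_norm2 n \<pi>)"
  unfolding pi_norm2_def
proof (intro mpoly_fun_sum mpoly_fun_cmult)
  fix i assume "i \<in> {..<n}"
  then show "mpoly_fun n 2 (\<lambda>x. (x i)\<^sup>2)" using mpoly_fun_power[OF mpoly_fun_coord, of i n 2] by simp
qed

lemma mpoly_fun_dirichlet: "mpoly_fun n 2 (dirichlet n K \<pi>)"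
  unfolding dirichlet_def
proof (intro mpoly_fun_sum mpoly_fun_cmult)
  fix i j assume "i \<in> {..<n}" "j \<in> {..<n}"
  then show "mpoly_fun n 2 (\<lambda>x. (x i - x j)\<^sup>2)"
    using mpoly_fun_power[OF mpoly_fun_diff[OF mpoly_fun_coord mpoly_fun_coord], of i n j 2] by simp
qed

section \<open>Sums of squares, first with and then without degree bounds\<close>

lemma sos_mpolyE:
  assumes "sos_mpoly n k f"
  obtains qs where "\<forall>q\<in>set qs. mpoly_fun n k q" and "\<And>x. f x = (\<Sum>q\<leftarrow>qs. (q x)\<^sup>2)"
  using assms unfolding sos_mpoly_def by blast

lemma sos_mpoly_zero: "sos_mpoly n k (\<lambda>x. 0)"
  unfolding sos_mpoly_def by (intro exI[of _ "[]"]) simp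

lemma sos_mpoly_square: "mpoly_fun n k f \<Longrightarrow> sos_mpoly n k (\<lambda>x. (f x)\<^sup>2)"
  unfolding sos_mpoly_def by (intro exI[of _ "[f]"]) simp

lemma sos_mpoly_add:
  assumes "sos_mpoly n k f" "sos_mpoly n k g"
  shows "sos_mpoly n k (\<lambda>x. f x + g x)"
proof -
  obtain ps where p: "\<forall>q\<in>set ps. mpoly_fun n k q" "\<And>x. f x = (\<Sum>q\<leftarrow>ps. (q x)\<^sup>2)"
    using sos_mpolyE[OF assms(1)] by blast
  obtain qs where q: "\<forall>q\<in>set qs. mpoly_fun n k q" "\<And>x. g x = (\<Sum>q\<leftarrow>qs. (q x)\<^sup>2)"
    using sos_mpolyE[OF assms(2)] by blast
  from p q show ?thesis
    unfolding sos_mpoly_def by (intro exI[of _ "ps @ qs"]) auto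
qed

lemma sos_mpoly_sum:
  "(\<And>i. i \<in> A \<Longrightarrow> sos_mpoly n k (f i)) \<Longrightarrow> sos_mpoly n k (\<lambda>x. \<Sum>i\<in>A. f i x)"
  by (induction A rule: infinite_finite_induct) (auto intro: sos_mpoly_zero sos_mpoly_add)

lemma sos_mpoly_sum_list:
  "(\<And>q. q \<in> set qs \<Longrightarrow> sos_mpoly n k (f q)) \<Longrightarrow> sos_mpoly n k (\<lambda>x. \<Sum>q\<leftarrow>qs. f q x)"
  by (induction qs) (auto intro: sos_mpoly_zero sos_mpoly_add)

lemma sos_mpoly_mult:
  assumes "sos_mpoly n k f" "sos_mpoly n l g"
  shows "sos_mpoly n (k + l) (\<lambda>x. f x * g x)"
proof -
  obtain ps where p: "\<forall>q\<in>set ps. mpoly_fun n k q" and f: "\<And>x. f x = (\<Sum>q\<leftarrow>ps. (q x)\<^sup>2)"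
    using sos_mpolyE[OF assms(1)] by blast
  obtain qs where q: "\<forall>q\<in>set qs. mpoly_fun n l q" and g: "\<And>x. g x = (\<Sum>q\<leftarrow>qs. (q x)\<^sup>2)"
    using sos_mpolyE[OF assms(2)] by blast
  have "f x * g x = (\<Sum>p\<leftarrow>ps. \<Sum>q\<leftarrow>qs. (p x * q x)\<^sup>2)" for x
    unfolding f g by (simp add: sum_list_mult_const sum_list_const_mult power_mult_distrib)
  moreover have "sos_mpoly n (k + l) (\<lambda>x. \<Sum>p\<leftarrow>ps. \<Sum>q\<leftarrow>qs. (p x * q x)\<^sup>2)"
    using p q by (intro sos_mpoly_sum_list sos_mpoly_square mpoly_fun_mult) auto
  ultimately show ?thesis by simp
qed

lemma sos_mpoly_const: "c \<ge> 0 \<Longrightarrow> sos_mpoly n k (\<lambda>x. c)"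
  using sos_mpoly_square[OF mpoly_fun_const[of n k "sqrt c"]] by simp

lemma sos_mpoly_mono: "sos_mpoly n k f \<Longrightarrow> k \<le> l \<Longrightarrow> sos_mpoly n l f"
  unfolding sos_mpoly_def by (meson mpoly_fun_mono)

lemma sos_mpoly_cmult: "c \<ge> 0 \<Longrightarrow> sos_mpoly n k f \<Longrightarrow> sos_mpoly n k (\<lambda>x. c * f x)"
  using sos_mpoly_mult[OF sos_mpoly_const[of c n 0], of k f] by simp

lemma sos_mpoly_nonneg: "sos_mpoly n k f \<Longrightarrow> f x \<ge> 0"
  unfolding sos_mpoly_def by (auto intro!: sum_list_nonneg)

text \<open>Without degrees, certificates can be added and multiplied freely;
  \<open>quadratic_module_imp_SOS_Spi\<close> recovers a bound at the end.\<close>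

definition polynomial :: "nat \<Rightarrow> ((nat \<Rightarrow> real) \<Rightarrow> real) \<Rightarrow> bool" where
  "polynomial n f \<longleftrightarrow> (\<exists>k. mpoly_fun n k f)"

definition sos :: "nat \<Rightarrow> ((nat \<Rightarrow> real) \<Rightarrow> real) \<Rightarrow> bool" where
  "sos n f \<longleftrightarrow> (\<exists>k. sos_mpoly n k f)"

lemma polynomial_add: "polynomial n f \<Longrightarrow> polynomial n g \<Longrightarrow> polynomial n (\<lambda>x. f x + g x)"
  unfolding polynomial_def
  by (elim exE, rule exI, rule mpoly_fun_add; erule mpoly_fun_mono) (rule max.cobounded1 max.cobounded2)+

lemma polynomial_mult: "polynomial n f \<Longrightarrow> polynomial n g \<Longrightarrow> polynomial n (\<lambda>x. f x * g x)"
  unfolding polynomial_def by (blast intro: mpoly_fun_mult)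

lemma polynomial_const: "polynomial n (\<lambda>x. c)"
  unfolding polynomial_def by (blast intro: mpoly_fun_const)

lemma polynomial_uminus: "polynomial n f \<Longrightarrow> polynomial n (\<lambda>x. - f x)"
  unfolding polynomial_def by (blast intro: mpoly_fun_uminus)

lemma polynomial_diff: "polynomial n f \<Longrightarrow> polynomial n g \<Longrightarrow> polynomial n (\<lambda>x. f x - g x)"
  using polynomial_add[OF _ polynomial_uminus] by fastforce

lemma polynomial_power: "polynomial n f \<Longrightarrow> polynomial n (\<lambda>x. f x ^ N)"
  unfolding polynomial_def by (blast intro: mpoly_fun_power)

lemma polynomial_sum: "(\<And>i. i \<in> A \<Longrightarrow> polynomial n (f i)) \<Longrightarrow> polynomial n (\<lambda>x. \<Sum>i\<in>A. f i x)"
  by (induction A rule: infinite_finite_induct) (auto intro: polynomial_const polynomial_add)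

lemma polynomial_prod: "(\<And>i. i \<in> A \<Longrightarrow> polynomial n (f i)) \<Longrightarrow> polynomial n (\<lambda>x. \<Prod>i\<in>A. f i x)"
  by (induction A rule: infinite_finite_induct) (auto intro: polynomial_const polynomial_mult)

lemma polynomial_coord: "i < n \<Longrightarrow> polynomial n (\<lambda>x. x i)"
  unfolding polynomial_def by (blast intro: mpoly_fun_coord)

lemma polynomial_poly: "i < n \<Longrightarrow> polynomial n (\<lambda>x. poly p (x i))"
  unfolding polynomial_def by (blast intro: mpoly_fun_poly order_refl)

lemma polynomial_pi_norm2: "polynomial n (\<lambda>x. pi_norm2 n \<pi> x)"
  unfolding polynomial_def by (blast intro: mpoly_fun_pi_norm2)

lemma polynomial_dirichlet: "polynomial n (\<lambda>x. dirichlet n K \<pi> x)"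
  unfolding polynomial_def by (blast intro: mpoly_fun_dirichlet)

lemmas polynomial_intros = polynomial_add polynomial_diff polynomial_mult polynomial_const
  polynomial_uminus polynomial_power polynomial_sum polynomial_coord polynomial_poly
  polynomial_pi_norm2 polynomial_dirichlet

lemma sos_add: "sos n f \<Longrightarrow> sos n g \<Longrightarrow> sos n (\<lambda>x. f x + g x)"
  unfolding sos_def
  by (elim exE, rule exI, rule sos_mpoly_add; erule sos_mpoly_mono) (rule max.cobounded1 max.cobounded2)+

lemma sos_mult: "sos n f \<Longrightarrow> sos n g \<Longrightarrow> sos n (\<lambda>x. f x * g x)"
  unfolding sos_def by (blast intro: sos_mpoly_mult)

lemma sos_const: "c \<ge> 0 \<Longrightarrow> sos n (\<lambda>x. c)"
  unfolding sos_def by (blast intro: sos_mpoly_const)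

lemma sos_sum: "(\<And>i. i \<in> A \<Longrightarrow> sos n (f i)) \<Longrightarrow> sos n (\<lambda>x. \<Sum>i\<in>A. f i x)"
  by (induction A rule: infinite_finite_induct) (auto intro: sos_const sos_add)

lemma sos_square: "polynomial n f \<Longrightarrow> sos n (\<lambda>x. (f x)\<^sup>2)"
  unfolding sos_def polynomial_def by (blast intro: sos_mpoly_square)

lemma sos_even_power: "polynomial n f \<Longrightarrow> sos n (\<lambda>x. f x ^ (2 * N))"
  using sos_square[OF polynomial_power[of n f N]] by (simp add: power_even_eq)

lemma sos_polynomial: assumes "sos n f" shows "polynomial n f"
proof -
  obtain k where "sos_mpoly n k f" using assms unfolding sos_def by blast
  then obtain qs where q: "\<forall>q\<in>set qs. mpoly_fun n k q" and f: "\<And>x. f x = (\<Sum>q\<leftarrow>qs. (q x)\<^sup>2)"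
    using sos_mpolyE by blast
  from q have q: "\<forall>q\<in>set qs. polynomial n q" unfolding polynomial_def by blast
  then have "polynomial n (\<lambda>x. \<Sum>q\<leftarrow>qs. (q x)\<^sup>2)"
  proof (induction qs)
    case Nil then show ?case by (simp add: polynomial_const)
  next
    case (Cons q qs)
    then show ?case by (simp add: polynomial_add polynomial_power)
  qed
  then show ?thesis unfolding f[abs_def] .
qed

lemma polynomial_affine_substitution:
  assumes "polynomial n f"
  shows "polynomial n (\<lambda>x. f (\<lambda>i. a * x i + b))"
proof -
  obtain k where "mpoly_fun n k f" using assms unfolding polynomial_def by blast
  then obtain c where f: "\<And>x. f x = (\<Sum>a\<in>exps n k. c a * (\<Prod>i<n. x i ^ a i))"
    using mpoly_funE by blast
  show ?thesis unfolding f by (intro polynomial_prod polynomial_intros) auto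
qed

lemma polynomial_continuous:
  assumes "polynomial n f"
  shows "continuous_on X f"
proof -
  obtain k where "mpoly_fun n k f" using assms unfolding polynomial_def by blast
  then obtain c where f: "\<And>x. f x = (\<Sum>a\<in>exps n k. c a * (\<Prod>i<n. x i ^ a i))"
    using mpoly_funE by blast
  have "continuous_on X (\<lambda>x. x i)" for i :: nat and X :: "(nat \<Rightarrow> real) set"
    by (rule continuous_on_subset[OF continuous_on_product_coordinates]) simp
  then show ?thesis unfolding f[abs_def] by (intro continuous_intros)
qed

text \<open>Vectors are functions on all natural numbers. This allows a vector to be truncated to
  one that is 0 from n on and lies in a compact set.\<close>

lemma polynomial_cong:
  assumes "polynomial n f" and "\<And>i. i < n \<Longrightarrow> x i = y i"
  shows "f x = f y"
proof -
  obtain k where "mpoly_fun n k f" using assms(1) unfolding polynomial_def by blast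
  then obtain c where f: "\<And>x. f x = (\<Sum>a\<in>exps n k. c a * (\<Prod>i<n. x i ^ a i))"
    using mpoly_funE by blast
  show ?thesis unfolding f by (intro sum.cong refl arg_cong2[where f = "(*)"] prod.cong) (use assms(2) in auto)
qed

section \<open>A Positivstellensatz on the nonnegative part of the sphere\<close>

text \<open>By C(N,k) C(k,a) = C(N,a) C(N-a,k-a) the sum reduces to one over all Bernstein
  polynomials of degree N - a, which is 1.\<close>

lemma power_Bernstein_expansion:
  assumes "a \<le> N"
  shows "y ^ a = (\<Sum>k\<le>N. real (k choose a) / real (N choose a) * Bernstein N k y)"
proof -
  have "(\<Sum>k\<le>N. real (k choose a) * Bernstein N k y)
      = (\<Sum>k\<in>{a..N}. real (k choose a) * Bernstein N k y)"
    by (rule sum.mono_neutral_right) (auto simp: binomial_eq_0)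
  also have "\<dots> = (\<Sum>k\<in>{a..N}. real (N choose a) * y ^ a * Bernstein (N - a) (k - a) y)"
  proof (intro sum.cong refl)
    fix k assume k: "k \<in> {a..N}"
    have "real (N choose k) * real (k choose a) = real (N choose a) * real ((N - a) choose (k - a))"
      using choose_mult[of a k N] k by (simp flip: of_nat_mult)
    moreover have "y ^ k = y ^ a * y ^ (k - a)" using k by (simp flip: power_add)
    ultimately show "real (k choose a) * Bernstein N k y = real (N choose a) * y ^ a * Bernstein (N - a) (k - a) y"
      using k by (simp add: Bernstein_def mult_ac)
  qed
  also have "\<dots> = real (N choose a) * y ^ a * (\<Sum>k\<in>{a..N}. Bernstein (N - a) (k - a) y)"
    by (simp add: sum_distrib_left)
  also have "(\<Sum>k\<in>{a..N}. Bernstein (N - a) (k - a) y) = (\<Sum>k\<le>N - a. Bernstein (N - a) k y)"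
    by (rule sum.reindex_bij_witness[of _ "\<lambda>k. k + a" "\<lambda>k. k - a"]) (use assms in auto)
  finally have "(\<Sum>k\<le>N. real (k choose a) * Bernstein N k y) = real (N choose a) * y ^ a" by simp
  moreover have "real (N choose a) \<noteq> 0" using assms by simp
  ultimately show ?thesis by (simp add: sum_divide_distrib[symmetric])
qed

text \<open>For k >= a the quotient is a product of a factors (k-i)/(N-i), each within a/N of k/N.
  For k < a it is 0, and k/N itself is below a/N.\<close>

lemma binomial_ratio_approx:
  assumes "a \<le> N" "k \<le> N"
  shows "\<bar>real (k choose a) / real (N choose a) - (real k / real N) ^ a\<bar> \<le> (real a)\<^sup>2 / real N"
proof (cases "k < a")
  case True
  then have N: "N > 0" "a \<ge> 1" using assms by auto
  have "(real k / real N) ^ a \<le> (real k / real N) ^ 1"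
    using assms N by (intro power_decreasing) auto
  also have "\<dots> \<le> real a / real N" using True by (simp add: divide_right_mono)
  also have "\<dots> \<le> (real a)\<^sup>2 / real N" using N by (intro divide_right_mono) (auto simp: power2_eq_square)
  finally show ?thesis using True by (simp add: binomial_eq_0)
next
  case False
  show ?thesis
  proof (cases "a = 0")
    case True then show ?thesis by simp
  next
    case a0: False
    then have N: "N > 0" using assms by simp
    have "real (k choose a) / real (N choose a)
        = (\<Prod>i = 0..<a. (real (k - i) / real (a - i)) / (real (N - i) / real (a - i)))"
      using False assms by (simp add: binomial_altdef_of_nat prod_dividef)
    also have "\<dots> = (\<Prod>i = 0..<a. real (k - i) / real (N - i))"
      by (intro prod.cong) auto
    finally have *: "real (k choose a) / real (N choose a) = (\<Prod>i = 0..<a. real (k - i) / real (N - i))" .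
    have "norm ((\<Prod>i = 0..<a. real (k - i) / real (N - i)) - (\<Prod>i = 0..<a. real k / real N))
        \<le> (\<Sum>i = 0..<a. norm (real (k - i) / real (N - i) - real k / real N))"
      using assms False by (intro norm_prod_diff) (auto simp: divide_le_eq)
    also have "\<dots> \<le> (\<Sum>i = 0..<a. real a / real N)"
    proof (intro sum_mono)
      fix i assume i: "i \<in> {0..<a}"
      then have ik: "i \<le> k" "i < N" using False assms by auto
      then have "real k / real N - real (k - i) / real (N - i) = (real i / real N) * (real (N - k) / real (N - i))"
        using N assms by (simp add: of_nat_diff field_simps)
      moreover have "\<bar>(real i / real N) * (real (N - k) / real (N - i))\<bar> \<le> (real a / real N) * 1"
        unfolding abs_mult using i ik N by (intro mult_mono) (auto intro!: divide_right_mono simp: divide_le_eq)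
      ultimately show "norm (real (k - i) / real (N - i) - real k / real N) \<le> real a / real N"
        by (simp add: abs_minus_commute)
    qed
    finally show ?thesis unfolding * by (simp add: power2_eq_square)
  qed
qed

text \<open>The coefficient \<open>b k\<close> differs from the value of \<open>f\<close> at the
  grid point k/N by at most \<open>C / N\<close>, so for large N it inherits nonnegativity.\<close>

lemma positive_on_box_Bernstein:
  assumes f: "polynomial n f" and "\<delta> > 0"
    and pos: "\<And>x. (\<And>i. i < n \<Longrightarrow> 0 \<le> x i \<and> x i \<le> 1) \<Longrightarrow> f x \<ge> \<delta>"
  shows "\<exists>N b. (\<forall>k\<in>PiE {..<n} (\<lambda>_. {..N}). b k \<ge> 0) \<and>
    (\<forall>x. f x = (\<Sum>k\<in>PiE {..<n} (\<lambda>_. {..N}). b k * (\<Prod>i<n. Bernstein N (k i) (x i))))"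
proof -
  obtain D where "mpoly_fun n D f" using f unfolding polynomial_def by blast
  then obtain c where c: "\<And>x. f x = (\<Sum>a\<in>exps n D. c a * (\<Prod>i<n. x i ^ a i))"
    using mpoly_funE by blast
  have aD: "a i \<le> D" if "a \<in> exps n D" "i < n" for a i
    using that member_le_sum[of i "{..<n}" a] by (auto simp: exps_def)
  define C where "C = (\<Sum>a\<in>exps n D. \<bar>c a\<bar> * (\<Sum>i<n. (real (a i))\<^sup>2))"
  have "C \<ge> 0" unfolding C_def by (intro sum_nonneg mult_nonneg_nonneg) auto
  obtain N0 :: nat where N0: "real N0 > C / \<delta>" using reals_Archimedean2 by blast
  \<comment> \<open>Adding \<open>D\<close> ensures that no exponent exceeds \<open>N\<close>, as
    the Bernstein expansion requires.\<close>
  define N where "N = N0 + D + 1"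
  have "C / \<delta> \<le> real N" using N0 by (simp add: N_def)
  then have CN: "C / real N \<le> \<delta>" using \<open>\<delta> > 0\<close> by (simp add: N_def field_simps)
  let ?P = "PiE {..<n} (\<lambda>_. {..N})"
  define \<rho> where "\<rho> = (\<lambda>k a. real (k choose a) / real (N choose a))"
  define b where "b = (\<lambda>k. \<Sum>a\<in>exps n D. c a * (\<Prod>i<n. \<rho> (k i) (a i)))"
  have "b k \<ge> 0" if k: "k \<in> ?P" for k
  proof -
    have kN: "k i \<le> N" if "i < n" for i using k that by auto
    have "\<bar>f (\<lambda>i. real (k i) / real N) - b k\<bar>
        \<le> (\<Sum>a\<in>exps n D. \<bar>c a * (\<Prod>i<n. (real (k i) / real N) ^ a i) - c a * (\<Prod>i<n. \<rho> (k i) (a i))\<bar>)"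
      unfolding c b_def sum_subtractf[symmetric] by (rule sum_abs)
    also have "\<dots> \<le> (\<Sum>a\<in>exps n D. \<bar>c a\<bar> * (\<Sum>i<n. (real (a i))\<^sup>2 / real N))"
    proof (intro sum_mono)
      fix a assume a: "a \<in> exps n D"
      have "norm ((\<Prod>i<n. (real (k i) / real N) ^ a i) - (\<Prod>i<n. \<rho> (k i) (a i)))
          \<le> (\<Sum>i<n. norm ((real (k i) / real N) ^ a i - \<rho> (k i) (a i)))"
      proof (rule norm_prod_diff)
        fix i assume "i \<in> {..<n}"
        then have i: "k i \<le> N" using kN by simp
        then have "real (k i) / real N \<le> 1" by (simp add: divide_le_eq)
        then show "norm ((real (k i) / real N) ^ a i) \<le> 1" by (simp add: power_le_one)
        show "norm (\<rho> (k i) (a i)) \<le> 1"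
          using binomial_right_mono[OF i, of "a i"] by (simp add: \<rho>_def divide_le_eq)
      qed
      also have "\<dots> \<le> (\<Sum>i<n. (real (a i))\<^sup>2 / real N)"
      proof (rule sum_mono)
        fix i assume "i \<in> {..<n}"
        then have "k i \<le> N" "a i \<le> N" using kN aD[OF a, of i] by (auto simp: N_def)
        then show "norm ((real (k i) / real N) ^ a i - \<rho> (k i) (a i)) \<le> (real (a i))\<^sup>2 / real N"
          using binomial_ratio_approx[of "a i" N "k i"] by (simp add: \<rho>_def abs_minus_commute)
      qed
      finally show "\<bar>c a * (\<Prod>i<n. (real (k i) / real N) ^ a i) - c a * (\<Prod>i<n. \<rho> (k i) (a i))\<bar>
          \<le> \<bar>c a\<bar> * (\<Sum>i<n. (real (a i))\<^sup>2 / real N)"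
        unfolding right_diff_distrib[symmetric] abs_mult by (intro mult_left_mono) auto
    qed
    also have "\<dots> = C / real N"
      by (simp only: C_def sum_divide_distrib times_divide_eq_right[symmetric])
    finally have "\<bar>f (\<lambda>i. real (k i) / real N) - b k\<bar> \<le> \<delta>" using CN by simp
    moreover have "f (\<lambda>i. real (k i) / real N) \<ge> \<delta>"
      using kN by (intro pos) (auto simp: divide_le_eq)
    ultimately show ?thesis by linarith
  qed
  moreover have "f x = (\<Sum>k\<in>?P. b k * (\<Prod>i<n. Bernstein N (k i) (x i)))" for x
  proof -
    have "f x = (\<Sum>a\<in>exps n D. c a * (\<Prod>i<n. \<Sum>k\<le>N. \<rho> k (a i) * Bernstein N k (x i)))"
      unfolding c \<rho>_def
    proof (intro sum.cong refl arg_cong2[where f = "(*)"] prod.cong)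
      fix a i assume "a \<in> exps n D" "i \<in> {..<n}"
      then have "a i \<le> N" using aD[of a i] by (simp add: N_def)
      from power_Bernstein_expansion[OF this]
      show "x i ^ a i = (\<Sum>k\<le>N. real (k choose a i) / real (N choose a i) * Bernstein N k (x i))" .
    qed
    also have "\<dots> = (\<Sum>a\<in>exps n D. c a * (\<Sum>k\<in>?P. \<Prod>i<n. \<rho> (k i) (a i) * Bernstein N (k i) (x i)))"
      by (subst prod_sum_PiE) auto
    also have "\<dots> = (\<Sum>k\<in>?P. \<Sum>a\<in>exps n D. c a * (\<Prod>i<n. \<rho> (k i) (a i)) * (\<Prod>i<n. Bernstein N (k i) (x i)))"
      unfolding sum_distrib_left prod.distrib by (subst sum.swap) (simp add: mult.assoc)
    finally show ?thesis by (simp add: b_def sum_distrib_right)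
  qed
  ultimately show ?thesis by blast
qed

section \<open>Sums of squares modulo the sphere\<close>

definition sphere_sos :: "nat \<Rightarrow> (nat \<Rightarrow> real) \<Rightarrow> ((nat \<Rightarrow> real) \<Rightarrow> real) \<Rightarrow> bool" where
  "sphere_sos n \<pi> f \<longleftrightarrow> (\<exists>\<sigma> \<phi>. sos n \<sigma> \<and> polynomial n \<phi> \<and> (\<forall>x. f x = \<sigma> x + \<phi> x * (pi_norm2 n \<pi> x - 1)))"

text \<open>The cone \<open>SOS_Spi\<close> without degree bounds.\<close>

definition quadratic_module :: "nat \<Rightarrow> (nat \<Rightarrow> real) \<Rightarrow> ((nat \<Rightarrow> real) \<Rightarrow> real) \<Rightarrow> bool" where
  "quadratic_module n \<pi> f \<longleftrightarrow> (\<exists>\<sigma>0 \<sigma> \<phi>. sos n \<sigma>0 \<and> (\<forall>i<n. sos n (\<sigma> i)) \<and> polynomial n \<phi> \<and>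
     (\<forall>x. f x = \<sigma>0 x + (\<Sum>i<n. x i * \<sigma> i x) + \<phi> x * (pi_norm2 n \<pi> x - 1)))"

lemma sphere_sosI:
  "sos n \<sigma> \<Longrightarrow> polynomial n \<phi> \<Longrightarrow> (\<And>x. f x = \<sigma> x + \<phi> x * (pi_norm2 n \<pi> x - 1)) \<Longrightarrow> sphere_sos n \<pi> f"
  unfolding sphere_sos_def by blast

lemma sphere_sosE:
  assumes "sphere_sos n \<pi> f"
  obtains \<sigma> \<phi> where "sos n \<sigma>" "polynomial n \<phi>" "\<And>x. f x = \<sigma> x + \<phi> x * (pi_norm2 n \<pi> x - 1)"
  using assms unfolding sphere_sos_def by blast

lemma sphere_sos_of_sos: "sos n f \<Longrightarrow> sphere_sos n \<pi> f"
  by (rule sphere_sosI[of n f "\<lambda>_. 0"]) (auto intro: polynomial_const)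

lemma sphere_sos_add:
  assumes "sphere_sos n \<pi> f" "sphere_sos n \<pi> g"
  shows "sphere_sos n \<pi> (\<lambda>x. f x + g x)"
proof -
  obtain \<sigma> \<phi> where f: "sos n \<sigma>" "polynomial n \<phi>" "\<And>x. f x = \<sigma> x + \<phi> x * (pi_norm2 n \<pi> x - 1)"
    using sphere_sosE[OF assms(1)] by blast
  obtain \<sigma>' \<phi>' where g: "sos n \<sigma>'" "polynomial n \<phi>'" "\<And>x. g x = \<sigma>' x + \<phi>' x * (pi_norm2 n \<pi> x - 1)"
    using sphere_sosE[OF assms(2)] by blast
  show ?thesis
    by (rule sphere_sosI[OF sos_add[OF f(1) g(1)] polynomial_add[OF f(2) g(2)]])
       (simp add: f(3) g(3) algebra_simps)
qed

lemma sphere_sos_mult: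
  assumes "sphere_sos n \<pi> f" "sphere_sos n \<pi> g"
  shows "sphere_sos n \<pi> (\<lambda>x. f x * g x)"
proof -
  obtain \<sigma> \<phi> where f: "sos n \<sigma>" "polynomial n \<phi>" "\<And>x. f x = \<sigma> x + \<phi> x * (pi_norm2 n \<pi> x - 1)"
    using sphere_sosE[OF assms(1)] by blast
  obtain \<sigma>' \<phi>' where g: "sos n \<sigma>'" "polynomial n \<phi>'" "\<And>x. g x = \<sigma>' x + \<phi>' x * (pi_norm2 n \<pi> x - 1)"
    using sphere_sosE[OF assms(2)] by blast
  have "polynomial n (\<lambda>x. \<sigma> x * \<phi>' x + \<sigma>' x * \<phi> x + \<phi> x * \<phi>' x * (pi_norm2 n \<pi> x - 1))"
    by (intro polynomial_intros sos_polynomial f g)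
  then show ?thesis
    by (rule sphere_sosI[OF sos_mult[OF f(1) g(1)]]) (simp add: f(3) g(3) algebra_simps)
qed

lemma sphere_sos_const: "c \<ge> 0 \<Longrightarrow> sphere_sos n \<pi> (\<lambda>x. c)"
  by (rule sphere_sos_of_sos[OF sos_const])

lemma sphere_sos_power: "sphere_sos n \<pi> f \<Longrightarrow> sphere_sos n \<pi> (\<lambda>x. f x ^ N)"
  by (induction N) (auto intro: sphere_sos_const sphere_sos_mult)

lemma sphere_sos_prod: "(\<And>i. i \<in> A \<Longrightarrow> sphere_sos n \<pi> (f i)) \<Longrightarrow> sphere_sos n \<pi> (\<lambda>x. \<Prod>i\<in>A. f i x)"
  by (induction A rule: infinite_finite_induct) (auto intro: sphere_sos_const sphere_sos_mult)

lemma sphere_sos_sum: "(\<And>i. i \<in> A \<Longrightarrow> sphere_sos n \<pi> (f i)) \<Longrightarrow> sphere_sos n \<pi> (\<lambda>x. \<Sum>i\<in>A. f i x)"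
  by (induction A rule: infinite_finite_induct) (auto intro: sphere_sos_const sphere_sos_add)

text \<open>2B (B + s x_i) = (B + s x_i)^2 + B^2 - x_i^2, and on the sphere B^2 - x_i^2 equals B^2 -
  1/\<pi>_i plus the squares of the other coordinates with weights \<pi>_j/\<pi>_i. The divisor 2B
  turns the two signs into a pair y, 1 - y of Bernstein variables.\<close>

lemma sphere_sos_linear:
  assumes i: "i < n" and pos: "\<And>i. i < n \<Longrightarrow> \<pi> i > 0" and B: "B > 0" "B\<^sup>2 * \<pi> i \<ge> 1"
    and s: "s\<^sup>2 = (1::real)"
  shows "sphere_sos n \<pi> (\<lambda>x. (B + s * x i) / (2 * B))"
proof (rule sphere_sosI)
  let ?c = "1 / (2 * B)\<^sup>2"
  show "sos n (\<lambda>x. ?c * ((B + s * x i)\<^sup>2 + (B\<^sup>2 - 1 / \<pi> i) + (\<Sum>j\<in>{..<n}-{i}. \<pi> j / \<pi> i * (x j)\<^sup>2)))"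
    using i B pos[OF i] by (intro sos_mult sos_add sos_const sos_sum sos_square polynomial_intros)
      (auto simp: field_simps intro!: divide_nonneg_pos less_imp_le[OF pos])
  show "polynomial n (\<lambda>x. - ?c / \<pi> i)" by (rule polynomial_const)
  have alg: "c * ((B\<^sup>2 + 2 * B * s * y + y\<^sup>2) + (B\<^sup>2 - 1 / p) + (P / p - y\<^sup>2)) + - c / p * (P - 1)
      = c * (2 * B * (B + s * y))" for c y p P :: real
    by (simp add: algebra_simps power2_eq_square diff_divide_distrib)
  fix x
  have "pi_norm2 n \<pi> x = \<pi> i * (x i)\<^sup>2 + (\<Sum>j\<in>{..<n}-{i}. \<pi> j * (x j)\<^sup>2)"
    unfolding pi_norm2_def using i by (subst sum.remove[of _ i]) auto
  moreover have "(\<Sum>j\<in>{..<n}-{i}. \<pi> j / \<pi> i * (x j)\<^sup>2) = (\<Sum>j\<in>{..<n}-{i}. \<pi> j * (x j)\<^sup>2) / \<pi> i"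
    by (simp add: sum_divide_distrib)
  ultimately have "(\<Sum>j\<in>{..<n}-{i}. \<pi> j / \<pi> i * (x j)\<^sup>2) = pi_norm2 n \<pi> x / \<pi> i - (x i)\<^sup>2"
    using pos[OF i] by (simp add: field_simps)
  moreover have "(B + s * x i)\<^sup>2 = B\<^sup>2 + 2 * B * s * x i + (x i)\<^sup>2"
    using s by (simp add: power2_sum power_mult_distrib)
  ultimately have "?c * ((B + s * x i)\<^sup>2 + (B\<^sup>2 - 1 / \<pi> i) + (\<Sum>j\<in>{..<n}-{i}. \<pi> j / \<pi> i * (x j)\<^sup>2))
      + - ?c / \<pi> i * (pi_norm2 n \<pi> x - 1) = ?c * (2 * B * (B + s * x i))"
    by (simp only: alg)
  also have "\<dots> = (B + s * x i) / (2 * B)" using B(1) by (simp add: power2_eq_square field_simps)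
  finally show "(B + s * x i) / (2 * B) = ?c * ((B + s * x i)\<^sup>2 + (B\<^sup>2 - 1 / \<pi> i) + (\<Sum>j\<in>{..<n}-{i}. \<pi> j / \<pi> i * (x j)\<^sup>2))
      + - ?c / \<pi> i * (pi_norm2 n \<pi> x - 1)" by simp
qed

lemma sphere_sos_if_positive_on_box:
  assumes f: "polynomial n f" and \<pi>: "\<And>i. i < n \<Longrightarrow> \<pi> i > 0"
    and B: "B > 0" "\<And>i. i < n \<Longrightarrow> B\<^sup>2 * \<pi> i \<ge> 1"
    and "\<delta> > 0" and pos: "\<And>x. (\<And>i. i < n \<Longrightarrow> \<bar>x i\<bar> \<le> B) \<Longrightarrow> f x \<ge> \<delta>"
  shows "sphere_sos n \<pi> f"
proof -
  define g where "g = (\<lambda>x. f (\<lambda>i. 2 * B * x i + (- B)))"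
  have "polynomial n g" unfolding g_def by (rule polynomial_affine_substitution[OF f])
  moreover have "g x \<ge> \<delta>" if "\<And>i. i < n \<Longrightarrow> 0 \<le> x i \<and> x i \<le> 1" for x
  proof -
    have "\<bar>2 * B * x i + (- B)\<bar> \<le> B" if "i < n" for i
    proof -
      have "2 * B * x i \<le> 2 * B * 1" "0 \<le> 2 * B * x i"
        using B \<open>\<And>i. i < n \<Longrightarrow> 0 \<le> x i \<and> x i \<le> 1\<close>[OF that] by (intro mult_left_mono mult_nonneg_nonneg; simp)+
      then show ?thesis by linarith
    qed
    then show ?thesis unfolding g_def by (intro pos)
  qed
  ultimately obtain N b where b: "\<And>k. k \<in> PiE {..<n} (\<lambda>_. {..N}) \<Longrightarrow> b k \<ge> 0" and
    g: "\<And>x. g x = (\<Sum>k\<in>PiE {..<n} (\<lambda>_. {..N}). b k * (\<Prod>i<n. Bernstein N (k i) (x i)))"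
    using positive_on_box_Bernstein[OF _ \<open>\<delta> > 0\<close>, of n g] by blast
  have "f x = g (\<lambda>i. (B + 1 * x i) / (2 * B))" for x using B by (simp add: g_def)
  moreover have "1 - (B + 1 * y) / (2 * B) = (B + (-1) * y) / (2 * B)" for y using B by (simp add: field_simps)
  ultimately have "f = (\<lambda>x. \<Sum>k\<in>PiE {..<n} (\<lambda>_. {..N}). b k * (\<Prod>i<n. real (N choose k i) *
      ((B + 1 * x i) / (2 * B)) ^ k i * ((B + (-1) * x i) / (2 * B)) ^ (N - k i)))"
    unfolding g Bernstein_def by (intro ext) (simp only:)
  moreover have "sphere_sos n \<pi> \<dots>"
    using b B \<pi> by (intro sphere_sos_sum sphere_sos_mult sphere_sos_prod sphere_sos_power sphere_sos_linear
        sphere_sos_const) auto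
  ultimately show ?thesis by simp
qed

text \<open>Where \<open>f\<close> is not positive, \<open>g\<close> is bounded away from 0 by
  compactness, so a large multiple of \<open>g\<close> outweighs the minimum of
  \<open>f\<close>.\<close>

lemma positive_by_penalty:
  fixes f g :: "'a::topological_space \<Rightarrow> real"
  assumes "compact X" "continuous_on X f" "continuous_on X g"
    and g: "\<And>x. x \<in> X \<Longrightarrow> g x \<ge> 0" and f: "\<And>x. x \<in> X \<Longrightarrow> g x = 0 \<Longrightarrow> f x > 0"
  shows "\<exists>\<Lambda>>0. \<exists>\<delta>>0. \<forall>x\<in>X. f x + \<Lambda> * g x \<ge> \<delta>"
proof -
  define Y where "Y = {x \<in> X. f x \<le> 0}"
  have "compact Y"
  proof -
    have "closedin (top_of_set X) (X \<inter> f -` {..0})"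
      by (rule continuous_closedin_preimage[OF assms(2)]) simp
    moreover have "X \<inter> f -` {..0} = Y" by (auto simp: Y_def)
    ultimately show ?thesis using closedin_compact[OF \<open>compact X\<close>] by simp
  qed
  have cY: "continuous_on Y f" "continuous_on Y g"
    using assms(2,3) by (auto intro: continuous_on_subset simp: Y_def)
  obtain \<Lambda> where "\<Lambda> > 0" and \<Lambda>: "\<And>x. x \<in> X \<Longrightarrow> f x + \<Lambda> * g x > 0"
  proof (cases "Y = {}")
    case True
    have "f x + 1 * g x > 0" if "x \<in> X" for x
      using True g[OF that] that by (force simp: Y_def)
    then show ?thesis using that[of 1] by simp
  next
    case False
    obtain p where p: "p \<in> Y" "\<And>x. x \<in> Y \<Longrightarrow> g p \<le> g x"
      using continuous_attains_inf[OF \<open>compact Y\<close> False cY(2)] by blast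
    obtain q where q: "q \<in> Y" "\<And>x. x \<in> Y \<Longrightarrow> f q \<le> f x"
      using continuous_attains_inf[OF \<open>compact Y\<close> False cY(1)] by blast
    have gp: "g p > 0" using p(1) g[of p] f[of p] by (force simp: Y_def)
    have fq: "f q \<le> 0" using q by (simp add: Y_def)
    \<comment> \<open>With this value the penalty on \<open>Y\<close> is at least 1 - min f.\<close>
    define \<Lambda> where "\<Lambda> = (1 - f q) / g p"
    have "\<Lambda> > 0" using gp fq by (simp add: \<Lambda>_def)
    moreover have "f x + \<Lambda> * g x > 0" if "x \<in> X" for x
    proof (cases "x \<in> Y")
      case True
      have "1 - f q = \<Lambda> * g p" using gp by (simp add: \<Lambda>_def)
      also have "\<dots> \<le> \<Lambda> * g x" using p(2)[OF True] \<open>\<Lambda> > 0\<close> by simp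
      finally show ?thesis using q(2)[OF True] by linarith
    next
      case False
      then show ?thesis using that g[OF that] \<open>\<Lambda> > 0\<close> by (auto simp: Y_def intro!: add_pos_nonneg)
    qed
    ultimately show ?thesis using that by blast
  qed
  have "\<exists>\<delta>>0. \<forall>x\<in>X. f x + \<Lambda> * g x \<ge> \<delta>"
  proof (cases "X = {}")
    case True then show ?thesis by (intro exI[of _ 1]) simp
  next
    case False
    obtain p where "p \<in> X" "\<forall>x\<in>X. f p + \<Lambda> * g p \<le> f x + \<Lambda> * g x"
      using continuous_attains_inf[OF \<open>compact X\<close> False, of "\<lambda>x. f x + \<Lambda> * g x"]
        continuous_on_add[OF assms(2) continuous_on_mult_left[OF assms(3)]]
      by blast
    then show ?thesis using \<Lambda>[of p] by blast
  qed
  with \<open>\<Lambda> > 0\<close> show ?thesis by blast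
qed

text \<open>The polynomial -t (1 - t/B)^(2N) imitates max 0 (-t): for t >= 0 the high power damps it
  to at most B/(2N) in size, for t < 0 its factor is at least 1. It is -t times a square, so it can
  be moved into the term x_i \<sigma>_i.\<close>

lemma coordinate_penalty:
  fixes t B :: real
  assumes "\<bar>t\<bar> \<le> B" "B > 0" "N > 0"
  shows "max 0 (- t) - B / real (2 * N) \<le> - (t * (1 - t / B) ^ (2 * N))"
proof (cases "t \<ge> 0")
  case True
  have "t * (1 - t / B) ^ (2 * N) \<le> t * (1 / (1 + real (2 * N) * (t / B)))"
    using assms True by (intro mult_left_mono power_le_inverse_linear) auto
  also have "\<dots> \<le> B / real (2 * N)"
  proof -
    have "t * real (2 * N) \<le> B * (1 + real (2 * N) * (t / B))"
      using assms by (simp add: field_simps)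
    moreover have "1 + real (2 * N) * (t / B) > 0" using True assms by (intro add_pos_nonneg) auto
    ultimately show ?thesis using assms by (simp add: divide_le_eq pos_le_divide_eq mult.commute)
  qed
  finally show ?thesis using True by simp
next
  case False
  have "1 \<le> (1 - t / B) ^ (2 * N)" using False assms by (intro one_le_power) (simp add: divide_nonpos_pos)
  then have "- t * 1 \<le> - t * (1 - t / B) ^ (2 * N)" using False by (intro mult_left_mono) auto
  moreover have "B / real (2 * N) \<ge> 0" using assms by simp
  moreover have "max 0 (- t) = - t" using False by simp
  ultimately show ?thesis by linarith
qed

theorem positivstellensatz_sphere_orthant:
  assumes f: "polynomial n f" and \<pi>: "\<And>i. i < n \<Longrightarrow> \<pi> i > 0"
    and pos: "\<And>x. (\<And>i. i < n \<Longrightarrow> x i \<ge> 0) \<Longrightarrow> pi_norm2 n \<pi> x = 1 \<Longrightarrow> f x > 0"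
  shows "quadratic_module n \<pi> f"
proof -
  \<comment> \<open>At least 1 and at least every 1 / \<open>\<pi> i\<close>, hence B^2 \<pi>_i >=
    1: the box contains the sphere.\<close>
  define B where "B = 1 + (\<Sum>i<n. 1 / \<pi> i)"
  have B1: "B \<ge> 1" unfolding B_def using \<pi> by (auto intro!: sum_nonneg simp: less_imp_le)
  have B2: "B\<^sup>2 * \<pi> i \<ge> 1" if "i < n" for i
  proof -
    have "1 / \<pi> i \<le> (\<Sum>i<n. 1 / \<pi> i)" using that \<pi> by (intro member_le_sum) (auto simp: less_imp_le)
    then have "1 / \<pi> i \<le> B" by (simp add: B_def)
    then have "1 \<le> B * \<pi> i" using \<pi>[OF that] by (simp add: divide_le_eq)
    also have "\<dots> \<le> B * (B * \<pi> i)" using B1 \<pi>[OF that] by simp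
    finally show ?thesis by (simp add: power2_eq_square)
  qed
  \<comment> \<open>Coordinates from n on are frozen at 0, which makes the set compact in the
    product topology.\<close>
  define X where "X = PiE UNIV (\<lambda>i. if i < n then {-B..B} else {0::real})"
  have "compactin (product_topology (\<lambda>i::nat. euclidean) UNIV) X"
    unfolding X_def compactin_PiE by auto
  then have "compact X" by (simp add: euclidean_product_topology)
  have co: "continuous_on X (\<lambda>x. x i)" for i :: nat
    by (rule continuous_on_subset[OF continuous_on_product_coordinates]) simp
  \<comment> \<open>On \<open>X\<close> this vanishes exactly on the nonnegative part of the
    sphere.\<close>
  define g where "g = (\<lambda>x. (\<Sum>i<n. max 0 (- x i)) + (pi_norm2 n \<pi> x - 1)\<^sup>2)"
  have "\<exists>\<Lambda>>0. \<exists>\<delta>>0. \<forall>x\<in>X. f x + \<Lambda> * g x \<ge> \<delta>"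
  proof (rule positive_by_penalty[OF \<open>compact X\<close> polynomial_continuous[OF f]])
    show "continuous_on X g"
      unfolding g_def
      by (intro continuous_intros co polynomial_continuous[OF polynomial_pi_norm2])
    fix x
    show "g x \<ge> 0" unfolding g_def by (intro add_nonneg_nonneg sum_nonneg) auto
    assume "g x = 0"
    then have "(\<Sum>i<n. max 0 (- x i)) = 0" "(pi_norm2 n \<pi> x - 1)\<^sup>2 = 0"
      unfolding g_def by (subst (asm) add_nonneg_eq_0_iff; simp add: sum_nonneg)+
    then have "\<forall>i<n. max 0 (- x i) = 0" "pi_norm2 n \<pi> x = 1"
      by (subst (asm) sum_nonneg_eq_0_iff; simp)+
    then show "f x > 0" by (intro pos) (auto simp: max_def not_le split: if_splits)
  qed
  then obtain \<Lambda> \<delta> where "\<Lambda> > 0" "\<delta> > 0" and pen: "\<And>x. x \<in> X \<Longrightarrow> f x + \<Lambda> * g x \<ge> \<delta>" by blast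
  \<comment> \<open>Each of the n coordinate penalties loses at most B/(2N); scaled by
    \<open>\<Lambda>\<close>, they use up at most half of \<open>\<delta>\<close>.\<close>
  obtain N :: nat where N: "real N > max 0 (\<Lambda> * real n * B / \<delta>)" using reals_Archimedean2 by blast
  then have "N > 0" by auto
  have NB: "\<Lambda> * (real n * (B / real (2 * N))) \<le> \<delta> / 2"
    using N \<open>N > 0\<close> \<open>\<delta> > 0\<close> by (simp add: field_simps)
  \<comment> \<open>Moving the corrections back writes \<open>f\<close> as \<open>F\<close> plus x_i
    times squares plus a multiple of the sphere equation.\<close>
  define F where "F = (\<lambda>x. f x - \<Lambda> * (\<Sum>i<n. x i * (1 - x i / B) ^ (2 * N)) + \<Lambda> * (pi_norm2 n \<pi> x - 1)\<^sup>2)"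
  have pdiv: "polynomial n (\<lambda>x. 1 - x i / B)" if "i < n" for i
    using polynomial_diff[OF polynomial_const polynomial_mult[OF polynomial_const[of n "1 / B"] polynomial_coord[OF that]]]
    by simp
  have polyF: "polynomial n F"
    unfolding F_def by (intro polynomial_intros f pdiv) auto
  have "F x \<ge> \<delta> / 2" if x: "\<And>i. i < n \<Longrightarrow> \<bar>x i\<bar> \<le> B" for x
  proof -
    define y where "y = (\<lambda>i. if i < n then x i else 0)"
    have "y \<in> X" using x by (auto simp: X_def y_def abs_le_iff minus_le_iff)
    have "F x = F y" by (rule polynomial_cong[OF polyF]) (simp add: y_def)
    have "(\<Sum>i<n. max 0 (- y i)) - real n * (B / real (2 * N)) = (\<Sum>i<n. max 0 (- y i) - B / real (2 * N))"
      by (simp add: sum_subtractf)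
    also have "\<dots> \<le> (\<Sum>i<n. - (y i * (1 - y i / B) ^ (2 * N)))"
      using x B1 \<open>N > 0\<close> by (intro sum_mono coordinate_penalty) (auto simp: y_def)
    finally have "\<Lambda> * ((\<Sum>i<n. max 0 (- y i)) - real n * (B / real (2 * N)))
        \<le> \<Lambda> * (\<Sum>i<n. - (y i * (1 - y i / B) ^ (2 * N)))"
      using \<open>\<Lambda> > 0\<close> by simp
    then have "F y \<ge> f y + \<Lambda> * g y - \<Lambda> * (real n * (B / real (2 * N)))"
      unfolding F_def g_def by (simp add: sum_negf algebra_simps)
    then show ?thesis using pen[OF \<open>y \<in> X\<close>] NB \<open>F x = F y\<close> by linarith
  qed
  then have "sphere_sos n \<pi> F"
    using B1 B2 \<pi> \<open>\<delta> > 0\<close> polyF by (intro sphere_sos_if_positive_on_box[of n F \<pi> B "\<delta> / 2"]) auto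
  then obtain \<sigma> \<phi> where sg: "sos n \<sigma>" "polynomial n \<phi>" "\<And>x. F x = \<sigma> x + \<phi> x * (pi_norm2 n \<pi> x - 1)"
    using sphere_sosE by blast
  show ?thesis
    unfolding quadratic_module_def
  proof (intro exI conjI allI impI)
    show "sos n \<sigma>" by fact
    show "sos n (\<lambda>x. \<Lambda> * (1 - x i / B) ^ (2 * N))" if "i < n" for i
      using \<open>\<Lambda> > 0\<close> that by (intro sos_mult sos_const sos_even_power pdiv) auto
    show "polynomial n (\<lambda>x. \<phi> x - \<Lambda> * (pi_norm2 n \<pi> x - 1))"
      by (intro polynomial_intros sg)
    fix x
    have "f x = F x + \<Lambda> * (\<Sum>i<n. x i * (1 - x i / B) ^ (2 * N)) - \<Lambda> * (pi_norm2 n \<pi> x - 1)\<^sup>2"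
      by (simp add: F_def)
    also have "\<Lambda> * (\<Sum>i<n. x i * (1 - x i / B) ^ (2 * N)) = (\<Sum>i<n. x i * (\<Lambda> * (1 - x i / B) ^ (2 * N)))"
      by (simp add: sum_distrib_left mult.left_commute)
    finally show "f x = \<sigma> x + (\<Sum>i<n. x i * (\<Lambda> * (1 - x i / B) ^ (2 * N)))
        + (\<phi> x - \<Lambda> * (pi_norm2 n \<pi> x - 1)) * (pi_norm2 n \<pi> x - 1)"
      unfolding sg(3) by (simp add: algebra_simps power2_eq_square)
  qed
qed

section \<open>Closure of the quadratic module and recovery of degrees\<close>

lemma quadratic_moduleI:
  "sos n \<sigma>0 \<Longrightarrow> (\<And>i. i < n \<Longrightarrow> sos n (\<sigma> i)) \<Longrightarrow> polynomial n \<phi> \<Longrightarrow>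
    (\<And>x. f x = \<sigma>0 x + (\<Sum>i<n. x i * \<sigma> i x) + \<phi> x * (pi_norm2 n \<pi> x - 1)) \<Longrightarrow> quadratic_module n \<pi> f"
  unfolding quadratic_module_def by blast

lemma quadratic_moduleE:
  assumes "quadratic_module n \<pi> f"
  obtains \<sigma>0 \<sigma> \<phi> where "sos n \<sigma>0" "\<And>i. i < n \<Longrightarrow> sos n (\<sigma> i)" "polynomial n \<phi>"
    "\<And>x. f x = \<sigma>0 x + (\<Sum>i<n. x i * \<sigma> i x) + \<phi> x * (pi_norm2 n \<pi> x - 1)"
  using assms unfolding quadratic_module_def by blast

lemma quadratic_module_of_sos: "sos n f \<Longrightarrow> quadratic_module n \<pi> f"
  by (rule quadratic_moduleI[of n f "\<lambda>_ _. 0" "\<lambda>_. 0"]) (auto intro: polynomial_const sos_const)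

lemma quadratic_module_ideal: "polynomial n \<phi> \<Longrightarrow> quadratic_module n \<pi> (\<lambda>x. \<phi> x * (pi_norm2 n \<pi> x - 1))"
  by (rule quadratic_moduleI[of n "\<lambda>_. 0" "\<lambda>_ _. 0" \<phi>]) (auto intro: sos_const)

lemma quadratic_module_add:
  assumes "quadratic_module n \<pi> f" "quadratic_module n \<pi> g"
  shows "quadratic_module n \<pi> (\<lambda>x. f x + g x)"
proof -
  obtain \<sigma>0 \<sigma> \<phi> where f: "sos n \<sigma>0" "\<And>i. i < n \<Longrightarrow> sos n (\<sigma> i)" "polynomial n \<phi>"
    "\<And>x. f x = \<sigma>0 x + (\<Sum>i<n. x i * \<sigma> i x) + \<phi> x * (pi_norm2 n \<pi> x - 1)"
    using quadratic_moduleE[OF assms(1)] by blast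
  obtain \<sigma>0' \<sigma>' \<phi>' where g: "sos n \<sigma>0'" "\<And>i. i < n \<Longrightarrow> sos n (\<sigma>' i)" "polynomial n \<phi>'"
    "\<And>x. g x = \<sigma>0' x + (\<Sum>i<n. x i * \<sigma>' i x) + \<phi>' x * (pi_norm2 n \<pi> x - 1)"
    using quadratic_moduleE[OF assms(2)] by blast
  show ?thesis
    by (rule quadratic_moduleI[of n "\<lambda>x. \<sigma>0 x + \<sigma>0' x" "\<lambda>i x. \<sigma> i x + \<sigma>' i x" "\<lambda>x. \<phi> x + \<phi>' x"])
       (use f(1-3) g(1-3) in \<open>auto intro: sos_add polynomial_add simp: f(4) g(4) algebra_simps sum.distrib\<close>)
qed

lemma quadratic_module_sos_mult:
  assumes "sos n g" "quadratic_module n \<pi> f"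
  shows "quadratic_module n \<pi> (\<lambda>x. g x * f x)"
proof -
  obtain \<sigma>0 \<sigma> \<phi> where f: "sos n \<sigma>0" "\<And>i. i < n \<Longrightarrow> sos n (\<sigma> i)" "polynomial n \<phi>"
    "\<And>x. f x = \<sigma>0 x + (\<Sum>i<n. x i * \<sigma> i x) + \<phi> x * (pi_norm2 n \<pi> x - 1)"
    using quadratic_moduleE[OF assms(2)] by blast
  show ?thesis
    by (rule quadratic_moduleI[of n "\<lambda>x. g x * \<sigma>0 x" "\<lambda>i x. g x * \<sigma> i x" "\<lambda>x. g x * \<phi> x"])
       (use f(1-3) assms(1) in \<open>auto intro: sos_mult polynomial_mult sos_polynomial
          simp: f(4) distrib_left sum_distrib_left mult_ac\<close>)
qed

lemma quadratic_module_sum: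
  "(\<And>i. i \<in> A \<Longrightarrow> quadratic_module n \<pi> (f i)) \<Longrightarrow> quadratic_module n \<pi> (\<lambda>x. \<Sum>i\<in>A. f i x)"
  by (induction A rule: infinite_finite_induct)
     (auto intro: quadratic_module_of_sos sos_const quadratic_module_add)

lemma SOS_Spi_mono:
  assumes "SOS_Spi n \<pi> d f" "d \<le> d'"
  shows "SOS_Spi n \<pi> d' f"
proof -
  from assms(1) obtain \<sigma>0 \<sigma> \<phi> where *: "mpoly_fun n (2*d) f" "sos_mpoly n d \<sigma>0"
    "\<forall>i<n. sos_mpoly n (d - 1) (\<sigma> i)" "mpoly_fun n (2*d - 2) \<phi>"
    "\<forall>x. f x = \<sigma>0 x + (\<Sum>i<n. x i * \<sigma> i x) + \<phi> x * (pi_norm2 n \<pi> x - 1)"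
    unfolding SOS_Spi_def by blast
  have "mpoly_fun n (2*d') f" by (rule mpoly_fun_mono[OF *(1)]) (use assms(2) in simp)
  moreover have "sos_mpoly n d' \<sigma>0" by (rule sos_mpoly_mono[OF *(2) assms(2)])
  moreover have "\<forall>i<n. sos_mpoly n (d' - 1) (\<sigma> i)"
    using *(3) assms(2) by (auto intro: sos_mpoly_mono)
  moreover have "mpoly_fun n (2*d' - 2) \<phi>" by (rule mpoly_fun_mono[OF *(4)]) (use assms(2) in simp)
  ultimately show ?thesis unfolding SOS_Spi_def using *(5) by blast
qed

lemma quadratic_module_imp_SOS_Spi:
  assumes "quadratic_module n \<pi> f" "polynomial n f"
  shows "\<exists>d. SOS_Spi n \<pi> d f"
proof -
  obtain \<sigma>0 \<sigma> \<phi> where f: "sos n \<sigma>0" "\<And>i. i < n \<Longrightarrow> sos n (\<sigma> i)" "polynomial n \<phi>"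
    "\<And>x. f x = \<sigma>0 x + (\<Sum>i<n. x i * \<sigma> i x) + \<phi> x * (pi_norm2 n \<pi> x - 1)"
    using quadratic_moduleE[OF assms(1)] by blast
  obtain k0 k1 k2 where k: "mpoly_fun n k0 f" "sos_mpoly n k1 \<sigma>0" "mpoly_fun n k2 \<phi>"
    using f assms(2) unfolding polynomial_def sos_def by blast
  have "\<forall>i. \<exists>k. i < n \<longrightarrow> sos_mpoly n k (\<sigma> i)" using f(2) unfolding sos_def by blast
  then obtain k3 where k3: "\<And>i. i < n \<Longrightarrow> sos_mpoly n (k3 i) (\<sigma> i)" by metis
  define d where "d = k0 + k1 + k2 + (\<Sum>i<n. k3 i) + 2"
  have k3d: "k3 i \<le> d - 1" if "i < n" for i
    using member_le_sum[of i "{..<n}" k3] that by (auto simp: d_def)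
  have "mpoly_fun n (2*d) f" by (rule mpoly_fun_mono[OF k(1)]) (simp add: d_def)
  moreover have "sos_mpoly n d \<sigma>0" by (rule sos_mpoly_mono[OF k(2)]) (simp add: d_def)
  moreover have "\<forall>i<n. sos_mpoly n (d - 1) (\<sigma> i)" using k3 k3d by (auto intro: sos_mpoly_mono)
  moreover have "mpoly_fun n (2*d - 2) \<phi>" by (rule mpoly_fun_mono[OF k(3)]) (simp add: d_def)
  ultimately have "SOS_Spi n \<pi> d f" unfolding SOS_Spi_def using f(4) by blast
  then show ?thesis by blast
qed

lemma SOS_Spi_nonneg:
  assumes "SOS_Spi n \<pi> d f" and "\<And>i. i < n \<Longrightarrow> x i \<ge> 0" and "pi_norm2 n \<pi> x = 1"
  shows "f x \<ge> 0"
proof -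
  from assms(1) obtain \<sigma>0 \<sigma> \<phi> where *: "sos_mpoly n d \<sigma>0" "\<And>i. i < n \<Longrightarrow> sos_mpoly n (d - 1) (\<sigma> i)"
    "\<And>x. f x = \<sigma>0 x + (\<Sum>i<n. x i * \<sigma> i x) + \<phi> x * (pi_norm2 n \<pi> x - 1)"
    unfolding SOS_Spi_def by blast
  have "(\<Sum>i<n. x i * \<sigma> i x) \<ge> 0"
    using assms(2) sos_mpoly_nonneg[OF *(2)] by (intro sum_nonneg) auto
  then show ?thesis
    unfolding *(3) using sos_mpoly_nonneg[OF *(1), of x] assms(3) by simp
qed

text \<open>Complete the square in the last variable; the Schur complement \<open>a'\<close> is
  again positive semidefinite, and the induction hypothesis applies to it.\<close>

lemma psd_form_sum_of_squares:
  fixes a :: "nat \<Rightarrow> nat \<Rightarrow> real"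
  assumes "\<And>i j. a i j = a j i" and "\<And>x. (\<Sum>i<n. \<Sum>j<n. a i j * x i * x j) \<ge> 0"
  shows "\<exists>ls. \<forall>x. (\<Sum>i<n. \<Sum>j<n. a i j * x i * x j) = (\<Sum>l\<leftarrow>ls. (\<Sum>i<n. l i * x i)\<^sup>2)"
  using assms
proof (induction n arbitrary: a)
  case 0
  show ?case by (intro exI[of _ "[]"]) simp
next
  case (Suc n)
  define Q where "Q = (\<lambda>x. \<Sum>i<n. \<Sum>j<n. a i j * x i * x j)"
  define b where "b = (\<lambda>x. \<Sum>i<n. a i n * x i)"
  define q where "q = a n n"
  have split: "(\<Sum>i<Suc n. \<Sum>j<Suc n. a i j * x i * x j) = Q x + 2 * x n * b x + q * (x n)\<^sup>2" for x
  proof -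
    have "(\<Sum>i<Suc n. \<Sum>j<Suc n. a i j * x i * x j)
        = Q x + (\<Sum>i<n. a i n * x i * x n) + (\<Sum>j<n. a n j * x n * x j) + a n n * x n * x n"
      by (simp add: Q_def sum.distrib)
    also have "(\<Sum>j<n. a n j * x n * x j) = (\<Sum>i<n. a i n * x i * x n)"
      by (intro sum.cong refl) (simp add: Suc.prems(1)[of n])
    finally show ?thesis
      by (simp add: b_def q_def power2_eq_square sum_distrib_left sum_distrib_right algebra_simps)
  qed
  have Qupd: "Q (x(n := t)) = Q x" and bupd: "b (x(n := t)) = b x" for x t
    unfolding Q_def b_def by (intro sum.cong refl; simp)+
  have psd: "Q x + 2 * t * b x + q * t\<^sup>2 \<ge> 0" for x t
    using Suc.prems(2)[of "x(n := t)"] unfolding split Qupd bupd by simp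
  have "q \<ge> 0" using psd[of "\<lambda>_. 0" 1] by (simp add: Q_def b_def)
  show ?case
  proof (cases "q = 0")
    case True
    \<comment> \<open>With zero pivot the form is affine in the last variable, so its slope 2 b must
      vanish; otherwise the value chosen below makes the form -1.\<close>
    have b0: "b x = 0" for x
    proof (rule ccontr)
      assume "b x \<noteq> 0"
      then show False using psd[of x "- (Q x + 1) / (2 * b x)"] True by (simp add: field_simps)
    qed
    have "Q x \<ge> 0" for x using psd[of x 0] by simp
    from Suc.IH[OF Suc.prems(1) this[unfolded Q_def]]
    obtain ls where ls: "\<And>x. Q x = (\<Sum>l\<leftarrow>ls. (\<Sum>i<n. l i * x i)\<^sup>2)" unfolding Q_def by blast
    show ?thesis
      by (intro exI[of _ "map (\<lambda>l. l(n := 0)) ls"] allI)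
         (simp only: split b0 True ls, simp add: o_def)
  next
    case False
    then have "q > 0" using \<open>q \<ge> 0\<close> by simp
    define a' where "a' = (\<lambda>i j. a i j - a i n * a j n / q)"
    have sym': "a' i j = a' j i" for i j by (simp add: a'_def Suc.prems(1)[of i j] mult.commute)
    have Q': "(\<Sum>i<n. \<Sum>j<n. a' i j * x i * x j) = Q x - (b x)\<^sup>2 / q" for x
    proof -
      have "(b x)\<^sup>2 / q = (\<Sum>i<n. \<Sum>j<n. (a i n * a j n / q) * x i * x j)"
        unfolding b_def power2_eq_square sum_product sum_divide_distrib by (simp add: mult_ac)
      then show ?thesis by (simp add: Q_def a'_def sum_subtractf algebra_simps)
    qed
    have "(\<Sum>i<n. \<Sum>j<n. a' i j * x i * x j) \<ge> 0" for x
    proof -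
      have "Q x + 2 * (- b x / q) * b x + q * (- b x / q)\<^sup>2 = Q x - (b x)\<^sup>2 / q"
        using \<open>q > 0\<close> by (simp add: field_simps power2_eq_square)
      then show ?thesis unfolding Q' using psd[of x "- b x / q"] by simp
    qed
    from Suc.IH[OF sym' this] obtain ls where
      ls: "\<And>x. Q x - (b x)\<^sup>2 / q = (\<Sum>l\<leftarrow>ls. (\<Sum>i<n. l i * x i)\<^sup>2)" unfolding Q' by blast
    define l0 where "l0 = (\<lambda>i. if i = n then sqrt q else a i n / sqrt q)"
    have l0: "(\<Sum>i<Suc n. l0 i * x i)\<^sup>2 = (b x)\<^sup>2 / q + 2 * x n * b x + q * (x n)\<^sup>2" for x
    proof -
      have "(\<Sum>i<Suc n. l0 i * x i) = b x / sqrt q + sqrt q * x n"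
        by (simp add: l0_def b_def sum_divide_distrib)
      then show ?thesis
        using \<open>q > 0\<close> by (simp add: power2_sum power_divide power_mult_distrib)
    qed
    show ?thesis
    proof (intro exI[of _ "l0 # map (\<lambda>l. l(n := 0)) ls"] allI)
      fix x
      have "(\<Sum>l\<leftarrow>map (\<lambda>l. l(n := 0)) ls. (\<Sum>i<Suc n. l i * x i)\<^sup>2) = Q x - (b x)\<^sup>2 / q"
        unfolding ls by (simp add: o_def)
      then show "(\<Sum>i<Suc n. \<Sum>j<Suc n. a i j * x i * x j)
          = (\<Sum>l\<leftarrow>l0 # map (\<lambda>l. l(n := 0)) ls. (\<Sum>i<Suc n. l i * x i)\<^sup>2)"
        unfolding split list.map(2) sum_list.Cons l0 by simp
    qed
  qed
qed

section \<open>The semidefinite hierarchy of a Markov chain\<close>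

context pade
begin

text \<open>Multiplication by S > 0 clears the denominator of r. For the degrees, m <= 2 ceil(m/2),
  and the term with \<open>R\<close> has degree at most m + 3, for which d >= 2 leaves room.\<close>

lemma SOS_interval_if_above:
  assumes "degree p \<le> 2 * d" "d \<ge> 2" and above: "\<And>t. 0 \<le> t \<Longrightarrow> t \<le> b \<Longrightarrow> 2 * t\<^sup>2 * r t \<le> poly p t"
  shows "SOS_interval (d + nat \<lceil>real m / 2\<rceil>) 0 b (S * p - [:0, 0, 2:] * [:-1, 1:] * R)"
  unfolding SOS_interval_def
proof (intro conjI ballI)
  have m: "m \<le> 2 * nat \<lceil>real m / 2\<rceil>" by linarith
  have degs: "degree S \<le> m" "degree R \<le> m" using pade by (auto simp: pade_log_def)
  show "degree (S * p - [:0, 0, 2:] * [:-1, 1:] * R) \<le> 2 * (d + nat \<lceil>real m / 2\<rceil>)"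
  proof (rule degree_diff_le)
    show "degree (S * p) \<le> 2 * (d + nat \<lceil>real m / 2\<rceil>)"
      by (rule order_trans[OF degree_mult_le]) (use m degs assms in simp)
    show "degree ([:0, 0, 2:] * [:-1, 1:] * R) \<le> 2 * (d + nat \<lceil>real m / 2\<rceil>)"
      by (rule order_trans[OF degree_mult_le]) (use m degs assms in simp)
  qed
  fix t assume t: "t \<in> {0..b}"
  have "poly (S * p - [:0, 0, 2:] * [:-1, 1:] * R) t = poly S t * (poly p t - 2 * t\<^sup>2 * r t)"
    using S_pos[of t] t by (simp add: r_def field_simps power2_eq_square)
  also have "\<dots> \<ge> 0" using S_pos[of t] above[of t] t by simp
  finally show "poly (S * p - [:0, 0, 2:] * [:-1, 1:] * R) t \<ge> 0" .
qed

end

section \<open>Stationary mass and the Poincare inequality\<close>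

locale markov_chain =
  fixes n :: nat and K :: "nat \<Rightarrow> nat \<Rightarrow> real" and \<pi> :: "nat \<Rightarrow> real"
  assumes n_ge_2: "n \<ge> 2" and kernel: "markov_kernel n K"
    and irreducible: "irreducible_kernel n K" and stationary: "stationary_dist n K \<pi>"
begin

abbreviation "E \<equiv> dirichlet n K \<pi>"
abbreviation "norm2 \<equiv> pi_norm2 n \<pi>"

lemma K_nonneg: "i < n \<Longrightarrow> j < n \<Longrightarrow> K i j \<ge> 0"
  using kernel by (simp add: markov_kernel_def)

lemma kpow_nonneg: "i < n \<Longrightarrow> j < n \<Longrightarrow> kpow n K k i j \<ge> 0"
  by (induction k arbitrary: j) (auto intro!: sum_nonneg mult_nonneg_nonneg K_nonneg)

lemma pi_nonneg: "i < n \<Longrightarrow> \<pi> i \<ge> 0" and pi_sum: "(\<Sum>i<n. \<pi> i) = 1"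
  and pi_step: "j < n \<Longrightarrow> (\<Sum>i<n. \<pi> i * K i j) = \<pi> j"
  using stationary by (auto simp: stationary_dist_def)

lemma pi_kpow: "j < n \<Longrightarrow> (\<Sum>i<n. \<pi> i * kpow n K k i j) = \<pi> j"
proof (induction k arbitrary: j)
  case 0
  have "(\<Sum>i<n. \<pi> i * kpow n K 0 i j) = (\<Sum>i<n. if i = j then \<pi> i else 0)"
    by (intro sum.cong) auto
  then show ?case using 0 by simp
next
  case (Suc k)
  have "(\<Sum>i<n. \<pi> i * kpow n K (Suc k) i j) = (\<Sum>i<n. \<Sum>l<n. \<pi> i * kpow n K k i l * K l j)"
    by (simp add: sum_distrib_left mult.assoc)
  also have "\<dots> = (\<Sum>l<n. (\<Sum>i<n. \<pi> i * kpow n K k i l) * K l j)"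
    by (subst sum.swap) (simp add: sum_distrib_right)
  also have "\<dots> = (\<Sum>l<n. \<pi> l * K l j)" by (intro sum.cong) (simp_all add: Suc.IH)
  finally show ?case using pi_step Suc.prems by simp
qed

text \<open>Mass present at some state reaches j after some number of steps, and stationarity turns
  it into mass at j.\<close>

lemma pi_pos: assumes "j < n" shows "\<pi> j > 0"
proof -
  obtain i where i: "i < n" "\<pi> i > 0"
  proof (rule ccontr)
    assume "\<not> thesis"
    then have "\<forall>i\<in>{..<n}. \<pi> i = 0" using that pi_nonneg by (auto simp: less_eq_real_def)
    then have "(\<Sum>i<n. \<pi> i) = 0" by (rule sum.neutral)
    then show False using pi_sum by simp
  qed
  obtain k where "kpow n K k i j > 0" using irreducible i assms by (auto simp: irreducible_kernel_def)
  then have "0 < \<pi> i * kpow n K k i j" using i by simp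
  also have "\<dots> \<le> (\<Sum>i<n. \<pi> i * kpow n K k i j)"
    using i assms by (intro member_le_sum) (auto intro!: mult_nonneg_nonneg pi_nonneg kpow_nonneg)
  finally show ?thesis using pi_kpow assms by simp
qed

lemma pi_less_1: assumes "i < n" shows "\<pi> i < 1"
proof -
  define j where "j = (if i = 0 then 1 else 0 :: nat)"
  have j: "j < n" "j \<noteq> i" using n_ge_2 by (auto simp: j_def)
  have "\<pi> i + \<pi> j = (\<Sum>k\<in>{i, j}. \<pi> k)" using j by simp
  also have "\<dots> \<le> (\<Sum>k<n. \<pi> k)" using assms j by (intro sum_mono2) (auto simp: pi_nonneg)
  finally show ?thesis using pi_pos[OF j(1)] pi_sum by simp
qed

lemma sos_dirichlet: "sos_mpoly n 1 E"
  unfolding dirichlet_def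
  using K_nonneg pi_nonneg
  by (intro sos_mpoly_cmult sos_mpoly_sum sos_mpoly_square mpoly_fun_diff mpoly_fun_coord) auto

lemma dirichlet_nonneg: "E x \<ge> 0"
  by (rule sos_mpoly_nonneg[OF sos_dirichlet])

text \<open>The square occurs in 2 E with weight \<pi>_i K_ij, and dropping it leaves a sum of
  squares. A certificate is kept, not just an inequality, because feasibility at d = 2 needs
  one.\<close>

lemma edge_bound:
  assumes "i < n" "j < n" "K i j > 0"
  shows "\<exists>C\<ge>0. sos_mpoly n 1 (\<lambda>x. C * E x - (x i - x j)\<^sup>2)"
proof -
  let ?c = "\<pi> i * K i j"
  have c: "?c > 0" using assms pi_pos by simp
  let ?I = "{..<n} \<times> {..<n}"
  have "sos_mpoly n 1 (\<lambda>x. 1 / ?c * (\<Sum>p\<in>?I - {(i, j)}. \<pi> (fst p) * K (fst p) (snd p) * (x (fst p) - x (snd p))\<^sup>2))"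
    using K_nonneg pi_nonneg c
    by (intro sos_mpoly_cmult sos_mpoly_sum sos_mpoly_square mpoly_fun_diff mpoly_fun_coord) auto
  moreover have "1 / ?c * (\<Sum>p\<in>?I - {(i, j)}. \<pi> (fst p) * K (fst p) (snd p) * (x (fst p) - x (snd p))\<^sup>2)
      = 2 / ?c * E x - (x i - x j)\<^sup>2" for x
  proof -
    have "2 * E x = (\<Sum>p\<in>?I. \<pi> (fst p) * K (fst p) (snd p) * (x (fst p) - x (snd p))\<^sup>2)"
      unfolding dirichlet_def by (simp add: sum.cartesian_product case_prod_unfold)
    also have "\<dots> = ?c * (x i - x j)\<^sup>2 + (\<Sum>p\<in>?I - {(i, j)}. \<pi> (fst p) * K (fst p) (snd p) * (x (fst p) - x (snd p))\<^sup>2)"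
      using assms by (subst sum.remove[of _ "(i, j)"]) auto
    finally have eq: "2 * E x = ?c * (x i - x j)\<^sup>2 +
        (\<Sum>p\<in>?I - {(i, j)}. \<pi> (fst p) * K (fst p) (snd p) * (x (fst p) - x (snd p))\<^sup>2)" .
    have alg: "1 / c * W = 2 / c * e - s" if "2 * e = c * s + W" "c > 0" for c e s W :: real
      using that by (simp add: field_simps)
    show ?thesis by (rule alg[OF eq c])
  qed
  ultimately show ?thesis using c by (intro exI[of _ "2 / ?c"]) auto
qed

text \<open>Induction along a path by (u + v)^2 + (u - v)^2 = 2 u^2 + 2 v^2, whose second square
  goes into the certificate.\<close>

lemma path_bound:
  assumes "i < n" "j < n" "kpow n K k i j > 0"
  shows "\<exists>C\<ge>0. sos_mpoly n 1 (\<lambda>x. C * E x - (x i - x j)\<^sup>2)"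
  using assms(2,3)
proof (induction k arbitrary: j)
  case 0
  then have "i = j" by (auto split: if_splits)
  then show ?case by (intro exI[of _ 0]) (simp add: sos_mpoly_zero)
next
  case (Suc k)
  then have "\<not> (\<forall>l\<in>{..<n}. kpow n K k i l * K l j \<le> 0)"
    using sum_nonpos[of "{..<n}" "\<lambda>l. kpow n K k i l * K l j"] by force
  then obtain l where l: "l < n" "kpow n K k i l * K l j > 0" by (auto simp: not_le)
  then have "kpow n K k i l > 0" "K l j > 0"
    using K_nonneg[OF l(1) Suc.prems(1)] kpow_nonneg[OF assms(1) l(1), of k]
    by (auto simp: zero_less_mult_iff)
  then obtain C C' where C: "C \<ge> 0" "sos_mpoly n 1 (\<lambda>x. C * E x - (x i - x l)\<^sup>2)"
    and C': "C' \<ge> 0" "sos_mpoly n 1 (\<lambda>x. C' * E x - (x l - x j)\<^sup>2)"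
    using Suc.IH[OF l(1)] edge_bound[OF l(1) Suc.prems(1)] by blast
  have "sos_mpoly n 1 (\<lambda>x. ((x i - x l) - (x l - x j))\<^sup>2 + (2 * (C * E x - (x i - x l)\<^sup>2) + 2 * (C' * E x - (x l - x j)\<^sup>2)))"
    using assms(1) l(1) Suc.prems(1)
    by (intro sos_mpoly_add sos_mpoly_cmult C C' sos_mpoly_square mpoly_fun_diff mpoly_fun_coord) auto
  moreover have "((x i - x l) - (x l - x j))\<^sup>2 + (2 * (C * E x - (x i - x l)\<^sup>2) + 2 * (C' * E x - (x l - x j)\<^sup>2))
      = (2 * C + 2 * C') * E x - (x i - x j)\<^sup>2" for x
    by (simp add: power2_eq_square algebra_simps)
  ultimately show ?case using C C' by (intro exI[of _ "2 * C + 2 * C'"]) auto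
qed

text \<open>One constant for all pairs: the sum of the individual ones, plus 1 for positivity. The
  excess is a multiple of \<open>E\<close>, itself a sum of squares.\<close>

lemma poincare_sos:
  obtains C where "C > 0" "\<And>i j. i < n \<Longrightarrow> j < n \<Longrightarrow> sos_mpoly n 1 (\<lambda>x. C * E x - (x i - x j)\<^sup>2)"
proof -
  define good where "good = (\<lambda>i j C. C \<ge> 0 \<and> sos_mpoly n 1 (\<lambda>x. C * E x - (x i - x j)\<^sup>2))"
  define c where "c = (\<lambda>i j. SOME C. good i j C)"
  have "good i j (c i j)" if "i < n" "j < n" for i j
  proof -
    obtain k where "kpow n K k i j > 0" using irreducible \<open>i < n\<close> \<open>j < n\<close> unfolding irreducible_kernel_def by blast
    from path_bound[OF that this] have "\<exists>C. good i j C" unfolding good_def .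
    then show ?thesis unfolding c_def by (rule someI_ex)
  qed
  then have c: "\<And>i j. i < n \<Longrightarrow> j < n \<Longrightarrow> c i j \<ge> 0"
    "\<And>i j. i < n \<Longrightarrow> j < n \<Longrightarrow> sos_mpoly n 1 (\<lambda>x. c i j * E x - (x i - x j)\<^sup>2)"
    unfolding good_def by blast+
  define C where "C = 1 + (\<Sum>i<n. \<Sum>j<n. c i j)"
  have "(\<Sum>i<n. \<Sum>j<n. c i j) \<ge> 0" by (intro sum_nonneg) (auto simp: c)
  then have "C > 0" by (simp add: C_def)
  moreover have "sos_mpoly n 1 (\<lambda>x. C * E x - (x i - x j)\<^sup>2)" if ij: "i < n" "j < n" for i j
  proof -
    have "c i j \<le> (\<Sum>j<n. c i j)" using ij by (intro member_le_sum) (auto simp: c)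
    also have "\<dots> \<le> (\<Sum>i<n. \<Sum>j<n. c i j)"
      using ij by (intro member_le_sum[of i _ "\<lambda>i. \<Sum>j<n. c i j"]) (auto intro!: sum_nonneg simp: c)
    finally have "C - c i j \<ge> 0" by (simp add: C_def)
    then have "sos_mpoly n 1 (\<lambda>x. (C - c i j) * E x + (c i j * E x - (x i - x j)\<^sup>2))"
      by (intro sos_mpoly_add sos_mpoly_cmult sos_dirichlet c ij)
    then show ?thesis by (simp add: algebra_simps)
  qed
  ultimately show ?thesis using that by blast
qed

section \<open>Feasibility from d = 2 on\<close>

lemma variance_identity:
  "(\<Sum>i<n. \<Sum>j<n. \<pi> i * \<pi> j * (y i - y j)\<^sup>2) = 2 * ((\<Sum>i<n. \<pi> i * (y i)\<^sup>2) - (\<Sum>i<n. \<pi> i * y i)\<^sup>2)"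
proof -
  have "(\<Sum>i<n. \<Sum>j<n. \<pi> i * \<pi> j * (y i - y j)\<^sup>2)
      = (\<Sum>i<n. \<Sum>j<n. (\<pi> i * (y i)\<^sup>2) * \<pi> j) + (\<Sum>i<n. \<Sum>j<n. \<pi> i * (\<pi> j * (y j)\<^sup>2))
        - 2 * (\<Sum>i<n. \<Sum>j<n. (\<pi> i * y i) * (\<pi> j * y j))"
    unfolding sum_distrib_left sum.distrib[symmetric] sum_subtractf[symmetric]
    by (intro sum.cong refl) (simp add: power2_eq_square algebra_simps)
  also have "(\<Sum>i<n. \<Sum>j<n. (\<pi> i * (y i)\<^sup>2) * \<pi> j) = (\<Sum>i<n. \<pi> i * (y i)\<^sup>2)"
    by (simp add: pi_sum flip: sum_distrib_left)
  also have "(\<Sum>i<n. \<Sum>j<n. \<pi> i * (\<pi> j * (y j)\<^sup>2)) = (\<Sum>i<n. \<pi> i * (y i)\<^sup>2)"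
    by (simp add: pi_sum flip: sum_distrib_left sum_distrib_right)
  also have "(\<Sum>i<n. \<Sum>j<n. (\<pi> i * y i) * (\<pi> j * y j)) = (\<Sum>i<n. \<pi> i * y i)\<^sup>2"
    by (simp add: power2_eq_square sum_product)
  finally show ?thesis by simp
qed

lemma sum_inverse_pi_ge: assumes "i < n" shows "1 \<le> (\<Sum>k<n. 1 / \<pi> k) * \<pi> i"
proof -
  have "1 / \<pi> i \<le> (\<Sum>k<n. 1 / \<pi> k)"
    using assms pi_nonneg by (intro member_le_sum) auto
  then show ?thesis using pi_pos[OF assms] by (simp add: divide_le_eq)
qed

text \<open>The subtracted term is the variance of x^2. Its pair terms factor as (x_i - x_j)^2 (x_i
  + x_j)^2, the first factor being below C E and the second below c times the norm. Keeping the norm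
  as a factor makes the identity valid off the sphere.\<close>

lemma variance_of_squares_sos:
  obtains \<gamma> where "sos_mpoly n 2 (\<lambda>x. \<gamma> * E x * norm2 x - ((\<Sum>i<n. \<pi> i * x i ^ 4) - (norm2 x)\<^sup>2))"
proof -
  obtain C where C: "C > 0" "\<And>i j. i < n \<Longrightarrow> j < n \<Longrightarrow> sos_mpoly n 1 (\<lambda>x. C * E x - (x i - x j)\<^sup>2)"
    using poincare_sos by blast
  \<comment> \<open>The 2 lets c times the norm dominate 2 x_i^2 + 2 x_j^2 = (x_i + x_j)^2 + (x_i -
    x_j)^2.\<close>
  define c where "c = 2 * (\<Sum>k<n. 1 / \<pi> k)"
  have c_ge: "c * \<pi> k \<ge> 2" if "k < n" for k
    using sum_inverse_pi_ge[OF that] by (simp add: c_def)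
  have "c \<ge> 0" unfolding c_def using pi_nonneg by (intro mult_nonneg_nonneg sum_nonneg) auto
  have plus: "sos_mpoly n 1 (\<lambda>x. c * norm2 x - (x i + x j)\<^sup>2)" if ij: "i < n" "j < n" "i \<noteq> j" for i j
  proof -
    let ?w = "\<lambda>k. c * \<pi> k - ((if k = i then 2 else 0) + (if k = j then 2 else 0))"
    have "sos_mpoly n 1 (\<lambda>x. (x i - x j)\<^sup>2 + (\<Sum>k<n. ?w k * (x k)\<^sup>2))"
      using ij by (intro sos_mpoly_add sos_mpoly_sum sos_mpoly_cmult sos_mpoly_square mpoly_fun_diff
          mpoly_fun_coord) (use c_ge in \<open>fastforce+\<close>)
    moreover have "(\<Sum>k<n. ?w k * (x k)\<^sup>2) = c * norm2 x - 2 * (x i)\<^sup>2 - 2 * (x j)\<^sup>2" for x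
    proof -
      have "(\<Sum>k<n. ?w k * (x k)\<^sup>2) = (\<Sum>k<n. c * (\<pi> k * (x k)\<^sup>2)
          - (if k = i then 2 * (x k)\<^sup>2 else 0) - (if k = j then 2 * (x k)\<^sup>2 else 0))"
        by (intro sum.cong refl) (simp add: algebra_simps)
      then show ?thesis
        using ij by (simp add: sum_subtractf pi_norm2_def sum_distrib_left)
    qed
    ultimately have "sos_mpoly n 1 (\<lambda>x. (x i - x j)\<^sup>2 + (c * norm2 x - 2 * (x i)\<^sup>2 - 2 * (x j)\<^sup>2))" by simp
    moreover have "(x i - x j)\<^sup>2 + (c * norm2 x - 2 * (x i)\<^sup>2 - 2 * (x j)\<^sup>2) = c * norm2 x - (x i + x j)\<^sup>2" for x
      by (simp add: power2_eq_square algebra_simps)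
    ultimately show ?thesis by simp
  qed
  have sos_norm2: "sos_mpoly n 1 norm2"
    unfolding pi_norm2_def
    by (intro sos_mpoly_sum sos_mpoly_cmult sos_mpoly_square mpoly_fun_coord) (auto simp: pi_nonneg)
  have pair: "sos_mpoly n 2 (\<lambda>x. C * c * E x * norm2 x - ((x i)\<^sup>2 - (x j)\<^sup>2)\<^sup>2)" if ij: "i < n" "j < n" for i j
  proof (cases "i = j")
    case True
    have "sos_mpoly n (1 + 1) (\<lambda>x. (C * c) * (E x * norm2 x))"
      using C \<open>c \<ge> 0\<close> by (intro sos_mpoly_cmult sos_mpoly_mult sos_norm2 sos_dirichlet) auto
    then show ?thesis using True by (simp add: mult.assoc numeral_2_eq_2)
  next
    case False
    \<comment> \<open>The pattern is A B - a b = (A - a) B + a (B - b) with a = (x_i + x_j)^2 and b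
      = (x_i - x_j)^2.\<close>
    have "sos_mpoly n (1 + 1) (\<lambda>x. (c * norm2 x - (x i + x j)\<^sup>2) * (C * E x) + (x i + x j)\<^sup>2 * (C * E x - (x i - x j)\<^sup>2))"
      using C(1) by (intro sos_mpoly_add sos_mpoly_mult plus C(2) sos_mpoly_cmult sos_dirichlet sos_mpoly_square
          mpoly_fun_add mpoly_fun_coord ij False) auto
    moreover have "(c * norm2 x - (x i + x j)\<^sup>2) * (C * E x) + (x i + x j)\<^sup>2 * (C * E x - (x i - x j)\<^sup>2)
        = C * c * E x * norm2 x - ((x i)\<^sup>2 - (x j)\<^sup>2)\<^sup>2" for x
      by (simp add: power2_eq_square algebra_simps)
    ultimately show ?thesis by (simp add: numeral_2_eq_2)
  qed
  have "sos_mpoly n 2 (\<lambda>x. 1 / 2 * (\<Sum>i<n. \<Sum>j<n. (\<pi> i * \<pi> j) * (C * c * E x * norm2 x - ((x i)\<^sup>2 - (x j)\<^sup>2)\<^sup>2)))"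
    by (intro sos_mpoly_cmult sos_mpoly_sum pair) (auto simp: pi_nonneg)
  moreover have "1 / 2 * (\<Sum>i<n. \<Sum>j<n. (\<pi> i * \<pi> j) * (C * c * E x * norm2 x - ((x i)\<^sup>2 - (x j)\<^sup>2)\<^sup>2))
      = (C * c / 2) * E x * norm2 x - ((\<Sum>i<n. \<pi> i * x i ^ 4) - (norm2 x)\<^sup>2)" for x
  proof -
    define w where "w = C * c * E x * norm2 x"
    have "(\<Sum>i<n. \<Sum>j<n. (\<pi> i * \<pi> j) * (w - ((x i)\<^sup>2 - (x j)\<^sup>2)\<^sup>2))
        = (\<Sum>i<n. \<Sum>j<n. \<pi> i * \<pi> j) * w - (\<Sum>i<n. \<Sum>j<n. \<pi> i * \<pi> j * ((x i)\<^sup>2 - (x j)\<^sup>2)\<^sup>2)"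
      by (simp only: right_diff_distrib sum_subtractf sum_distrib_right)
    also have "(\<Sum>i<n. \<Sum>j<n. \<pi> i * \<pi> j * ((x i)\<^sup>2 - (x j)\<^sup>2)\<^sup>2) = 2 * ((\<Sum>i<n. \<pi> i * x i ^ 4) - (norm2 x)\<^sup>2)"
      unfolding variance_identity by (simp add: pi_norm2_def)
    finally show ?thesis by (simp add: pi_sum w_def flip: sum_product)
  qed
  ultimately have "sos_mpoly n 2 (\<lambda>x. (C * c / 2) * E x * norm2 x - ((\<Sum>i<n. \<pi> i * x i ^ 4) - (norm2 x)\<^sup>2))"
    by (simp only:)
  then show ?thesis by (rule that)
qed

lemma feasible_gamma_exists:
  assumes "pade_log m R S" "d \<ge> 2"
  shows "feasible_gammas n K \<pi> R S d m \<noteq> {}"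
proof -
  interpret pade m R S by unfold_locales fact
  \<comment> \<open>2 r <= 2 (t - 1) <= t^2 - 1, so t^2 (t^2 - 1) lies above 2 t^2 r for every m; on
    the sphere its average is the variance of x^2.\<close>
  define p :: "real poly" where "p = monom 1 4 - monom 1 2"
  have p: "poly p t = t ^ 4 - t\<^sup>2" for t by (simp add: p_def poly_monom)
  have degp: "degree p \<le> 4" unfolding p_def
    by (intro degree_diff_le order_trans[OF degree_monom_le]) auto
  obtain \<gamma> where \<gamma>: "sos_mpoly n 2 (\<lambda>x. \<gamma> * E x * norm2 x - ((\<Sum>i<n. \<pi> i * x i ^ 4) - (norm2 x)\<^sup>2))"
    using variance_of_squares_sos by blast
  have "SOS_Spi n \<pi> 2 (\<lambda>x. \<gamma> * E x - (\<Sum>i<n. \<pi> i * poly p (x i)))"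
    unfolding SOS_Spi_def
  proof (intro conjI exI allI impI)
    show "mpoly_fun n (2 * 2) (\<lambda>x. \<gamma> * E x - (\<Sum>i<n. \<pi> i * poly p (x i)))"
      using degp by (intro mpoly_fun_diff mpoly_fun_sum mpoly_fun_cmult mpoly_fun_poly
          mpoly_fun_mono[OF mpoly_fun_dirichlet]) auto
    show "sos_mpoly n 2 (\<lambda>x. \<gamma> * E x * norm2 x - ((\<Sum>i<n. \<pi> i * x i ^ 4) - (norm2 x)\<^sup>2))" by fact
    show "sos_mpoly n (2 - 1) (\<lambda>_. 0)" by (rule sos_mpoly_zero)
    \<comment> \<open>The cost of replacing \<gamma> E by \<gamma> E \<open>norm2\<close> and
      \<open>norm2\<close> by its square.\<close>
    show "mpoly_fun n (2 * 2 - 2) (\<lambda>x. - (\<gamma> * E x + norm2 x))"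
      by (intro mpoly_fun_uminus mpoly_fun_add mpoly_fun_cmult mpoly_fun_mono[OF mpoly_fun_dirichlet]
          mpoly_fun_mono[OF mpoly_fun_pi_norm2]) auto
    fix x
    have "(\<Sum>i<n. \<pi> i * poly p (x i)) = (\<Sum>i<n. \<pi> i * x i ^ 4) - norm2 x"
      by (simp add: p pi_norm2_def algebra_simps sum_subtractf)
    then show "\<gamma> * E x - (\<Sum>i<n. \<pi> i * poly p (x i)) = (\<gamma> * E x * norm2 x - ((\<Sum>i<n. \<pi> i * x i ^ 4) - (norm2 x)\<^sup>2))
        + (\<Sum>i<n. x i * 0) + - (\<gamma> * E x + norm2 x) * (norm2 x - 1)"
      by (simp add: power2_eq_square algebra_simps)
  qed
  then have sp: "SOS_Spi n \<pi> d (\<lambda>x. \<gamma> * E x - (\<Sum>i<n. \<pi> i * poly p (x i)))"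
    using SOS_Spi_mono assms(2) by blast
  have "SOS_interval (d + nat \<lceil>real m / 2\<rceil>) 0 b (S * p - [:0, 0, 2:] * [:-1, 1:] * R)" for b
  proof (rule SOS_interval_if_above)
    show "degree p \<le> 2 * d" "d \<ge> 2" using degp assms(2) by auto
    fix t :: real assume t: "0 \<le> t"
    show "2 * t\<^sup>2 * r t \<le> poly p t"
    proof (cases "t = 0")
      case False
      have "2 * (t - 1) \<le> t\<^sup>2 - 1" using zero_le_power2[of "t - 1"] by (simp add: power2_eq_square algebra_simps)
      then have "2 * r t \<le> t\<^sup>2 - 1" using r_le[of t] t False by simp
      then have "t\<^sup>2 * (2 * r t) \<le> t\<^sup>2 * (t\<^sup>2 - 1)" by (intro mult_left_mono) auto
      then show ?thesis unfolding p by (simp add: algebra_simps flip: power_add)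
    qed (simp add: p)
  qed
  then have "\<gamma> \<in> feasible_gammas n K \<pi> R S d m"
    unfolding feasible_gammas_def using sp degp assms(2) by (intro CollectI exI[of _ "\<lambda>_. p"]) auto
  then show ?thesis by blast
qed

section \<open>The sphere near the constant vector 1\<close>

definition \<tau> :: "(nat \<Rightarrow> real) \<Rightarrow> real" where "\<tau> x = (\<Sum>i<n. \<pi> i * (x i - 1)\<^sup>2)"

definition dev :: "(nat \<Rightarrow> real) \<Rightarrow> real" where "dev x = (\<Sum>i<n. \<pi> i * (x i - 1))"

definition orthant_sphere :: "(nat \<Rightarrow> real) set" where
  "orthant_sphere = {x. (\<forall>i<n. x i \<ge> 0) \<and> norm2 x = 1}"

lemma tau_nonneg: "\<tau> x \<ge> 0"
  unfolding \<tau>_def by (intro sum_nonneg) (auto simp: pi_nonneg)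

lemma sum_pi_squares: "(\<Sum>i<n. \<pi> i * ((x i)\<^sup>2 - 1)) = norm2 x - 1"
  by (simp add: pi_norm2_def right_diff_distrib sum_subtractf pi_sum)

text \<open>On the sphere \<open>dev\<close> is therefore -\<tau>/2: the linear deviation is of
  second order, and its square contributes only \<tau>^2/4.\<close>

lemma norm2_tau: "norm2 x - 1 = 2 * dev x + \<tau> x"
  unfolding sum_pi_squares[symmetric] dev_def \<tau>_def sum_distrib_left sum.distrib[symmetric]
  by (intro sum.cong refl) (simp add: power2_eq_square algebra_simps)

lemma sos_tau: "sos n (\<lambda>x. \<tau> x)"
  unfolding \<tau>_def by (intro sos_sum sos_mult sos_const sos_square polynomial_intros) (auto simp: pi_nonneg)

lemma polynomial_tau: "polynomial n (\<lambda>x. \<tau> x)"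
  by (rule sos_polynomial[OF sos_tau])

text \<open>A nonnegative vector has nonnegative mean, so \<open>dev\<close> is at least -1.\<close>

lemma tau_le_2: assumes "x \<in> orthant_sphere" shows "\<tau> x \<le> 2"
proof -
  have "dev x = (\<Sum>i<n. \<pi> i * x i) - 1"
    by (simp add: dev_def right_diff_distrib sum_subtractf pi_sum)
  moreover have "(\<Sum>i<n. \<pi> i * x i) \<ge> 0"
    using assms by (intro sum_nonneg mult_nonneg_nonneg pi_nonneg) (auto simp: orthant_sphere_def)
  moreover have "norm2 x = 1" using assms by (simp add: orthant_sphere_def)
  ultimately show ?thesis using norm2_tau[of x] by simp
qed

lemma orthant_sphere_coordinate:
  assumes "x \<in> orthant_sphere" "i < n"
  shows "0 \<le> x i" "\<pi> i * (x i)\<^sup>2 \<le> 1"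
proof -
  show "0 \<le> x i" using assms by (simp add: orthant_sphere_def)
  have "\<pi> i * (x i)\<^sup>2 \<le> norm2 x"
    unfolding pi_norm2_def using assms by (intro member_le_sum) (auto simp: pi_nonneg)
  then show "\<pi> i * (x i)\<^sup>2 \<le> 1" using assms by (simp add: orthant_sphere_def)
qed

text \<open>A common bound for the coordinates on the sphere and for all interval ends
  1/sqrt(\<pi>_i): it is at least 1/\<pi>_i, which exceeds its own square root.\<close>

definition coord_bound :: real where "coord_bound = (\<Sum>k<n. 1 / \<pi> k)"

lemma coord_bound_ge: assumes "i < n" shows "1 \<le> coord_bound * \<pi> i"
  using sum_inverse_pi_ge[OF assms] by (simp add: coord_bound_def)

lemma coord_bound_ge_1: "coord_bound \<ge> 1"
proof -
  have "0 < n" using n_ge_2 by simp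
  then have "1 \<le> coord_bound * \<pi> 0" by (rule coord_bound_ge)
  moreover have "coord_bound \<ge> 0" unfolding coord_bound_def by (intro sum_nonneg) (auto simp: pi_nonneg)
  moreover have "\<pi> 0 \<le> 1" using pi_less_1[OF \<open>0 < n\<close>] by simp
  ultimately show ?thesis using mult_left_mono[of "\<pi> 0" 1 coord_bound] by simp
qed

lemma le_coord_boundI: assumes "i < n" "\<pi> i * t\<^sup>2 \<le> 1" shows "t \<le> coord_bound"
proof (rule power2_le_imp_le)
  have "t\<^sup>2 * 1 \<le> t\<^sup>2 * (coord_bound * \<pi> i)" by (rule mult_left_mono[OF coord_bound_ge[OF assms(1)]]) simp
  moreover have "t\<^sup>2 * (coord_bound * \<pi> i) = coord_bound * (\<pi> i * t\<^sup>2)" by (simp only: mult_ac)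
  moreover have "coord_bound * (\<pi> i * t\<^sup>2) \<le> coord_bound * 1" by (rule mult_left_mono[OF assms(2)]) (use coord_bound_ge_1 in simp)
  moreover have "coord_bound * 1 \<le> coord_bound * coord_bound" by (rule mult_left_mono[OF coord_bound_ge_1]) (use coord_bound_ge_1 in simp)
  ultimately show "t\<^sup>2 \<le> coord_bound\<^sup>2" unfolding power2_eq_square[of coord_bound] by linarith
qed (use coord_bound_ge_1 in simp)

text \<open>The coefficients are symmetrised because \<open>psd_form_sum_of_squares\<close> asks for
  a symmetric matrix. The diagonal arises from unit row sums for x_i^2 and from stationarity for
  x_j^2.\<close>

lemma dirichlet_form:
  "E u = (\<Sum>i<n. \<Sum>j<n. ((if i = j then \<pi> i else 0) - (\<pi> i * K i j + \<pi> j * K j i) / 2) * u i * u j)"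
proof -
  let ?w = "\<lambda>i j. \<pi> i * K i j"
  have row: "(\<Sum>i<n. \<Sum>j<n. ?w i j * (u i)\<^sup>2) = (\<Sum>i<n. \<pi> i * (u i)\<^sup>2)"
  proof (intro sum.cong refl)
    fix i assume "i \<in> {..<n}"
    then have "(\<Sum>j<n. K i j) = 1" using kernel by (simp add: markov_kernel_def)
    then show "(\<Sum>j<n. ?w i j * (u i)\<^sup>2) = \<pi> i * (u i)\<^sup>2"
      by (simp flip: sum_distrib_left sum_distrib_right)
  qed
  have col: "(\<Sum>i<n. \<Sum>j<n. ?w i j * (u j)\<^sup>2) = (\<Sum>i<n. \<pi> i * (u i)\<^sup>2)"
    by (subst sum.swap) (simp add: pi_step flip: sum_distrib_right)
  have diag: "(\<Sum>i<n. \<Sum>j<n. (if i = j then \<pi> i else 0) * u i * u j) = (\<Sum>i<n. \<pi> i * (u i)\<^sup>2)"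
    by (intro sum.cong refl) (simp add: if_distrib[of "\<lambda>c. c * _ * _"] power2_eq_square cong: if_cong)
  have swap: "(\<Sum>i<n. \<Sum>j<n. ?w j i * u i * u j) = (\<Sum>i<n. \<Sum>j<n. ?w i j * u i * u j)"
    by (subst sum.swap) (simp add: mult_ac)
  have "2 * E u = (\<Sum>i<n. \<Sum>j<n. ?w i j * (u i)\<^sup>2) + (\<Sum>i<n. \<Sum>j<n. ?w i j * (u j)\<^sup>2)
      - 2 * (\<Sum>i<n. \<Sum>j<n. ?w i j * u i * u j)"
    unfolding dirichlet_def sum_distrib_left sum.distrib[symmetric] sum_subtractf[symmetric]
    by (intro sum.cong refl) (simp add: power2_eq_square algebra_simps)
  moreover have "(\<Sum>i<n. \<Sum>j<n. ((if i = j then \<pi> i else 0) - (?w i j + ?w j i) / 2) * u i * u j)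
      = (\<Sum>i<n. \<Sum>j<n. (if i = j then \<pi> i else 0) * u i * u j)
        - ((\<Sum>i<n. \<Sum>j<n. ?w i j * u i * u j) + (\<Sum>i<n. \<Sum>j<n. ?w j i * u i * u j)) / 2"
    unfolding sum_divide_distrib sum.distrib[symmetric] sum_subtractf[symmetric]
    by (intro sum.cong refl) (simp add: field_simps)
  ultimately show ?thesis unfolding row col diag swap by simp
qed

lemma dirichlet_shift: "E (\<lambda>i. x i - a) = E x"
  by (simp add: dirichlet_def)

lemma norm2_form: "norm2 u = (\<Sum>i<n. \<Sum>j<n. (if i = j then \<pi> i else 0) * u i * u j)"
  unfolding pi_norm2_def
  by (intro sum.cong refl) (simp add: if_distrib[of "\<lambda>c. c * _ * _"] power2_eq_square cong: if_cong)

lemma mean_form: "(\<Sum>i<n. \<pi> i * u i)\<^sup>2 = (\<Sum>i<n. \<Sum>j<n. (\<pi> i * \<pi> j) * u i * u j)"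
  unfolding power2_eq_square sum_product by (intro sum.cong refl) (simp only: mult_ac)

text \<open>Subtracting the mean m from u leaves \<open>E\<close> unchanged and lowers the norm by
  m^2, so the form with the added mean term is positive semidefinite everywhere. Its squares are
  then evaluated at x - 1.\<close>

lemma sos_if_spectral_gap:
  assumes gap: "\<And>v. (\<Sum>i<n. \<pi> i * v i) = 0 \<Longrightarrow> \<gamma> * E v \<ge> \<mu> * norm2 v"
  shows "sos n (\<lambda>x. \<gamma> * E x - \<mu> * \<tau> x + \<mu> * (dev x)\<^sup>2)"
proof -
  define a where "a = (\<lambda>i j. \<gamma> * ((if i = j then \<pi> i else 0) - (\<pi> i * K i j + \<pi> j * K j i) / 2)
      - \<mu> * (if i = j then \<pi> i else 0) + \<mu> * (\<pi> i * \<pi> j))"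
  have form: "(\<Sum>i<n. \<Sum>j<n. a i j * u i * u j) = \<gamma> * E u - \<mu> * norm2 u + \<mu> * (\<Sum>i<n. \<pi> i * u i)\<^sup>2" for u
    unfolding dirichlet_form norm2_form mean_form sum_distrib_left sum.distrib[symmetric] sum_subtractf[symmetric] a_def
    by (intro sum.cong refl) (simp add: algebra_simps)
  have sym: "a i j = a j i" for i j by (simp add: a_def add.commute mult.commute)
  have psd: "(\<Sum>i<n. \<Sum>j<n. a i j * u i * u j) \<ge> 0" for u
  proof -
    define m where "m = (\<Sum>i<n. \<pi> i * u i)"
    define v where "v = (\<lambda>i. u i - m)"
    have "(\<Sum>i<n. \<pi> i * v i) = 0"
      by (simp add: v_def m_def right_diff_distrib sum_subtractf pi_sum flip: sum_distrib_right)
    from gap[OF this] have g: "\<gamma> * E u \<ge> \<mu> * norm2 v"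
      unfolding v_def dirichlet_shift .
    have "norm2 v = (\<Sum>i<n. \<pi> i * (u i)\<^sup>2 - 2 * m * (\<pi> i * u i) + m\<^sup>2 * \<pi> i)"
      unfolding pi_norm2_def v_def by (intro sum.cong refl) (simp add: power2_eq_square algebra_simps)
    also have "\<dots> = norm2 u - 2 * m * m + m\<^sup>2"
      by (simp add: sum.distrib sum_subtractf pi_norm2_def m_def pi_sum flip: sum_distrib_left)
    finally have "norm2 v = norm2 u - m\<^sup>2" by (simp add: power2_eq_square)
    then have "\<mu> * norm2 v = \<mu> * norm2 u - \<mu> * m\<^sup>2" by (simp add: right_diff_distrib)
    then show ?thesis unfolding form m_def[symmetric] using g by linarith
  qed
  have "\<exists>ls. \<forall>u. \<gamma> * E u - \<mu> * norm2 u + \<mu> * (\<Sum>i<n. \<pi> i * u i)\<^sup>2 = (\<Sum>l\<leftarrow>ls. (\<Sum>i<n. l i * u i)\<^sup>2)"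
    using psd_form_sum_of_squares[OF sym psd] unfolding form .
  then obtain ls where
    ls: "\<forall>u. \<gamma> * E u - \<mu> * norm2 u + \<mu> * (\<Sum>i<n. \<pi> i * u i)\<^sup>2 = (\<Sum>l\<leftarrow>ls. (\<Sum>i<n. l i * u i)\<^sup>2)"
    by (rule exE)
  have "\<gamma> * E x - \<mu> * \<tau> x + \<mu> * (dev x)\<^sup>2 = (\<Sum>l\<leftarrow>ls. (\<Sum>i<n. l i * (x i - 1))\<^sup>2)" for x
    using spec[OF ls, of "\<lambda>i. x i - 1"] by (simp only: dirichlet_shift \<tau>_def dev_def pi_norm2_def)
  moreover have "sos n (\<lambda>x. \<Sum>l\<leftarrow>ls. (\<Sum>i<n. l i * (x i - 1))\<^sup>2)"
  proof (induction ls)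
    case Nil then show ?case by (simp add: sos_const)
  next
    case (Cons l ls)
    have "sos n (\<lambda>x. (\<Sum>i<n. l i * (x i - 1))\<^sup>2)" by (intro sos_square polynomial_intros) auto
    from sos_add[OF this Cons] show ?case by simp
  qed
  ultimately show ?thesis by (simp only:)
qed

text \<open>Second-order expansion at the point $1$ along the curve $(1 + sv)/\|1 + sv\|$ on the sphere.\<close>

lemma spectral_gap_if_coercive:
  fixes k :: "real poly"
  assumes coercive: "\<And>x. x \<in> orthant_sphere \<Longrightarrow>
      \<gamma> * E x - \<mu> * \<tau> x - (\<Sum>i<n. \<pi> i * (poly k (x i) * (x i - 1) ^ 3)) \<ge> 0"
    and v: "(\<Sum>i<n. \<pi> i * v i) = 0"
  shows "\<gamma> * E v \<ge> \<mu> * norm2 v"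
proof -
  define N where "N = norm2 v"
  have "N \<ge> 0" unfolding N_def pi_norm2_def by (intro sum_nonneg) (auto simp: pi_nonneg)
  have Npos: "1 + s\<^sup>2 * N > 0" for s :: real using \<open>N \<ge> 0\<close> by (simp add: add_pos_nonneg)
  define X where "X = (\<lambda>s i. (1 + s * v i) / sqrt (1 + s\<^sup>2 * N))"
  \<comment> \<open>\<open>E\<close> and \<tau> are quadratic in X - 1 = s z and the cubic term
    gains one more factor s, so division by s^2 and s -> 0 leave the form at v.\<close>
  define z where "z = (\<lambda>s i. (X s i - 1) / s)"
  have der: "((\<lambda>s. X s i) has_real_derivative v i) (at 0)" for i
    unfolding X_def using Npos[of 0] by (auto intro!: derivative_eq_intros)
  have zlim: "((\<lambda>s. z s i) \<longlongrightarrow> v i) (at 0)" for i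
    using der[of i] unfolding has_field_derivative_iff z_def by (simp add: X_def)
  have Xlim: "((\<lambda>s. X s i) \<longlongrightarrow> 1) (at 0)" for i
    using DERIV_isCont[OF der[of i]] by (simp add: isCont_def X_def)
  have "\<forall>\<^sub>F s in at 0. \<forall>i\<in>{..<n}. X s i > 0"
    by (intro eventually_ball_finite) (auto intro: order_tendstoD(1)[OF Xlim])
  then have ev: "\<forall>\<^sub>F s in at 0. 0 \<le> \<gamma> * E (z s) - \<mu> * norm2 (z s) - s * (\<Sum>i<n. \<pi> i * (poly k (X s i) * z s i ^ 3))"
    using eventually_neq_at_within[of 0]
  proof eventually_elim
    case (elim s)
    have Xz: "X s i - 1 = s * z s i" for i using elim by (simp add: z_def)
    have "norm2 (X s) = (\<Sum>i<n. \<pi> i + 2 * s * (\<pi> i * v i) + s\<^sup>2 * (\<pi> i * (v i)\<^sup>2)) / (1 + s\<^sup>2 * N)"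
      unfolding pi_norm2_def X_def sum_divide_distrib
      using Npos[of s] by (intro sum.cong refl) (simp add: power_divide power2_eq_square algebra_simps add_divide_distrib)
    also have "(\<Sum>i<n. \<pi> i + 2 * s * (\<pi> i * v i) + s\<^sup>2 * (\<pi> i * (v i)\<^sup>2)) = 1 + s\<^sup>2 * N"
      by (simp add: sum.distrib pi_sum v N_def pi_norm2_def flip: sum_distrib_left)
    finally have "X s \<in> orthant_sphere"
      using elim Npos[of s] by (auto simp: orthant_sphere_def less_imp_le)
    from coercive[OF this]
    have "\<gamma> * E (X s) - \<mu> * \<tau> (X s) - (\<Sum>i<n. \<pi> i * (poly k (X s i) * (X s i - 1) ^ 3)) \<ge> 0" .
    moreover have "E (X s) = s\<^sup>2 * E (z s)"
    proof -
      have "X s i - X s j = s * (z s i - z s j)" for i j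
        using Xz[of i] Xz[of j] by (simp add: algebra_simps)
      then have "(X s i - X s j)\<^sup>2 = s\<^sup>2 * (z s i - z s j)\<^sup>2" for i j by (simp add: power_mult_distrib)
      then show ?thesis by (simp add: dirichlet_def sum_distrib_left mult_ac)
    qed
    moreover have "\<tau> (X s) = s\<^sup>2 * norm2 (z s)"
      unfolding \<tau>_def Xz by (simp add: pi_norm2_def power_mult_distrib sum_distrib_left mult_ac)
    moreover have "(\<Sum>i<n. \<pi> i * (poly k (X s i) * (X s i - 1) ^ 3))
        = s\<^sup>2 * (s * (\<Sum>i<n. \<pi> i * (poly k (X s i) * z s i ^ 3)))"
      unfolding Xz power_mult_distrib sum_distrib_left
      by (intro sum.cong refl) (simp add: power2_eq_square power3_eq_cube mult_ac)
    ultimately have "s\<^sup>2 * (\<gamma> * E (z s) - \<mu> * norm2 (z s) - s * (\<Sum>i<n. \<pi> i * (poly k (X s i) * z s i ^ 3))) \<ge> 0"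
      by (simp add: algebra_simps)
    then show ?case using elim by (simp add: zero_le_mult_iff)
  qed
  have "((\<lambda>s. \<gamma> * E (z s) - \<mu> * norm2 (z s) - s * (\<Sum>i<n. \<pi> i * (poly k (X s i) * z s i ^ 3)))
      \<longlongrightarrow> \<gamma> * E v - \<mu> * norm2 v - 0 * (\<Sum>i<n. \<pi> i * (poly k 1 * v i ^ 3))) (at 0)"
    unfolding dirichlet_def pi_norm2_def by (intro tendsto_intros zlim Xlim)
  from tendsto_lowerbound[OF this ev] show ?thesis by simp
qed

text \<open>h(t) = h(1) + (t-1) k(t) separates the second-order part of the polynomial from a cubic
  remainder; t^2 - 1 averages to the sphere equation.\<close>

lemma coercive_expansion:
  fixes h :: "real poly"
  defines "k \<equiv> synthetic_div h 1"
  shows "\<gamma> * E x - (\<Sum>i<n. \<pi> i * poly ([:-1, 0, 1:] + [:1, -2, 1:] * h) (x i))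
    = \<gamma> * E x - poly h 1 * \<tau> x - (\<Sum>i<n. \<pi> i * (poly k (x i) * (x i - 1) ^ 3)) - (norm2 x - 1)"
proof -
  have h: "poly h t = poly h 1 + (t - 1) * poly k t" for t
  proof -
    have "poly ([:-1, 1:] * k + [:poly h 1:]) t = poly h t"
      unfolding k_def using synthetic_div_correct'[of 1 h] by simp
    then show ?thesis by (simp add: algebra_simps)
  qed
  have p: "poly ([:-1, 0, 1:] + [:1, -2, 1:] * h) t
      = (t\<^sup>2 - 1) + poly h 1 * (t - 1)\<^sup>2 + poly k t * (t - 1) ^ 3" for t
  proof -
    have "poly ([:-1, 0, 1:] + [:1, -2, 1:] * h) t = (t\<^sup>2 - 1) + (t - 1)\<^sup>2 * poly h t"
      by (simp add: power2_eq_square algebra_simps)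
    then show ?thesis unfolding h[of t] by (simp add: power2_eq_square power3_eq_cube algebra_simps)
  qed
  have "(\<Sum>i<n. \<pi> i * poly ([:-1, 0, 1:] + [:1, -2, 1:] * h) (x i))
      = (\<Sum>i<n. \<pi> i * ((x i)\<^sup>2 - 1)) + poly h 1 * \<tau> x + (\<Sum>i<n. \<pi> i * (poly k (x i) * (x i - 1) ^ 3))"
    unfolding p \<tau>_def sum_distrib_left sum.distrib[symmetric]
    by (intro sum.cong refl) (simp add: algebra_simps)
  then show ?thesis unfolding sum_pi_squares by simp
qed

text \<open>Near the point 1, s is close to 1 and the form with margin \<open>c\<close> controls the
  cubic remainder; away from it s is small and \<open>f\<close> is bounded below by c \<tau>. One
  half of the margin is spent in the \<open>H i\<close>, the other in \<open>G\<close>.\<close>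

lemma quadratic_module_if_coercive:
  fixes h :: "real poly" and \<gamma> :: real
  defines "f \<equiv> \<lambda>x. \<gamma> * E x - (\<Sum>i<n. \<pi> i * poly ([:-1, 0, 1:] + [:1, -2, 1:] * h) (x i))"
  assumes "c > 0" and coercive: "\<And>x. x \<in> orthant_sphere \<Longrightarrow> f x \<ge> c * \<tau> x"
  shows "quadratic_module n \<pi> f"
proof -
  define k where "k = synthetic_div h 1"
  \<comment> \<open>The margin is built into the form, so that coercivity becomes nonnegativity of
    \<gamma> E - \<mu> \<tau> minus the cubic remainder on the sphere.\<close>
  define \<mu> where "\<mu> = poly h 1 + c"
  define cub where "cub = (\<lambda>x. \<Sum>i<n. \<pi> i * (poly k (x i) * (x i - 1) ^ 3))"
  have f: "f x = \<gamma> * E x - poly h 1 * \<tau> x - cub x - (norm2 x - 1)" for x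
    unfolding f_def cub_def k_def by (rule coercive_expansion)
  have "\<mu> * norm2 v \<le> \<gamma> * E v" if "(\<Sum>i<n. \<pi> i * v i) = 0" for v
  proof (rule spectral_gap_if_coercive[OF _ that])
    fix x assume x: "x \<in> orthant_sphere"
    then have "norm2 x = 1" by (simp add: orthant_sphere_def)
    then show "\<gamma> * E x - \<mu> * \<tau> x - (\<Sum>i<n. \<pi> i * (poly k (x i) * (x i - 1) ^ 3)) \<ge> 0"
      using coercive[OF x] unfolding f cub_def \<mu>_def by (simp add: algebra_simps)
  qed
  then have sosQ: "sos n (\<lambda>x. \<gamma> * E x - \<mu> * \<tau> x + \<mu> * (dev x)\<^sup>2)" by (rule sos_if_spectral_gap)

  have "bounded (poly k ` {0..coord_bound})"
    by (intro compact_imp_bounded compact_continuous_image continuous_intros) auto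
  then obtain \<kappa> where "\<kappa> > 0" and \<kappa>: "\<And>t. t \<in> {0..coord_bound} \<Longrightarrow> \<bar>poly k t\<bar> \<le> \<kappa>"
    unfolding bounded_pos by auto
  \<comment> \<open>Made for \<kappa> u <= c/4 + \<kappa>^2 u^2 / c combined with u^2 <=
    \<open>coord_bound\<close> \<tau>, where u = |x_i - 1|; this leaves \<open>H i\<close> at least
    c/4.\<close>
  define C where "C = coord_bound * \<kappa>\<^sup>2 / c"
  define H where "H = (\<lambda>i x. c / 2 + C * \<tau> x - poly k (x i) * (x i - 1))"
  have H: "quadratic_module n \<pi> (H i)" if i: "i < n" for i
  proof (rule positivstellensatz_sphere_orthant)
    show "polynomial n (H i)"
      unfolding H_def by (intro polynomial_intros polynomial_tau i)
    fix x assume "\<And>i. i < n \<Longrightarrow> x i \<ge> 0" "norm2 x = 1"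
    then have x: "x \<in> orthant_sphere" by (simp add: orthant_sphere_def)
    define u where "u = \<bar>x i - 1\<bar>"
    have "x i \<in> {0..coord_bound}" using orthant_sphere_coordinate[OF x i] le_coord_boundI[OF i] by simp
    from \<kappa>[OF this] have "\<bar>poly k (x i) * (x i - 1)\<bar> \<le> \<kappa> * u"
      unfolding abs_mult u_def by (intro mult_right_mono) auto
    moreover have "\<kappa>\<^sup>2 / c * u\<^sup>2 \<le> C * \<tau> x"
    proof -
      have "u\<^sup>2 * 1 \<le> u\<^sup>2 * (coord_bound * \<pi> i)" by (rule mult_left_mono[OF coord_bound_ge[OF i]]) simp
      also have "\<dots> = coord_bound * (\<pi> i * (x i - 1)\<^sup>2)" by (simp add: u_def)
      also have "\<dots> \<le> coord_bound * \<tau> x"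
        unfolding \<tau>_def using i coord_bound_ge_1 by (intro mult_left_mono member_le_sum) (auto simp: pi_nonneg)
      finally have "\<kappa>\<^sup>2 / c * u\<^sup>2 \<le> \<kappa>\<^sup>2 / c * (coord_bound * \<tau> x)"
        using \<open>c > 0\<close> by (intro mult_left_mono) auto
      then show ?thesis by (simp add: C_def mult_ac)
    qed
    moreover have "c / 2 + \<kappa>\<^sup>2 / c * u\<^sup>2 - \<kappa> * u = (\<kappa> * u - c / 2)\<^sup>2 / c + c / 4"
      using \<open>c > 0\<close> by (simp add: power2_eq_square field_simps)
    moreover have "(\<kappa> * u - c / 2)\<^sup>2 / c \<ge> 0" using \<open>c > 0\<close> by simp
    ultimately show "H i x > 0" unfolding H_def using \<open>c > 0\<close> by linarith
  qed (rule pi_pos)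

  \<comment> \<open>Collects the \<tau>^2 terms, \<open>C\<close> from the \<open>H i\<close> and
    \<mu>/4 from the squared mean; \<open>G\<close> carries them with the opposite sign.\<close>
  define C' where "C' = C + \<mu> / 4"
  obtain N :: nat where N: "2 * \<bar>C'\<bar> / c < real N" using reals_Archimedean2 by blast
  define s where "s = (\<lambda>x. (1 - \<tau> x / 4) ^ (2 * N))"
  define g where "g = (\<lambda>x. 1 / 4 * (\<Sum>j<2 * N. (1 - \<tau> x / 4) ^ j))"
  have ptau4: "polynomial n (\<lambda>x. 1 - \<tau> x / 4)"
    using polynomial_diff[OF polynomial_const polynomial_mult[OF polynomial_const[of n "1/4"] polynomial_tau], of 1] by simp
  have sos_s: "sos n s" unfolding s_def by (rule sos_even_power[OF ptau4])
  have sg: "1 - s x = \<tau> x * g x" for x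
    unfolding s_def g_def using one_diff_power_eq[of "1 - \<tau> x / 4" "2 * N"] by simp
  have pf: "polynomial n f" unfolding f_def by (intro polynomial_intros) auto
  \<comment> \<open>\<open>g\<close> is (1 - s)/\<tau> as a geometric sum, so \<tau> G = (1 - s) f +
    s (c/2 \<tau> - C' \<tau>^2) with \<open>G\<close> a polynomial. The choice of \<open>N\<close>
    makes the decay of s beat C' \<tau>.\<close>
  define G where "G = (\<lambda>x. g x * f x + s x * (c / 2 - C' * \<tau> x))"
  have G: "quadratic_module n \<pi> G"
  proof (rule positivstellensatz_sphere_orthant)
    have "polynomial n g" unfolding g_def by (intro polynomial_intros ptau4)
    then show "polynomial n G"
      unfolding G_def by (intro polynomial_intros pf polynomial_tau sos_polynomial[OF sos_s])
    fix x assume "\<And>i. i < n \<Longrightarrow> x i \<ge> 0" "norm2 x = 1"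
    then have x: "x \<in> orthant_sphere" by (simp add: orthant_sphere_def)
    note t = tau_nonneg[of x] tau_le_2[OF x]
    have "g x \<ge> 0" unfolding g_def using t by (intro mult_nonneg_nonneg sum_nonneg) auto
    then have "g x * f x \<ge> g x * (c * \<tau> x)" using coercive[OF x] by (intro mult_left_mono)
    also have "g x * (c * \<tau> x) = c * (1 - s x)" unfolding sg by simp
    finally have 1: "G x \<ge> c - s x * (c / 2 + C' * \<tau> x)"
      unfolding G_def by (simp add: algebra_simps)
    have s0: "s x \<ge> 0" unfolding s_def by simp
    have "s x \<le> 1 / (1 + real (2 * N) * (\<tau> x / 4))"
      unfolding s_def using t by (intro power_le_inverse_linear) auto
    then have s1: "s x * (1 + real N * \<tau> x / 2) \<le> 1"
      using t by (simp add: pos_le_divide_eq add_pos_nonneg)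
    have "\<bar>C'\<bar> \<le> c * (real N / 2)" using N \<open>c > 0\<close> by (simp add: field_simps)
    then have "C' * \<tau> x \<le> (c * (real N / 2)) * \<tau> x" using t by (intro mult_right_mono) auto
    then have "s x * (c / 2 + C' * \<tau> x) \<le> s x * (c * (1 + real N * \<tau> x / 2) - c / 2)"
      using s0 by (intro mult_left_mono) (auto simp: algebra_simps)
    also have "\<dots> = c * (s x * (1 + real N * \<tau> x / 2)) - c / 2 * s x" by (simp add: algebra_simps)
    also have "\<dots> \<le> c * 1 - c / 2 * s x" using s1 \<open>c > 0\<close> by simp
    finally have 2: "s x * (c / 2 + C' * \<tau> x) \<le> c - c / 2 * s x" by simp
    \<comment> \<open>The bounds give G >= c s / 2, which is positive unless s = 0; in that case the
      first bound alone gives G >= c.\<close>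
    show "G x > 0"
    proof (cases "s x = 0")
      case True then show ?thesis using 1 \<open>c > 0\<close> by simp
    next
      case False
      then have "c / 2 * s x > 0" using s0 \<open>c > 0\<close> by simp
      then show ?thesis using 1 2 by linarith
    qed
  qed (rule pi_pos)

  \<comment> \<open>Everything multiplying the sphere equation: -1 from the average of t^2 - 1, the
    rest from dev = ((norm2 - 1) - \<tau>)/2.\<close>
  define \<psi> where "\<psi> = (\<lambda>x. s x * (- 1 - \<mu> / 4 * ((norm2 x - 1) - 2 * \<tau> x)))"
  have "quadratic_module n \<pi> (\<lambda>x. \<tau> x * G x + (s x * (\<gamma> * E x - \<mu> * \<tau> x + \<mu> * (dev x)\<^sup>2)
      + ((\<Sum>i<n. (s x * (\<pi> i * (x i - 1)\<^sup>2)) * H i x) + \<psi> x * (norm2 x - 1))))"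
  proof (intro quadratic_module_add quadratic_module_sum)
    show "quadratic_module n \<pi> (\<lambda>x. \<tau> x * G x)" by (rule quadratic_module_sos_mult[OF sos_tau G])
    show "quadratic_module n \<pi> (\<lambda>x. s x * (\<gamma> * E x - \<mu> * \<tau> x + \<mu> * (dev x)\<^sup>2))"
      by (intro quadratic_module_of_sos sos_mult sos_s sosQ)
    show "quadratic_module n \<pi> (\<lambda>x. (s x * (\<pi> i * (x i - 1)\<^sup>2)) * H i x)" if "i \<in> {..<n}" for i
      using that by (intro quadratic_module_sos_mult H sos_mult sos_s sos_const sos_square polynomial_intros)
        (auto simp: pi_nonneg)
    show "quadratic_module n \<pi> (\<lambda>x. \<psi> x * (norm2 x - 1))"
      unfolding \<psi>_def by (intro quadratic_module_ideal polynomial_intros polynomial_tau sos_polynomial[OF sos_s])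
  qed
  moreover have "\<tau> x * G x + (s x * (\<gamma> * E x - \<mu> * \<tau> x + \<mu> * (dev x)\<^sup>2)
      + ((\<Sum>i<n. (s x * (\<pi> i * (x i - 1)\<^sup>2)) * H i x) + \<psi> x * (norm2 x - 1))) = f x" for x
  proof -
    have Hs: "(\<Sum>i<n. (s x * (\<pi> i * (x i - 1)\<^sup>2)) * H i x) = s x * ((c / 2 + C * \<tau> x) * \<tau> x - cub x)"
    proof -
      define w where "w = c / 2 + C * \<tau> x"
      have "(s x * (\<pi> i * (x i - 1)\<^sup>2)) * H i x
          = s x * (w * (\<pi> i * (x i - 1)\<^sup>2) - \<pi> i * (poly k (x i) * (x i - 1) ^ 3))" for i
        unfolding H_def w_def[symmetric] by (simp add: power2_eq_square power3_eq_cube algebra_simps)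
      then have "(\<Sum>i<n. (s x * (\<pi> i * (x i - 1)\<^sup>2)) * H i x) = s x * (w * \<tau> x - cub x)"
        unfolding \<tau>_def cub_def by (simp only: sum_subtractf flip: sum_distrib_left)
      then show ?thesis unfolding w_def .
    qed
    have dev: "\<mu> * (dev x)\<^sup>2 = \<mu> * \<tau> x * \<tau> x / 4 + (norm2 x - 1) * (\<mu> / 4 * ((norm2 x - 1) - 2 * \<tau> x))"
    proof -
      have "\<mu> * ((M - t) / 2)\<^sup>2 = \<mu> * t * t / 4 + M * (\<mu> / 4 * (M - 2 * t))" for M t :: real
        by (simp add: power2_eq_square field_simps)
      moreover have "dev x = ((norm2 x - 1) - \<tau> x) / 2" using norm2_tau[of x] by simp
      ultimately show ?thesis by (simp only:)
    qed
    have "s x * f x = s x * (\<gamma> * E x - \<mu> * \<tau> x + \<mu> * (dev x)\<^sup>2) + s x * (c * \<tau> x - \<mu> * \<tau> x * \<tau> x / 4 - cub x)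
        + \<psi> x * (norm2 x - 1)"
    proof -
      have "s' * (a - h1 * t - cb - M) = s' * (a - \<mu> * t + D) + s' * (c * t - \<mu> * t * t / 4 - cb)
          + s' * (- 1 - \<mu> / 4 * (M - 2 * t)) * M"
        if "D = \<mu> * t * t / 4 + M * (\<mu> / 4 * (M - 2 * t))" "h1 = \<mu> - c" for s' a h1 t cb M D :: real
        unfolding that by (simp add: algebra_simps)
      from this[OF dev, of "poly h 1"] show ?thesis unfolding f \<psi>_def by (simp add: \<mu>_def)
    qed
    moreover have "\<tau> x * G x = (1 - s x) * f x + s x * (c / 2 * \<tau> x - C' * \<tau> x * \<tau> x)"
      unfolding G_def sg by (simp add: algebra_simps)
    moreover have "s x * (c / 2 * \<tau> x - C' * \<tau> x * \<tau> x) + s x * ((c / 2 + C * \<tau> x) * \<tau> x - cub x)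
        = s x * (c * \<tau> x - \<mu> * \<tau> x * \<tau> x / 4 - cub x)"
      unfolding C'_def by (simp add: algebra_simps)
    ultimately show ?thesis unfolding Hs by (simp add: algebra_simps)
  qed
  ultimately show ?thesis by simp
qed

section \<open>Feasible values are logarithmic Sobolev constants\<close>

lemma entropy_on_sphere:
  assumes "x \<in> orthant_sphere"
  shows "entropy n \<pi> x = (\<Sum>i<n. \<pi> i * (2 * (x i)\<^sup>2 * ln (x i)))"
  unfolding entropy_def
proof (intro sum.cong refl)
  fix i assume "i \<in> {..<n}"
  then have "x i \<ge> 0" using orthant_sphere_coordinate(1)[OF assms] by simp
  moreover have "norm2 x = 1" using assms by (simp add: orthant_sphere_def)
  ultimately show "\<pi> i * (x i)\<^sup>2 * ln ((x i)\<^sup>2 / norm2 x) = \<pi> i * (2 * (x i)\<^sup>2 * ln (x i))"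
    by (cases "x i = 0") (simp_all add: ln_realpow)
qed

text \<open>Both sides are homogeneous of degree 2, and passing to |x| keeps the entropy and does
  not increase \<open>E\<close>.\<close>

lemma lsi_if_on_sphere:
  assumes "\<gamma> \<ge> 0" and sphere: "\<And>x. x \<in> orthant_sphere \<Longrightarrow> entropy n \<pi> x \<le> \<gamma> * E x"
  shows "entropy n \<pi> x \<le> \<gamma> * E x"
proof (cases "norm2 x = 0")
  case True
  \<comment> \<open>The entropy is 0 here, since division by 0 and \<open>ln 0\<close> both give
    0.\<close>
  then show ?thesis using assms(1) dirichlet_nonneg[of x] by (simp add: entropy_def)
next
  case False
  define N where "N = norm2 x"
  have "N \<ge> 0" unfolding N_def pi_norm2_def by (intro sum_nonneg) (auto simp: pi_nonneg)
  with False have "N > 0" by (simp add: N_def)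
  define y where "y = (\<lambda>i. \<bar>x i\<bar> / sqrt N)"
  have y2: "(y i)\<^sup>2 = (x i)\<^sup>2 / N" for i using \<open>N > 0\<close> by (simp add: y_def power_divide)
  have "norm2 y = norm2 x / N"
    unfolding pi_norm2_def y2 by (simp add: sum_divide_distrib)
  then have ny: "norm2 y = 1" using \<open>N > 0\<close> by (simp add: N_def)
  then have y: "y \<in> orthant_sphere" using \<open>N > 0\<close> by (simp add: orthant_sphere_def y_def)
  have "entropy n \<pi> x = N * entropy n \<pi> y"
    unfolding entropy_def ny y2 N_def[symmetric] sum_distrib_left
    using \<open>N > 0\<close> by (intro sum.cong refl) simp
  also have "\<dots> \<le> N * (\<gamma> * E y)" using sphere[OF y] \<open>N > 0\<close> by simp
  also have "\<dots> = \<gamma> * (N * E y)" by simp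
  also have "\<dots> \<le> \<gamma> * E x"
  proof (rule mult_left_mono)
    have "N * E y = 1 / 2 * (\<Sum>i<n. \<Sum>j<n. \<pi> i * K i j * (\<bar>x i\<bar> - \<bar>x j\<bar>)\<^sup>2)"
      using \<open>N > 0\<close> by (simp add: dirichlet_def y_def sum_distrib_left power_divide flip: diff_divide_distrib)
    also have "\<dots> \<le> E x"
      unfolding dirichlet_def
    proof (intro mult_left_mono sum_mono)
      fix i j assume "i \<in> {..<n}" "j \<in> {..<n}"
      then show "0 \<le> \<pi> i * K i j" by (simp add: pi_nonneg K_nonneg)
      have "\<bar>\<bar>x i\<bar> - \<bar>x j\<bar>\<bar> \<le> \<bar>x i - x j\<bar>" by simp
      then show "(\<bar>x i\<bar> - \<bar>x j\<bar>)\<^sup>2 \<le> (x i - x j)\<^sup>2" unfolding abs_le_square_iff .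
    qed simp
    finally show "N * E y \<le> E x" .
  qed (fact assms(1))
  finally show ?thesis .
qed

text \<open>A vector concentrated at one state has entropy log (1/\<pi>_0), positive because n >= 2.
  It forces admissible \<gamma> to be positive and keeps the supremum defining the constant
  finite.\<close>

lemma exists_positive_entropy: "\<exists>x\<in>orthant_sphere. entropy n \<pi> x > 0"
proof -
  have "0 < n" using n_ge_2 by simp
  note p = pi_pos[OF this] pi_less_1[OF this]
  define x where "x = (\<lambda>i::nat. if i = 0 then 1 / sqrt (\<pi> 0) else 0)"
  have "norm2 x = (\<Sum>i<n. if i = 0 then 1 else 0)"
    unfolding pi_norm2_def using p by (intro sum.cong) (auto simp: x_def power_divide)
  then have nx: "norm2 x = 1" using \<open>0 < n\<close> by simp
  then have "x \<in> orthant_sphere" using p by (auto simp: orthant_sphere_def x_def)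
  moreover have "entropy n \<pi> x = (\<Sum>i<n. if i = 0 then ln (1 / \<pi> 0) else 0)"
    unfolding entropy_def nx using p by (intro sum.cong) (auto simp: x_def power_divide)
  then have "entropy n \<pi> x > 0" using p \<open>0 < n\<close> by (simp add: ln_div)
  ultimately show ?thesis by blast
qed

lemma lsi_pos: assumes "\<And>x. entropy n \<pi> x \<le> \<gamma> * E x" shows "\<gamma> > 0"
proof -
  obtain x where "entropy n \<pi> x > 0" using exists_positive_entropy by blast
  then have "\<gamma> * E x > 0" using assms[of x] by simp
  then show ?thesis using dirichlet_nonneg[of x] by (auto simp: zero_less_mult_iff)
qed

text \<open>On the sphere x_i stays in the interval where 2 t^2 log t <= 2 t^2 r(t) <= p_i(t);
  averaging bounds the entropy by what is certified.\<close>

lemma feasible_imp_lsi: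
  assumes "pade_log m R S" "\<gamma> \<in> feasible_gammas n K \<pi> R S d m"
  shows "entropy n \<pi> x \<le> \<gamma> * E x"
proof -
  interpret pade m R S by unfold_locales fact
  from assms(2) obtain p where
    sp: "SOS_Spi n \<pi> d (\<lambda>x. \<gamma> * E x - (\<Sum>i<n. \<pi> i * poly (p i) (x i)))" and
    si: "\<And>i. i < n \<Longrightarrow> SOS_interval (d + nat \<lceil>real m / 2\<rceil>) 0 (1 / sqrt (\<pi> i)) (S * p i - [:0, 0, 2:] * [:-1, 1:] * R)"
    unfolding feasible_gammas_def by blast
  have sphere: "entropy n \<pi> x \<le> \<gamma> * E x" if x: "x \<in> orthant_sphere" for x
  proof -
    have "(\<Sum>i<n. \<pi> i * (2 * (x i)\<^sup>2 * ln (x i))) \<le> (\<Sum>i<n. \<pi> i * poly (p i) (x i))"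
    proof (intro sum_mono mult_left_mono)
      fix i assume "i \<in> {..<n}"
      then have i: "i < n" by simp
      show "0 \<le> \<pi> i" using i by (rule pi_nonneg)
      define t where "t = x i"
      have t: "t \<ge> 0" "\<pi> i * t\<^sup>2 \<le> 1" using orthant_sphere_coordinate[OF x i] by (auto simp: t_def)
      have "t\<^sup>2 \<le> (1 / sqrt (\<pi> i))\<^sup>2"
        using t pi_pos[OF i] by (simp add: power_divide pos_le_divide_eq mult.commute)
      then have "t \<le> 1 / sqrt (\<pi> i)" by (rule power2_le_imp_le) (use pi_pos[OF i] in simp)
      then have "poly (S * p i - [:0, 0, 2:] * [:-1, 1:] * R) t \<ge> 0"
        using si[OF i] t unfolding SOS_interval_def by simp
      moreover have "poly (S * p i - [:0, 0, 2:] * [:-1, 1:] * R) t = poly S t * (poly (p i) t - 2 * t\<^sup>2 * r t)"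
        using S_pos[OF t(1)] by (simp add: r_def field_simps power2_eq_square)
      ultimately have "poly S t * (poly (p i) t - 2 * t\<^sup>2 * r t) \<ge> 0" by (simp only:)
      then have "poly (p i) t \<ge> 2 * t\<^sup>2 * r t"
        using S_pos[OF t(1)] by (simp add: zero_le_mult_iff)
      moreover have "2 * t\<^sup>2 * ln t \<le> 2 * t\<^sup>2 * r t"
        using ln_le_r[of t] t by (cases "t = 0") (auto intro!: mult_left_mono)
      ultimately show "2 * (x i)\<^sup>2 * ln (x i) \<le> poly (p i) (x i)" unfolding t_def by linarith
    qed
    also have "\<dots> \<le> \<gamma> * E x"
      using SOS_Spi_nonneg[OF sp, of x] x by (simp add: orthant_sphere_def)
    finally show ?thesis unfolding entropy_on_sphere[OF x] .
  qed
  \<comment> \<open>The reduction to the sphere needs \<gamma> >= 0, which no constraint states; a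
    vector of positive entropy supplies it.\<close>
  obtain x0 where x0: "x0 \<in> orthant_sphere" "entropy n \<pi> x0 > 0" using exists_positive_entropy by blast
  then have "\<gamma> * E x0 > 0" using sphere[OF x0(1)] by simp
  then have "\<gamma> \<ge> 0" using dirichlet_nonneg[of x0] by (auto simp: zero_less_mult_iff)
  then show ?thesis by (rule lsi_if_on_sphere[OF _ sphere])
qed

text \<open>With mean a, \<tau> = 2 (1 - a) on the sphere, and 0 <= a <= 1 gives \<tau> <= 2 (1 -
  a^2), twice the variance. Nonnegativity is essential: the constant vector -1 has \<tau> = 4 and E
  = 0.\<close>

lemma tau_le_dirichlet:
  obtains C where "C > 0" "\<And>x. x \<in> orthant_sphere \<Longrightarrow> \<tau> x \<le> C * E x"
proof -
  obtain C where C: "C > 0" "\<And>i j. i < n \<Longrightarrow> j < n \<Longrightarrow> sos_mpoly n 1 (\<lambda>x. C * E x - (x i - x j)\<^sup>2)"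
    using poincare_sos by blast
  have "\<tau> x \<le> C * E x" if x: "x \<in> orthant_sphere" for x
  proof -
    define a where "a = (\<Sum>i<n. \<pi> i * x i)"
    have "norm2 x = 1" using x by (simp add: orthant_sphere_def)
    have "dev x = a - 1" by (simp add: dev_def a_def right_diff_distrib sum_subtractf pi_sum)
    then have t: "\<tau> x = 2 * (1 - a)" using norm2_tau[of x] \<open>norm2 x = 1\<close> by simp
    then have "0 \<le> a" "a \<le> 1" using tau_nonneg[of x] tau_le_2[OF x] by auto
    then have "a\<^sup>2 \<le> a" by (simp add: power2_eq_square mult_left_le)
    then have "\<tau> x \<le> 2 * (norm2 x - a\<^sup>2)" using t \<open>norm2 x = 1\<close> by simp
    also have "\<dots> = (\<Sum>i<n. \<Sum>j<n. \<pi> i * \<pi> j * (x i - x j)\<^sup>2)"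
      unfolding variance_identity a_def pi_norm2_def ..
    also have "\<dots> \<le> (\<Sum>i<n. \<Sum>j<n. \<pi> i * \<pi> j * (C * E x))"
    proof (intro sum_mono mult_left_mono)
      fix i j assume "i \<in> {..<n}" "j \<in> {..<n}"
      then show "(x i - x j)\<^sup>2 \<le> C * E x" using sos_mpoly_nonneg[OF C(2), of i j x] by simp
    qed (auto simp: pi_nonneg)
    also have "\<dots> = (\<Sum>i<n. \<Sum>j<n. \<pi> i * \<pi> j) * (C * E x)" by (simp only: sum_distrib_right)
    also have "(\<Sum>i<n. \<Sum>j<n. \<pi> i * \<pi> j) = 1" by (simp add: pi_sum flip: sum_product)
    finally show ?thesis by simp
  qed
  with C(1) show ?thesis using that by blast
qed

text \<open>\<open>m0\<close> is uniform over all Pade pairs, while \<open>d\<close> depends on the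
  polynomial approximating r_m; this matches the order of the two limits.\<close>

lemma eventually_feasible:
  assumes lsi: "\<And>x. entropy n \<pi> x \<le> \<gamma> * E x" and "\<epsilon> > 0"
  shows "\<exists>m0. \<forall>m\<ge>m0. \<forall>R S. pade_log m R S \<longrightarrow> (\<exists>d\<ge>2. \<gamma> + \<epsilon> \<in> feasible_gammas n K \<pi> R S d m)"
proof -
  obtain C where "C > 0" and C: "\<And>x. x \<in> orthant_sphere \<Longrightarrow> \<tau> x \<le> C * E x"
    using tau_le_dirichlet by blast
  \<comment> \<open>\<epsilon> E dominates (\<epsilon>/C) \<tau>. Half of that pays for the
    approximation error 2 \<eta> \<tau>, and the other half is the margin \<epsilon>/(2C).\<close>
  define \<eta> where "\<eta> = \<epsilon> / (4 * C)"
  have "\<eta> > 0" using \<open>\<epsilon> > 0\<close> \<open>C > 0\<close> by (simp add: \<eta>_def)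
  \<comment> \<open>Makes m positive and the Pade error of \<open>sq_r_le\<close> at most \<eta>
    (t-1)^2.\<close>
  obtain m0 :: nat where m0: "real m0 > max 0 (coord_bound\<^sup>2 / (2 * \<eta>))" using reals_Archimedean2 by blast
  have "\<exists>d\<ge>2. \<gamma> + \<epsilon> \<in> feasible_gammas n K \<pi> R S d m" if m: "m \<ge> m0" and pl: "pade_log m R S" for m R S
  proof -
    interpret pade m R S by unfold_locales fact
    have "m > 0" using m m0 by auto
    have "coord_bound\<^sup>2 / (2 * \<eta>) < real m" using m m0 by linarith
    then have Bm: "coord_bound\<^sup>2 / (2 * real m) \<le> \<eta>" using \<open>m > 0\<close> \<open>\<eta> > 0\<close> by (simp add: field_simps)
    \<comment> \<open>2 t^2 r - (t^2 - 1) = (t - 1) (2 t^2 R - (t + 1) S) / S, and the bracket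
      vanishes at 1, so a second factor t - 1 splits off.\<close>
    have "poly ([:0, 0, 2:] * R - [:1, 1:] * S) 1 = 0"
      using pade_log_numerator_at_one[OF pl] pl by (simp add: pade_log_def)
    then obtain Z where Z: "[:0, 0, 2:] * R - [:1, 1:] * S = [:-1, 1:] * Z"
      unfolding poly_eq_0_iff_dvd dvd_def by blast
    have rZ: "2 * t\<^sup>2 * r t = (t\<^sup>2 - 1) + (t - 1)\<^sup>2 * (poly Z t / poly S t)" if "t \<ge> 0" for t
    proof -
      have "poly ([:0, 0, 2:] * R - [:1, 1:] * S) t = (t - 1) * poly Z t" unfolding Z by (simp add: algebra_simps)
      then have *: "(t - 1) * poly Z t = 2 * t\<^sup>2 * poly R t - (t + 1) * poly S t"
        by (simp add: power2_eq_square algebra_simps)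
      have "(t - 1)\<^sup>2 * (poly Z t / poly S t) = (t - 1) * ((t - 1) * poly Z t) / poly S t"
        by (simp add: power2_eq_square)
      also have "\<dots> = 2 * t\<^sup>2 * r t - (t\<^sup>2 - 1)"
        unfolding * r_def using S_pos[OF that] by (simp add: field_simps power2_eq_square)
      finally show ?thesis by simp
    qed
    \<comment> \<open>Approximating the quotient raised by \<eta>/2 up to \<eta>/2 gives a
      polynomial above the quotient by at most \<eta>; the weight (t-1)^2 turns this into the bounds
      \<open>above\<close> and \<open>below\<close>.\<close>
    have "continuous_on {0..coord_bound} (\<lambda>t. poly Z t / poly S t + \<eta> / 2)"
      using S_pos by (intro continuous_intros) fastforce
    then obtain q where "real_polynomial_function q"
      and q: "\<And>t. t \<in> {0..coord_bound} \<Longrightarrow> \<bar>poly Z t / poly S t + \<eta> / 2 - q t\<bar> < \<eta> / 2"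
      using Stone_Weierstrass_real_polynomial_function[of "{0..coord_bound}" _ "\<eta> / 2"] \<open>\<eta> > 0\<close> by auto
    then obtain a N where aN: "q = (\<lambda>t. \<Sum>i\<le>N. a i * t ^ i)"
      unfolding real_polynomial_function_iff_sum by blast
    define h where "h = (\<Sum>i\<le>N. monom (a i) i)"
    have hq: "poly h t = q t" for t by (simp add: h_def aN poly_sum poly_monom)
    define p where "p = [:-1, 0, 1:] + [:1, -2, 1:] * h"
    have p: "poly p t = (t\<^sup>2 - 1) + (t - 1)\<^sup>2 * poly h t" for t
      by (simp add: p_def power2_eq_square algebra_simps)
    have above: "2 * t\<^sup>2 * r t \<le> poly p t" and below: "poly p t \<le> 2 * t\<^sup>2 * ln t + 2 * \<eta> * (t - 1)\<^sup>2"
      if t: "0 \<le> t" "t \<le> coord_bound" for t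
    proof -
      have h: "poly Z t / poly S t \<le> poly h t" "poly h t \<le> poly Z t / poly S t + \<eta>"
        using q[of t] t unfolding hq atLeastAtMost_iff abs_less_iff by linarith+
      show "2 * t\<^sup>2 * r t \<le> poly p t"
        unfolding p rZ[OF t(1)] using mult_left_mono[OF h(1), of "(t - 1)\<^sup>2"] by simp
      have "poly p t \<le> 2 * t\<^sup>2 * r t + \<eta> * (t - 1)\<^sup>2"
        unfolding p rZ[OF t(1)] using mult_left_mono[OF h(2), of "(t - 1)\<^sup>2"] by (simp add: algebra_simps)
      also have "2 * t\<^sup>2 * r t \<le> 2 * t\<^sup>2 * ln t + coord_bound\<^sup>2 / (2 * real m) * (t - 1)\<^sup>2"
        by (rule sq_r_le[OF t coord_bound_ge_1 \<open>m > 0\<close>])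
      also have "coord_bound\<^sup>2 / (2 * real m) * (t - 1)\<^sup>2 \<le> \<eta> * (t - 1)\<^sup>2"
        using Bm by (intro mult_right_mono) auto
      finally show "poly p t \<le> 2 * t\<^sup>2 * ln t + 2 * \<eta> * (t - 1)\<^sup>2" by simp
    qed
    have "quadratic_module n \<pi> (\<lambda>x. (\<gamma> + \<epsilon>) * E x - (\<Sum>i<n. \<pi> i * poly p (x i)))"
      unfolding p_def
    proof (rule quadratic_module_if_coercive)
      show "\<epsilon> / (2 * C) > 0" using \<open>\<epsilon> > 0\<close> \<open>C > 0\<close> by simp
      fix x assume x: "x \<in> orthant_sphere"
      have "(\<Sum>i<n. \<pi> i * poly p (x i)) \<le> (\<Sum>i<n. \<pi> i * (2 * (x i)\<^sup>2 * ln (x i) + 2 * \<eta> * (x i - 1)\<^sup>2))"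
      proof (intro sum_mono mult_left_mono)
        fix i assume "i \<in> {..<n}"
        then have i: "i < n" by simp
        show "0 \<le> \<pi> i" using i by (rule pi_nonneg)
        show "poly p (x i) \<le> 2 * (x i)\<^sup>2 * ln (x i) + 2 * \<eta> * (x i - 1)\<^sup>2"
          using orthant_sphere_coordinate[OF x i] le_coord_boundI[OF i] by (intro below) auto
      qed
      also have "\<dots> = entropy n \<pi> x + 2 * \<eta> * \<tau> x"
        unfolding entropy_on_sphere[OF x] \<tau>_def sum_distrib_left sum.distrib[symmetric]
        by (intro sum.cong refl) (simp add: algebra_simps)
      also have "\<dots> \<le> \<gamma> * E x + 2 * \<eta> * \<tau> x" using lsi[of x] by simp
      finally have 1: "(\<Sum>i<n. \<pi> i * poly p (x i)) \<le> \<gamma> * E x + 2 * \<eta> * \<tau> x" .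
      have "\<epsilon> / C * \<tau> x \<le> \<epsilon> / C * (C * E x)"
        using C[OF x] \<open>\<epsilon> > 0\<close> \<open>C > 0\<close> by (intro mult_left_mono) auto
      then have 2: "\<epsilon> / C * \<tau> x \<le> \<epsilon> * E x" using \<open>C > 0\<close> by simp
      have 3: "\<epsilon> / C * \<tau> x = \<epsilon> / (2 * C) * \<tau> x + 2 * \<eta> * \<tau> x" by (simp add: \<eta>_def field_simps)
      show "\<epsilon> / (2 * C) * \<tau> x
          \<le> (\<gamma> + \<epsilon>) * E x - (\<Sum>i<n. \<pi> i * poly ([:-1, 0, 1:] + [:1, -2, 1:] * h) (x i))"
        using 1 2 3 unfolding p_def[symmetric] distrib_right by linarith
    qed
    moreover have "polynomial n (\<lambda>x. (\<gamma> + \<epsilon>) * E x - (\<Sum>i<n. \<pi> i * poly p (x i)))"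
      by (intro polynomial_intros) auto
    ultimately obtain d1 where d1: "SOS_Spi n \<pi> d1 (\<lambda>x. (\<gamma> + \<epsilon>) * E x - (\<Sum>i<n. \<pi> i * poly p (x i)))"
      using quadratic_module_imp_SOS_Spi by blast
    define d where "d = d1 + degree p + 2"
    have "SOS_Spi n \<pi> d (\<lambda>x. (\<gamma> + \<epsilon>) * E x - (\<Sum>i<n. \<pi> i * poly p (x i)))"
      by (rule SOS_Spi_mono[OF d1]) (simp add: d_def)
    moreover have "SOS_interval (d + nat \<lceil>real m / 2\<rceil>) 0 (1 / sqrt (\<pi> i)) (S * p - [:0, 0, 2:] * [:-1, 1:] * R)"
      if i: "i < n" for i
    proof (rule SOS_interval_if_above)
      show "degree p \<le> 2 * d" "d \<ge> 2" by (auto simp: d_def)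
      fix t :: real assume t: "0 \<le> t" "t \<le> 1 / sqrt (\<pi> i)"
      have "t\<^sup>2 \<le> (1 / sqrt (\<pi> i))\<^sup>2" using t by (intro power_mono)
      then have "\<pi> i * t\<^sup>2 \<le> 1" using pi_pos[OF i] by (simp add: power_divide field_simps)
      then show "2 * t\<^sup>2 * r t \<le> poly p t" using above[OF t(1)] le_coord_boundI[OF i] by simp
    qed
    ultimately have "\<gamma> + \<epsilon> \<in> feasible_gammas n K \<pi> R S d m"
      unfolding feasible_gammas_def by (intro CollectI exI[of _ "\<lambda>_. p"]) (auto simp: d_def)
    then show ?thesis by (intro exI[of _ d]) (simp add: d_def)
  qed
  then have "\<forall>m\<ge>m0. \<forall>R S. pade_log m R S \<longrightarrow> (\<exists>d\<ge>2. \<gamma> + \<epsilon> \<in> feasible_gammas n K \<pi> R S d m)"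
    by (intro allI impI)
  then show ?thesis by (rule exI)
qed

section \<open>Passage to the limit\<close>

lemma feasible_gammas_mono:
  assumes "d \<le> d'"
  shows "feasible_gammas n K \<pi> R S d m \<subseteq> feasible_gammas n K \<pi> R S d' m"
proof
  fix \<gamma> assume "\<gamma> \<in> feasible_gammas n K \<pi> R S d m"
  then obtain p where p: "\<forall>i<n. degree (p i) \<le> 2 * d"
    "SOS_Spi n \<pi> d (\<lambda>x. \<gamma> * E x - (\<Sum>i<n. \<pi> i * poly (p i) (x i)))"
    "\<forall>i<n. SOS_interval (d + nat \<lceil>real m / 2\<rceil>) 0 (1 / sqrt (\<pi> i)) (S * p i - [:0, 0, 2:] * [:-1, 1:] * R)"
    unfolding feasible_gammas_def by blast
  show "\<gamma> \<in> feasible_gammas n K \<pi> R S d' m"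
    unfolding feasible_gammas_def
  proof (intro CollectI exI[of _ p] conjI)
    show "\<forall>i<n. degree (p i) \<le> 2 * d'" using p(1) assms by fastforce
    show "SOS_Spi n \<pi> d' (\<lambda>x. \<gamma> * E x - (\<Sum>i<n. \<pi> i * poly (p i) (x i)))"
      by (rule SOS_Spi_mono[OF p(2) assms])
    show "\<forall>i<n. SOS_interval (d' + nat \<lceil>real m / 2\<rceil>) 0 (1 / sqrt (\<pi> i)) (S * p i - [:0, 0, 2:] * [:-1, 1:] * R)"
      using p(3) assms unfolding SOS_interval_def
      by (meson add_le_mono1 mult_le_mono2 order_trans)
  qed
qed

text \<open>The inequality is closed under infima of \<gamma>, so \<open>Inf \<Gamma>\<close> is
  itself a logarithmic Sobolev constant and hence positive.\<close>

lemma Inf_lsi_constants: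
  assumes "\<Gamma> \<noteq> {}" and lsi: "\<And>\<gamma> x. \<gamma> \<in> \<Gamma> \<Longrightarrow> entropy n \<pi> x \<le> \<gamma> * E x"
  shows "bdd_below \<Gamma>" "Inf \<Gamma> > 0" "1 / Inf \<Gamma> \<le> log_sobolev n K \<pi>"
proof -
  show bdd: "bdd_below \<Gamma>" using lsi_pos[OF lsi] by (intro bdd_belowI[of _ 0]) (auto simp: less_imp_le)
  have inf: "entropy n \<pi> x \<le> Inf \<Gamma> * E x" for x
  proof (cases "E x = 0")
    case True then show ?thesis using lsi[of _ x] assms(1) by auto
  next
    case False
    then have "E x > 0" using dirichlet_nonneg[of x] by simp
    then have "entropy n \<pi> x / E x \<le> Inf \<Gamma>"
      using lsi by (intro cInf_greatest[OF assms(1)]) (simp add: divide_le_eq)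
    then show ?thesis using \<open>E x > 0\<close> by (simp add: divide_le_eq)
  qed
  then show pos: "Inf \<Gamma> > 0" by (rule lsi_pos)
  have "bdd_above {a. \<forall>x. E x \<ge> a * entropy n \<pi> x}"
  proof -
    obtain x where x: "entropy n \<pi> x > 0" using exists_positive_entropy by blast
    show ?thesis
      using x by (intro bdd_aboveI[of _ "E x / entropy n \<pi> x"]) (auto simp: pos_le_divide_eq)
  qed
  then show "1 / Inf \<Gamma> \<le> log_sobolev n K \<pi>"
    unfolding log_sobolev_def using inf pos
    by (intro cSup_upper) (auto simp: divide_le_eq mult.commute)
qed

text \<open>The supremum is attained, since each admissible a is at most E/entropy wherever the
  entropy is positive.\<close>

lemma lsi_log_sobolev:
  assumes "log_sobolev n K \<pi> > 0"
  shows "entropy n \<pi> x \<le> 1 / log_sobolev n K \<pi> * E x"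
proof (cases "entropy n \<pi> x > 0")
  case True
  have "0 \<in> {a. \<forall>x. E x \<ge> a * entropy n \<pi> x}" by (simp add: dirichlet_nonneg)
  then have "log_sobolev n K \<pi> \<le> E x / entropy n \<pi> x"
    unfolding log_sobolev_def
  proof (intro cSup_least)
    show "a \<le> E x / entropy n \<pi> x" if "a \<in> {a. \<forall>x. E x \<ge> a * entropy n \<pi> x}" for a
      using that True by (simp add: pos_le_divide_eq)
  qed blast
  then show ?thesis using True assms by (simp add: field_simps)
next
  case False
  moreover have "0 \<le> 1 / log_sobolev n K \<pi> * E x" using assms dirichlet_nonneg[of x] by simp
  ultimately show ?thesis by linarith
qed

end

theorem mainTheorem1:
  fixes n :: nat and K :: "nat \<Rightarrow> nat \<Rightarrow> real" and \<pi> :: "nat \<Rightarrow> real"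
    and Rm Sm :: "nat \<Rightarrow> real poly"
  assumes "n \<ge> 2"
    and "markov_kernel n K" and "irreducible_kernel n K" and "stationary_dist n K \<pi>"
    and "\<And>m. pade_log m (Rm m) (Sm m)"
  shows "(\<forall>d m. d \<ge> 2 \<longrightarrow>
            feasible_gammas n K \<pi> (Rm m) (Sm m) d m \<noteq> {}
          \<and> bdd_below (feasible_gammas n K \<pi> (Rm m) (Sm m) d m)
          \<and> 0 < alpha_dm n K \<pi> (Rm m) (Sm m) d m
          \<and> alpha_dm n K \<pi> (Rm m) (Sm m) d m \<le> log_sobolev n K \<pi>)
      \<and> (\<exists>L :: nat \<Rightarrow> real.
            (\<forall>m. (\<lambda>d. alpha_dm n K \<pi> (Rm m) (Sm m) d m) \<longlonglongrightarrow> L m)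
          \<and> L \<longlonglongrightarrow> log_sobolev n K \<pi>)"
proof -
  interpret markov_chain n K \<pi> by unfold_locales (fact assms)+
  define \<alpha> where "\<alpha> = log_sobolev n K \<pi>"
  define \<Gamma> where "\<Gamma> = (\<lambda>d m. feasible_gammas n K \<pi> (Rm m) (Sm m) d m)"
  define A where "A = (\<lambda>d m. alpha_dm n K \<pi> (Rm m) (Sm m) d m)"
  have A: "A d m = 1 / Inf (\<Gamma> d m)" for d m by (simp add: A_def \<Gamma>_def alpha_dm_def)
  have ne: "\<Gamma> d m \<noteq> {}" if "d \<ge> 2" for d m
    unfolding \<Gamma>_def by (rule feasible_gamma_exists[OF assms(5) that])
  have lsi: "entropy n \<pi> x \<le> \<gamma> * E x" if "\<gamma> \<in> \<Gamma> d m" for d m \<gamma> x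
    using feasible_imp_lsi[OF assms(5)] that unfolding \<Gamma>_def by blast
  have bdd: "bdd_below (\<Gamma> d m)" and inf_pos: "Inf (\<Gamma> d m) > 0" and le: "A d m \<le> \<alpha>" if "d \<ge> 2" for d m
    using Inf_lsi_constants[OF ne[OF that] lsi] unfolding A \<alpha>_def by auto
  have pos: "A d m > 0" if "d \<ge> 2" for d m using inf_pos[OF that] by (simp add: A)
  have mono: "A d m \<le> A d' m" if "2 \<le> d" "d \<le> d'" for d d' m
  proof -
    have "Inf (\<Gamma> d' m) \<le> Inf (\<Gamma> d m)"
      using that feasible_gammas_mono[OF that(2)] by (intro cInf_superset_mono ne bdd) (auto simp: \<Gamma>_def)
    then show ?thesis unfolding A using inf_pos[of d' m] inf_pos[of d m] that by (simp add: frac_le)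
  qed
  have "\<alpha> > 0" using pos[of 2 0] le[of 2 0] by simp
  have "\<exists>l. (\<lambda>d. A d m) \<longlonglongrightarrow> l \<and> l \<le> \<alpha> \<and> (\<forall>d\<ge>2. A d m \<le> l)" for m
  proof -
    \<comment> \<open>A larger \<open>d\<close> enlarges the feasible set and so raises the value;
      the shift by 2 stays where feasibility is known.\<close>
    have inc: "incseq (\<lambda>d. A (d + 2) m)" by (intro incseq_SucI mono) auto
    obtain l where l: "(\<lambda>d. A (d + 2) m) \<longlonglongrightarrow> l" "\<forall>d. A (d + 2) m \<le> l"
      using incseq_convergent[OF inc, of \<alpha>] le by auto
    have "l \<le> \<alpha>" using l(1) by (rule LIMSEQ_le_const2) (use le in auto)
    moreover have "A d m \<le> l" if "d \<ge> 2" for d using l(2)[rule_format, of "d - 2"] that by (simp del: add_2_eq_Suc')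
    ultimately show ?thesis using l(1) LIMSEQ_offset[of "\<lambda>d. A d m" 2 l] by blast
  qed
  then have "\<forall>m. \<exists>l. (\<lambda>d. A d m) \<longlonglongrightarrow> l \<and> l \<le> \<alpha> \<and> (\<forall>d\<ge>2. A d m \<le> l)" by blast
  from choice[OF this] obtain L where "\<forall>m. (\<lambda>d. A d m) \<longlonglongrightarrow> L m \<and> L m \<le> \<alpha> \<and> (\<forall>d\<ge>2. A d m \<le> L m)"
    by (rule exE)
  then have L: "\<And>m. (\<lambda>d. A d m) \<longlonglongrightarrow> L m" "\<And>m. L m \<le> \<alpha>" "\<And>m d. d \<ge> 2 \<Longrightarrow> A d m \<le> L m"
    by blast+
  have "L \<longlonglongrightarrow> \<alpha>"
  proof (rule order_tendstoI)
    fix a assume "a < \<alpha>"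
    \<comment> \<open>Raising \<open>a\<close> to at least \<alpha>/2 makes 1/b meaningful when a <=
      0.\<close>
    define b where "b = max a (\<alpha> / 2)"
    have b: "0 < b" "a \<le> b" "b < \<alpha>" using \<open>a < \<alpha>\<close> \<open>\<alpha> > 0\<close> by (auto simp: b_def)
    define \<epsilon> where "\<epsilon> = (1 / b - 1 / \<alpha>) / 2"
    have "1 / \<alpha> < 1 / b" using b by (simp add: frac_less2)
    then have "\<epsilon> > 0" and \<epsilon>: "1 / \<alpha> + \<epsilon> < 1 / b" by (auto simp: \<epsilon>_def field_simps)
    have "entropy n \<pi> x \<le> 1 / \<alpha> * E x" for x
      unfolding \<alpha>_def by (rule lsi_log_sobolev) (use \<open>\<alpha> > 0\<close> in \<open>simp add: \<alpha>_def\<close>)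
    from eventually_feasible[OF this \<open>\<epsilon> > 0\<close>] obtain m0 where
      "\<forall>m\<ge>m0. \<forall>R S. pade_log m R S \<longrightarrow> (\<exists>d\<ge>2. 1 / \<alpha> + \<epsilon> \<in> feasible_gammas n K \<pi> R S d m)"
      by (rule exE)
    then have m0: "\<exists>d\<ge>2. 1 / \<alpha> + \<epsilon> \<in> \<Gamma> d m" if "m \<ge> m0" for m
      using that assms(5)[of m] unfolding \<Gamma>_def by blast
    \<comment> \<open>A single feasible degree suffices, because \<open>L m\<close> dominates
      \<open>A d m\<close> for every d >= 2.\<close>
    have "a < L m" if "m \<ge> m0" for m
    proof -
      obtain d where d: "d \<ge> 2" "1 / \<alpha> + \<epsilon> \<in> \<Gamma> d m" using m0[OF \<open>m \<ge> m0\<close>] by blast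
      have "Inf (\<Gamma> d m) \<le> 1 / \<alpha> + \<epsilon>" by (rule cInf_lower[OF d(2) bdd[OF d(1)]])
      then have "Inf (\<Gamma> d m) < 1 / b" using \<epsilon> by simp
      then have "b < A d m" using inf_pos[OF d(1), of m] b unfolding A by (simp add: field_simps)
      then show ?thesis using L(3)[OF d(1), of m] b by simp
    qed
    then show "\<forall>\<^sub>F m in sequentially. a < L m" by (auto simp: eventually_sequentially)
  next
    fix a assume "\<alpha> < a"
    then show "\<forall>\<^sub>F m in sequentially. L m < a" by (intro always_eventually allI le_less_trans[OF L(2)])
  qed
  with L(1) have "\<exists>L. (\<forall>m. (\<lambda>d. A d m) \<longlonglongrightarrow> L m) \<and> L \<longlonglongrightarrow> \<alpha>" by blast
  moreover have "\<forall>d m. d \<ge> 2 \<longrightarrow> \<Gamma> d m \<noteq> {} \<and> bdd_below (\<Gamma> d m) \<and> 0 < A d m \<and> A d m \<le> \<alpha>"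
    using ne bdd pos le by simp
  ultimately show ?thesis unfolding A_def \<Gamma>_def \<alpha>_def by (intro conjI)
qed

end
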